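(* Let $\mathcal E$ be a closed symmetric monoidal category. The following two 2-categories, both having as 0-cells the $\mathcal E$-categories that are tensored over $\mathcal E$, are 2-isomorphic: (a) the 2-category $\mathbf{StrongCat}$ of strong functors and strong natural transformations of tensored $\mathcal E$-categories; (b) the 2-category $\mathcal E\mathbf{-Cat}$ of $\mathcal E$-functors and $\mathcal E$-natural transformations of tensored $\mathcal E$-categories.
   Context: Let $(\mathcal E,\otimes,I)$ be closed symmetric monoidal. An $\mathcal E$-category $\mathcal A$ with internal homs $\underline{\mathcal A}(A,B)\in\mathcal E$ is tensored over $\mathcal E$ if each $\underline{\mathcal A}(A,-):\mathcal A\to\mathcal E$ has a left $\mathcal E$-adjoint $-\otimes A:\mathcal E\to\mathcal A$, with natural isomorphisms $l_A:I\otimes A\cong A$ and $a_{X,Y,A}:(X\otimes Y)\otimes A\cong X\otimes(Y\otimes A)$. Strong functor. For tensored $\mathcal E$-categories $\mathcal A,\mathcal B$, a strong functor $(T,\sigma):\mathcal A\to\mathcal B$ is a functor $T$ between the underlying categories together with a tensorial strength, i.e. a family $\sigma_{X,A}:X\otimes TA\to T(X\otimes A)$ natural in $X\in\mathcal E$ and $A\in\mathcal A$, satisfying the unit axiom $T(l_A)\circ\sigma_{I,A}=l_{TA}$ and the associativity axiom $T(a_{X,Y,A})\circ\sigma_{X\otimes Y,A}=\sigma_{X,Y\otimes A}\circ(X\otimes\sigma_{Y,A})\circ a_{X,Y,TA}$. The composite of $(T_1,\sigma_1):\mathcal A\to\mathcal B$ and $(T_2,\sigma_2):\mathcal B\to\mathcal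 C$ is $T_2T_1$ with strength $T_2(\sigma_1)\circ\sigma_2:X\otimes T_2T_1A\to T_2(X\otimes T_1A)\to T_2T_1(X\otimes A)$. Strong natural transformation. A strong natural transformation $\Psi:(T_1,\sigma_1)\Rightarrow(T_2,\sigma_2)$ is a natural transformation with $\Psi_{X\otimes A}\circ\sigma_1=\sigma_2\circ(X\otimes\Psi_A)$ for all $X\in\mathcal E$, $A\in\mathcal A$. An $\mathcal E$-functor $(T,\varphi)$ has enrichment maps $\varphi_{A,B}:\underline{\mathcal A}(A,B)\to\underline{\mathcal B}(TA,TB)$ compatible with units and composition; an $\mathcal E$-natural transformation $\alpha:F\Rightarrow G$ is a family $\alpha_A:FA\to GA$ with $\underline{\mathcal B}(1,\alpha_B)\circ\varphi_F=\underline{\mathcal B}(\alpha_A,1)\circ\varphi_G$ as maps $\underline{\mathcal A}(A,B)\to\underline{\mathcal B}(FA,GB)$. Two 2-categories are 2-isomorphic if there is an invertible (strict) 2-functor between them. *)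

theory Defs
  imports Main "HOL-Library.FuncSet"
begin

section \<open>Categories, functors, natural transformations\<close>

record ('o, 'a) category =
  ob :: "'o set"
  arr :: "'a set"
  src :: "'a \<Rightarrow> 'o"
  tgt :: "'a \<Rightarrow> 'o"
  ident :: "'o \<Rightarrow> 'a"
  cmp :: "'a \<Rightarrow> 'a \<Rightarrow> 'a"  (infixr "\<cdot>\<index>" 60)

definition hom :: "('o, 'a, 'm) category_scheme \<Rightarrow> 'o \<Rightarrow> 'o \<Rightarrow> 'a set" where
  "hom C X Y = {f \<in> arr C. src C f = X \<and> tgt C f = Y}"

definition is_category :: "('o, 'a, 'm) category_scheme \<Rightarrow> bool" where
  "is_category C \<longleftrightarrow>
     (\<forall>f\<in>arr C. src C f \<in> ob C \<and> tgt C f \<in> ob C) \<and>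
     (\<forall>X\<in>ob C. ident C X \<in> hom C X X) \<and>
     (\<forall>f\<in>arr C. \<forall>g\<in>arr C. tgt C f = src C g \<longrightarrow> g \<cdot>\<^bsub>C\<^esub> f \<in> hom C (src C f) (tgt C g)) \<and>
     (\<forall>f\<in>arr C. f \<cdot>\<^bsub>C\<^esub> ident C (src C f) = f \<and> ident C (tgt C f) \<cdot>\<^bsub>C\<^esub> f = f) \<and>
     (\<forall>f\<in>arr C. \<forall>g\<in>arr C. \<forall>h\<in>arr C. tgt C f = src C g \<longrightarrow> tgt C g = src C h \<longrightarrow>
        (h \<cdot>\<^bsub>C\<^esub> g) \<cdot>\<^bsub>C\<^esub> f = h \<cdot>\<^bsub>C\<^esub> (g \<cdot>\<^bsub>C\<^esub> f))"

definition is_inverse :: "('o, 'a, 'm) category_scheme \<Rightarrow> 'a \<Rightarrow> 'a \<Rightarrow> bool" where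
  "is_inverse C f g \<longleftrightarrow> f \<in> arr C \<and> g \<in> hom C (tgt C f) (src C f) \<and>
     g \<cdot>\<^bsub>C\<^esub> f = ident C (src C f) \<and> f \<cdot>\<^bsub>C\<^esub> g = ident C (tgt C f)"

definition is_iso :: "('o, 'a, 'm) category_scheme \<Rightarrow> 'a \<Rightarrow> bool" where
  "is_iso C f \<longleftrightarrow> (\<exists>g. is_inverse C f g)"

definition inv_arr :: "('o, 'a, 'm) category_scheme \<Rightarrow> 'a \<Rightarrow> 'a" where
  "inv_arr C f = (THE g. is_inverse C f g)"

record ('o, 'a, 'p, 'b) functor_data =
  fob :: "'o \<Rightarrow> 'p"
  farr :: "'a \<Rightarrow> 'b"

definition is_functor ::
  "('o, 'a, 'm) category_scheme \<Rightarrow> ('p, 'b, 'n) category_scheme \<Rightarrow>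
   ('o, 'a, 'p, 'b, 'r) functor_data_scheme \<Rightarrow> bool" where
  "is_functor C D F \<longleftrightarrow>
     (\<forall>X\<in>ob C. fob F X \<in> ob D) \<and>
     (\<forall>f\<in>arr C. farr F f \<in> hom D (fob F (src C f)) (fob F (tgt C f))) \<and>
     (\<forall>X\<in>ob C. farr F (ident C X) = ident D (fob F X)) \<and>
     (\<forall>f\<in>arr C. \<forall>g\<in>arr C. tgt C f = src C g \<longrightarrow>
        farr F (g \<cdot>\<^bsub>C\<^esub> f) = farr F g \<cdot>\<^bsub>D\<^esub> farr F f)"

definition is_natural ::
  "('o, 'a, 'm) category_scheme \<Rightarrow> ('p, 'b, 'n) category_scheme \<Rightarrow>
   ('o, 'a, 'p, 'b, 'r) functor_data_scheme \<Rightarrow> ('o, 'a, 'p, 'b, 's) functor_data_scheme \<Rightarrow>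
   ('o \<Rightarrow> 'b) \<Rightarrow> bool" where
  "is_natural C D F G \<alpha> \<longleftrightarrow>
     (\<forall>X\<in>ob C. \<alpha> X \<in> hom D (fob F X) (fob G X)) \<and>
     (\<forall>f\<in>arr C. \<alpha> (tgt C f) \<cdot>\<^bsub>D\<^esub> farr F f = farr G f \<cdot>\<^bsub>D\<^esub> \<alpha> (src C f))"

definition prod_category ::
  "('o, 'a, 'm) category_scheme \<Rightarrow> ('p, 'b, 'n) category_scheme \<Rightarrow> ('o \<times> 'p, 'a \<times> 'b) category" where
  "prod_category C D =
     \<lparr> ob = ob C \<times> ob D,
       arr = arr C \<times> arr D,
       src = (\<lambda>(f, g). (src C f, src D g)),
       tgt = (\<lambda>(f, g). (tgt C f, tgt D g)),
       ident = (\<lambda>(X, Y). (ident C X, ident D Y)),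
       cmp = (\<lambda>(f', g') (f, g). (f' \<cdot>\<^bsub>C\<^esub> f, g' \<cdot>\<^bsub>D\<^esub> g)) \<rparr>"


section \<open>Closed symmetric monoidal categories\<close>

record ('o, 'a) monoidal_category = "('o, 'a) category" +
  tens_ob :: "'o \<Rightarrow> 'o \<Rightarrow> 'o"  (infixr "\<otimes>\<index>" 70)
  tens_arr :: "'a \<Rightarrow> 'a \<Rightarrow> 'a"  (infixr "\<odot>\<index>" 70)
  unit_ob :: "'o"  ("\<I>\<index>")
  assoc :: "'o \<Rightarrow> 'o \<Rightarrow> 'o \<Rightarrow> 'a"
  lunit :: "'o \<Rightarrow> 'a"
  runit :: "'o \<Rightarrow> 'a"
  braid :: "'o \<Rightarrow> 'o \<Rightarrow> 'a"
  ihom :: "'o \<Rightarrow> 'o \<Rightarrow> 'o"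
  eval :: "'o \<Rightarrow> 'o \<Rightarrow> 'a"

text \<open>
  Orientations: \<open>assoc X Y Z : (X \<otimes> Y) \<otimes> Z \<rightarrow> X \<otimes> (Y \<otimes> Z)\<close>, \<open>lunit X : I \<otimes> X \<rightarrow> X\<close>,
  \<open>runit X : X \<otimes> I \<rightarrow> X\<close>, \<open>braid X Y : X \<otimes> Y \<rightarrow> Y \<otimes> X\<close>, \<open>eval X Y : [X,Y] \<otimes> X \<rightarrow> Y\<close>.
\<close>

definition is_symmetric_monoidal :: "('o, 'a, 'm) monoidal_category_scheme \<Rightarrow> bool" where
  "is_symmetric_monoidal E \<longleftrightarrow>
     is_category E \<and>
     is_functor (prod_category E E) E
       \<lparr> fob = (\<lambda>(X, Y). X \<otimes>\<^bsub>E\<^esub> Y), farr = (\<lambda>(f, g). f \<odot>\<^bsub>E\<^esub> g) \<rparr> \<and>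
     \<I>\<^bsub>E\<^esub> \<in> ob E \<and>
     \<comment> \<open>structural isomorphisms\<close>
     (\<forall>X\<in>ob E. \<forall>Y\<in>ob E. \<forall>Z\<in>ob E.
        assoc E X Y Z \<in> hom E ((X \<otimes>\<^bsub>E\<^esub> Y) \<otimes>\<^bsub>E\<^esub> Z) (X \<otimes>\<^bsub>E\<^esub> Y \<otimes>\<^bsub>E\<^esub> Z) \<and> is_iso E (assoc E X Y Z)) \<and>
     (\<forall>X\<in>ob E. lunit E X \<in> hom E (\<I>\<^bsub>E\<^esub> \<otimes>\<^bsub>E\<^esub> X) X \<and> is_iso E (lunit E X)) \<and>
     (\<forall>X\<in>ob E. runit E X \<in> hom E (X \<otimes>\<^bsub>E\<^esub> \<I>\<^bsub>E\<^esub>) X \<and> is_iso E (runit E X)) \<and>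
     (\<forall>X\<in>ob E. \<forall>Y\<in>ob E. braid E X Y \<in> hom E (X \<otimes>\<^bsub>E\<^esub> Y) (Y \<otimes>\<^bsub>E\<^esub> X)) \<and>
     \<comment> \<open>naturality\<close>
     (\<forall>f\<in>arr E. \<forall>g\<in>arr E. \<forall>h\<in>arr E.
        assoc E (tgt E f) (tgt E g) (tgt E h) \<cdot>\<^bsub>E\<^esub> ((f \<odot>\<^bsub>E\<^esub> g) \<odot>\<^bsub>E\<^esub> h) =
        (f \<odot>\<^bsub>E\<^esub> g \<odot>\<^bsub>E\<^esub> h) \<cdot>\<^bsub>E\<^esub> assoc E (src E f) (src E g) (src E h)) \<and>
     (\<forall>f\<in>arr E. lunit E (tgt E f) \<cdot>\<^bsub>E\<^esub> (ident E \<I>\<^bsub>E\<^esub> \<odot>\<^bsub>E\<^esub> f) = f \<cdot>\<^bsub>E\<^esub> lunit E (src E f)) \<and>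
     (\<forall>f\<in>arr E. runit E (tgt E f) \<cdot>\<^bsub>E\<^esub> (f \<odot>\<^bsub>E\<^esub> ident E \<I>\<^bsub>E\<^esub>) = f \<cdot>\<^bsub>E\<^esub> runit E (src E f)) \<and>
     (\<forall>f\<in>arr E. \<forall>g\<in>arr E.
        braid E (tgt E f) (tgt E g) \<cdot>\<^bsub>E\<^esub> (f \<odot>\<^bsub>E\<^esub> g) = (g \<odot>\<^bsub>E\<^esub> f) \<cdot>\<^bsub>E\<^esub> braid E (src E f) (src E g)) \<and>
     \<comment> \<open>pentagon\<close>
     (\<forall>W\<in>ob E. \<forall>X\<in>ob E. \<forall>Y\<in>ob E. \<forall>Z\<in>ob E.
        assoc E W X (Y \<otimes>\<^bsub>E\<^esub> Z) \<cdot>\<^bsub>E\<^esub> assoc E (W \<otimes>\<^bsub>E\<^esub> X) Y Z =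
        (ident E W \<odot>\<^bsub>E\<^esub> assoc E X Y Z) \<cdot>\<^bsub>E\<^esub> assoc E W (X \<otimes>\<^bsub>E\<^esub> Y) Z \<cdot>\<^bsub>E\<^esub>
          (assoc E W X Y \<odot>\<^bsub>E\<^esub> ident E Z)) \<and>
     \<comment> \<open>triangle\<close>
     (\<forall>X\<in>ob E. \<forall>Y\<in>ob E.
        (ident E X \<odot>\<^bsub>E\<^esub> lunit E Y) \<cdot>\<^bsub>E\<^esub> assoc E X \<I>\<^bsub>E\<^esub> Y = runit E X \<odot>\<^bsub>E\<^esub> ident E Y) \<and>
     \<comment> \<open>symmetry and hexagon\<close>
     (\<forall>X\<in>ob E. \<forall>Y\<in>ob E. braid E Y X \<cdot>\<^bsub>E\<^esub> braid E X Y = ident E (X \<otimes>\<^bsub>E\<^esub> Y)) \<and>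
     (\<forall>X\<in>ob E. \<forall>Y\<in>ob E. \<forall>Z\<in>ob E.
        assoc E Y Z X \<cdot>\<^bsub>E\<^esub> braid E X (Y \<otimes>\<^bsub>E\<^esub> Z) \<cdot>\<^bsub>E\<^esub> assoc E X Y Z =
        (ident E Y \<odot>\<^bsub>E\<^esub> braid E X Z) \<cdot>\<^bsub>E\<^esub> assoc E Y X Z \<cdot>\<^bsub>E\<^esub> (braid E X Y \<odot>\<^bsub>E\<^esub> ident E Z))"

definition is_closed_symmetric_monoidal :: "('o, 'a, 'm) monoidal_category_scheme \<Rightarrow> bool" where
  "is_closed_symmetric_monoidal E \<longleftrightarrow>
     is_symmetric_monoidal E \<and>
     (\<forall>X\<in>ob E. \<forall>Y\<in>ob E.
        ihom E X Y \<in> ob E \<and>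
        eval E X Y \<in> hom E (ihom E X Y \<otimes>\<^bsub>E\<^esub> X) Y \<and>
        (\<forall>Z\<in>ob E. bij_betw (\<lambda>g. eval E X Y \<cdot>\<^bsub>E\<^esub> (g \<odot>\<^bsub>E\<^esub> ident E X))
           (hom E Z (ihom E X Y)) (hom E (Z \<otimes>\<^bsub>E\<^esub> X) Y)))"


section \<open>Enriched categories\<close>

text \<open>
  \<open>ecmp \<A> A B C : \<A>(B,C) \<otimes> \<A>(A,B) \<rightarrow> \<A>(A,C)\<close> is the composition and \<open>eid \<A> A : I \<rightarrow> \<A>(A,A)\<close> the
  unit. The objects form a subset of an arbitrary type \<open>'x\<close>.
\<close>

record ('x, 'o, 'a) ecategory =
  eob :: "'x set"
  ehom :: "'x \<Rightarrow> 'x \<Rightarrow> 'o"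
  eid :: "'x \<Rightarrow> 'a"
  ecmp :: "'x \<Rightarrow> 'x \<Rightarrow> 'x \<Rightarrow> 'a"

record ('x, 'y, 'a) efunctor =
  eob_map :: "'x \<Rightarrow> 'y"
  ehom_map :: "'x \<times> 'x \<Rightarrow> 'a"

text \<open>
  Functors and transformations between enriched categories are required to be \<open>undefined\<close>
  outside the objects, so that equality of 1-cells and of 2-cells is equality in HOL.
\<close>

context
  fixes E :: "('o, 'a) monoidal_category" (structure)
begin

definition is_ecategory :: "('x, 'o, 'a, 'm) ecategory_scheme \<Rightarrow> bool" where
  "is_ecategory \<A> \<longleftrightarrow>
     (\<forall>A\<in>eob \<A>. \<forall>B\<in>eob \<A>. ehom \<A> A B \<in> ob E) \<and>
     (\<forall>A\<in>eob \<A>. eid \<A> A \<in> hom E \<I> (ehom \<A> A A)) \<and>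
     (\<forall>A\<in>eob \<A>. \<forall>B\<in>eob \<A>. \<forall>C\<in>eob \<A>.
        ecmp \<A> A B C \<in> hom E (ehom \<A> B C \<otimes> ehom \<A> A B) (ehom \<A> A C)) \<and>
     (\<forall>A\<in>eob \<A>. \<forall>B\<in>eob \<A>. \<forall>C\<in>eob \<A>. \<forall>D\<in>eob \<A>.
        ecmp \<A> A B D \<cdot> (ecmp \<A> B C D \<odot> ident E (ehom \<A> A B)) =
        ecmp \<A> A C D \<cdot> (ident E (ehom \<A> C D) \<odot> ecmp \<A> A B C) \<cdot>
          assoc E (ehom \<A> C D) (ehom \<A> B C) (ehom \<A> A B)) \<and>
     (\<forall>A\<in>eob \<A>. \<forall>B\<in>eob \<A>.
        ecmp \<A> A B B \<cdot> (eid \<A> B \<odot> ident E (ehom \<A> A B)) = lunit E (ehom \<A> A B) \<and>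
        ecmp \<A> A A B \<cdot> (ident E (ehom \<A> A B) \<odot> eid \<A> A) = runit E (ehom \<A> A B))"

text \<open>The underlying category: an arrow from \<open>A\<close> to \<open>B\<close> is an arrow \<open>I \<rightarrow> \<A>(A,B)\<close>.\<close>

definition und :: "('x, 'o, 'a, 'm) ecategory_scheme \<Rightarrow> ('x, 'x \<times> 'x \<times> 'a) category" where
  "und \<A> =
     \<lparr> ob = eob \<A>,
       arr = {(A, B, f). A \<in> eob \<A> \<and> B \<in> eob \<A> \<and> f \<in> hom E \<I> (ehom \<A> A B)},
       src = (\<lambda>(A, B, f). A),
       tgt = (\<lambda>(A, B, f). B),
       ident = (\<lambda>A. (A, A, eid \<A> A)),
       cmp = (\<lambda>(B', C, g) (A, B, f). (A, C, ecmp \<A> A B C \<cdot> (g \<odot> f) \<cdot> inv_arr E (lunit E \<I>))) \<rparr>"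

text \<open>For \<open>g : B \<rightarrow> C\<close> in the underlying category, \<open>\<A>(A,g) : \<A>(A,B) \<rightarrow> \<A>(A,C)\<close>.\<close>

definition ehom_post ::
  "('x, 'o, 'a, 'm) ecategory_scheme \<Rightarrow> 'x \<Rightarrow> 'x \<times> 'x \<times> 'a \<Rightarrow> 'a" where
  "ehom_post \<A> A = (\<lambda>(B, C, g).
     ecmp \<A> A B C \<cdot> (g \<odot> ident E (ehom \<A> A B)) \<cdot> inv_arr E (lunit E (ehom \<A> A B)))"

text \<open>For \<open>f : A \<rightarrow> B\<close> in the underlying category, \<open>\<A>(f,C) : \<A>(B,C) \<rightarrow> \<A>(A,C)\<close>.\<close>

definition ehom_pre ::
  "('x, 'o, 'a, 'm) ecategory_scheme \<Rightarrow> 'x \<times> 'x \<times> 'a \<Rightarrow> 'x \<Rightarrow> 'a" where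
  "ehom_pre \<A> = (\<lambda>(A, B, f) C.
     ecmp \<A> A B C \<cdot> (ident E (ehom \<A> B C) \<odot> f) \<cdot> inv_arr E (runit E (ehom \<A> B C)))"

definition is_efunctor ::
  "('x, 'o, 'a, 'm) ecategory_scheme \<Rightarrow> ('y, 'o, 'a, 'n) ecategory_scheme \<Rightarrow>
   ('x, 'y, 'a) efunctor \<Rightarrow> bool" where
  "is_efunctor \<A> \<B> F \<longleftrightarrow>
     eob_map F \<in> eob \<A> \<rightarrow>\<^sub>E eob \<B> \<and>
     ehom_map F \<in> extensional (eob \<A> \<times> eob \<A>) \<and>
     (\<forall>A\<in>eob \<A>. \<forall>B\<in>eob \<A>.
        ehom_map F (A, B) \<in> hom E (ehom \<A> A B) (ehom \<B> (eob_map F A) (eob_map F B))) \<and>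
     (\<forall>A\<in>eob \<A>. ehom_map F (A, A) \<cdot> eid \<A> A = eid \<B> (eob_map F A)) \<and>
     (\<forall>A\<in>eob \<A>. \<forall>B\<in>eob \<A>. \<forall>C\<in>eob \<A>.
        ehom_map F (A, C) \<cdot> ecmp \<A> A B C =
        ecmp \<B> (eob_map F A) (eob_map F B) (eob_map F C) \<cdot> (ehom_map F (B, C) \<odot> ehom_map F (A, B)))"

definition id_efunctor :: "('x, 'o, 'a, 'm) ecategory_scheme \<Rightarrow> ('x, 'x, 'a) efunctor" where
  "id_efunctor \<A> =
     \<lparr> eob_map = (\<lambda>A\<in>eob \<A>. A),
       ehom_map = (\<lambda>(A, B)\<in>eob \<A> \<times> eob \<A>. ident E (ehom \<A> A B)) \<rparr>"

definition comp_efunctor ::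
  "('x, 'o, 'a, 'm) ecategory_scheme \<Rightarrow> ('y, 'z, 'a) efunctor \<Rightarrow> ('x, 'y, 'a) efunctor \<Rightarrow>
   ('x, 'z, 'a) efunctor" where
  "comp_efunctor \<A> G F =
     \<lparr> eob_map = (\<lambda>A\<in>eob \<A>. eob_map G (eob_map F A)),
       ehom_map = (\<lambda>(A, B)\<in>eob \<A> \<times> eob \<A>.
         ehom_map G (eob_map F A, eob_map F B) \<cdot> ehom_map F (A, B)) \<rparr>"

definition und_functor ::
  "('x, 'y, 'a) efunctor \<Rightarrow> ('x, 'x \<times> 'x \<times> 'a, 'y, 'y \<times> 'y \<times> 'a) functor_data" where
  "und_functor F =
     \<lparr> fob = eob_map F,
       farr = (\<lambda>(A, B, f). (eob_map F A, eob_map F B, ehom_map F (A, B) \<cdot> f)) \<rparr>"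

definition is_enatural ::
  "('x, 'o, 'a, 'm) ecategory_scheme \<Rightarrow> ('y, 'o, 'a, 'n) ecategory_scheme \<Rightarrow>
   ('x, 'y, 'a) efunctor \<Rightarrow> ('x, 'y, 'a) efunctor \<Rightarrow> ('x \<Rightarrow> 'y \<times> 'y \<times> 'a) \<Rightarrow> bool" where
  "is_enatural \<A> \<B> F G \<alpha> \<longleftrightarrow>
     \<alpha> \<in> extensional (eob \<A>) \<and>
     (\<forall>A\<in>eob \<A>. \<alpha> A \<in> hom (und \<B>) (eob_map F A) (eob_map G A)) \<and>
     (\<forall>A\<in>eob \<A>. \<forall>B\<in>eob \<A>.
        ehom_post \<B> (eob_map F A) (\<alpha> B) \<cdot> ehom_map F (A, B) =
        ehom_pre \<B> (\<alpha> A) (eob_map G B) \<cdot> ehom_map G (A, B))"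

text \<open>Adjunctions, with \<open>F\<close> left adjoint to \<open>G\<close>, in the 2-category of \<open>E\<close>-categories, given by unit and counit.\<close>

definition is_eadjunction ::
  "('x, 'o, 'a, 'm) ecategory_scheme \<Rightarrow> ('y, 'o, 'a, 'n) ecategory_scheme \<Rightarrow>
   ('x, 'y, 'a) efunctor \<Rightarrow> ('y, 'x, 'a) efunctor \<Rightarrow>
   ('x \<Rightarrow> 'x \<times> 'x \<times> 'a) \<Rightarrow> ('y \<Rightarrow> 'y \<times> 'y \<times> 'a) \<Rightarrow> bool" where
  "is_eadjunction \<C> \<D> F G \<eta> \<epsilon> \<longleftrightarrow>
     is_efunctor \<C> \<D> F \<and> is_efunctor \<D> \<C> G \<and>
     is_enatural \<C> \<C> (id_efunctor \<C>) (comp_efunctor \<C> G F) \<eta> \<and>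
     is_enatural \<D> \<D> (comp_efunctor \<D> F G) (id_efunctor \<D>) \<epsilon> \<and>
     (\<forall>X\<in>eob \<C>. \<epsilon> (eob_map F X) \<cdot>\<^bsub>und \<D>\<^esub> farr (und_functor F) (\<eta> X) = ident (und \<D>) (eob_map F X)) \<and>
     (\<forall>B\<in>eob \<D>. farr (und_functor G) (\<epsilon> B) \<cdot>\<^bsub>und \<C>\<^esub> \<eta> (eob_map G B) = ident (und \<C>) (eob_map G B))"


section \<open>The self-enrichment and representable functors\<close>

definition transpose :: "'o \<Rightarrow> 'o \<Rightarrow> 'o \<Rightarrow> 'a \<Rightarrow> 'a" where
  "transpose Z X Y f = (THE g. g \<in> hom E Z (ihom E X Y) \<and> eval E X Y \<cdot> (g \<odot> ident E X) = f)"

definition self :: "('o, 'o, 'a) ecategory" where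
  "self =
     \<lparr> eob = ob E,
       ehom = ihom E,
       eid = (\<lambda>X. transpose \<I> X X (lunit E X)),
       ecmp = (\<lambda>X Y Z. transpose (ihom E Y Z \<otimes> ihom E X Y) X Z
         (eval E Y Z \<cdot> (ident E (ihom E Y Z) \<odot> eval E X Y) \<cdot>
            assoc E (ihom E Y Z) (ihom E X Y) X)) \<rparr>"

text \<open>The identification of arrows of \<open>E\<close> with arrows of the underlying category of \<open>self\<close>.\<close>

definition name :: "'a \<Rightarrow> 'o \<times> 'o \<times> 'a" where
  "name f = (src E f, tgt E f, transpose \<I> (src E f) (tgt E f) (f \<cdot> lunit E (src E f)))"

definition unname :: "'o \<times> 'o \<times> 'a \<Rightarrow> 'a" where
  "unname = (\<lambda>(X, Y, n). eval E X Y \<cdot> (n \<odot> ident E X) \<cdot> inv_arr E (lunit E X))"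

text \<open>The representable functor \<open>\<A>(A,-) : \<A> \<rightarrow> E\<close>.\<close>

definition representable :: "('x, 'o, 'a, 'm) ecategory_scheme \<Rightarrow> 'x \<Rightarrow> ('x, 'o, 'a) efunctor" where
  "representable \<A> A =
     \<lparr> eob_map = (\<lambda>B\<in>eob \<A>. ehom \<A> A B),
       ehom_map = (\<lambda>(B, C)\<in>eob \<A> \<times> eob \<A>.
         transpose (ehom \<A> B C) (ehom \<A> A B) (ehom \<A> A C) (ecmp \<A> A B C)) \<rparr>"

end


section \<open>Tensored enriched categories\<close>

text \<open>
  A tensored \<open>E\<close>-category comes with a choice, for each object \<open>A\<close>, of an \<open>E\<close>-functor
  \<open>tensoring A = - \<otimes> A : E \<rightarrow> \<A>\<close> and of the unit and counit exhibiting it as left \<open>E\<close>-adjoint to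
  \<open>\<A>(A,-)\<close>.
\<close>

record ('x, 'o, 'a) tensored_ecategory = "('x, 'o, 'a) ecategory" +
  tensoring :: "'x \<Rightarrow> ('o, 'x, 'a) efunctor"
  adj_unit :: "'x \<Rightarrow> 'o \<Rightarrow> 'o \<times> 'o \<times> 'a"
  adj_counit :: "'x \<Rightarrow> 'x \<Rightarrow> 'x \<times> 'x \<times> 'a"

record ('x, 'a, 'y, 'b, 'o) strong_functor_data = "('x, 'a, 'y, 'b) functor_data" +
  strength :: "'o \<times> 'x \<Rightarrow> 'b"

type_synonym ('x, 'o, 'a) strong_1cell =
  "('x, 'x \<times> 'x \<times> 'a, 'x, 'x \<times> 'x \<times> 'a, 'o) strong_functor_data"

type_synonym ('x, 'a) transformation = "'x \<Rightarrow> 'x \<times> 'x \<times> 'a"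

context
  fixes E :: "('o, 'a) monoidal_category" (structure)
begin

definition is_tensored :: "('x, 'o, 'a) tensored_ecategory \<Rightarrow> bool" where
  "is_tensored \<A> \<longleftrightarrow>
     is_ecategory E \<A> \<and>
     (\<forall>A\<in>eob \<A>. is_eadjunction E (self E) \<A> (tensoring \<A> A) (representable E \<A> A)
        (adj_unit \<A> A) (adj_counit \<A> A))"

text \<open>The 0-cells: irrelevant values of the structure maps are normalised away.\<close>

definition tensored_ecategories :: "('x, 'o, 'a) tensored_ecategory set" where
  "tensored_ecategories =
     {\<A>. is_tensored \<A> \<and>
        case_prod (ehom \<A>) \<in> extensional (eob \<A> \<times> eob \<A>) \<and>
        eid \<A> \<in> extensional (eob \<A>) \<and>
        (\<lambda>(A, B, C). ecmp \<A> A B C) \<in> extensional (eob \<A> \<times> eob \<A> \<times> eob \<A>) \<and>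
        tensoring \<A> \<in> extensional (eob \<A>) \<and>
        adj_unit \<A> \<in> extensional (eob \<A>) \<and>
        adj_counit \<A> \<in> extensional (eob \<A>)}"

text \<open>\<open>X \<otimes> A\<close> in \<open>\<A>\<close>, and \<open>f \<otimes> A : X \<otimes> A \<rightarrow> Y \<otimes> A\<close> for \<open>f : X \<rightarrow> Y\<close> in \<open>E\<close>.\<close>

definition act_ob :: "('x, 'o, 'a) tensored_ecategory \<Rightarrow> 'o \<Rightarrow> 'x \<Rightarrow> 'x" where
  "act_ob \<A> X A = eob_map (tensoring \<A> A) X"

definition act_left :: "('x, 'o, 'a) tensored_ecategory \<Rightarrow> 'a \<Rightarrow> 'x \<Rightarrow> 'x \<times> 'x \<times> 'a" where
  "act_left \<A> f A = farr (und_functor E (tensoring \<A> A)) (name E f)"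

text \<open>The unit as an arrow \<open>X \<rightarrow> \<A>(A, X \<otimes> A)\<close> of \<open>E\<close>.\<close>

definition coev :: "('x, 'o, 'a) tensored_ecategory \<Rightarrow> 'o \<Rightarrow> 'x \<Rightarrow> 'a" where
  "coev \<A> X A = unname E (adj_unit \<A> A X)"

text \<open>The arrow \<open>X \<otimes> A \<rightarrow> B\<close> corresponding under the adjunction to \<open>h : X \<rightarrow> \<A>(A,B)\<close>.\<close>

definition adjunct :: "('x, 'o, 'a) tensored_ecategory \<Rightarrow> 'x \<Rightarrow> 'x \<Rightarrow> 'a \<Rightarrow> 'x \<times> 'x \<times> 'a" where
  "adjunct \<A> A B h = adj_counit \<A> A B \<cdot>\<^bsub>und E \<A>\<^esub> act_left \<A> h A"

text \<open>
  \<open>X \<otimes> f : X \<otimes> A \<rightarrow> X \<otimes> B\<close> for \<open>f : A \<rightarrow> B\<close>, the adjunct of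
  \<open>X \<rightarrow> \<A>(B, X \<otimes> B) \<rightarrow> \<A>(A, X \<otimes> B)\<close>.
\<close>

definition act_right ::
  "('x, 'o, 'a) tensored_ecategory \<Rightarrow> 'o \<Rightarrow> 'x \<times> 'x \<times> 'a \<Rightarrow> 'x \<times> 'x \<times> 'a" where
  "act_right \<A> X = (\<lambda>(A, B, f).
     adjunct \<A> A (act_ob \<A> X B) (ehom_pre E \<A> (A, B, f) (act_ob \<A> X B) \<cdot> coev \<A> X B))"

text \<open>
  \<open>l\<^sub>A : I \<otimes> A \<rightarrow> A\<close> is the adjunct of the unit \<open>I \<rightarrow> \<A>(A,A)\<close>, and
  \<open>a\<^sub>X\<^sub>Y\<^sub>A : (X \<otimes> Y) \<otimes> A \<rightarrow> X \<otimes> (Y \<otimes> A)\<close> is the adjunct of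
  \<open>X \<otimes> Y \<rightarrow> \<A>(Y \<otimes> A, X \<otimes> (Y \<otimes> A)) \<otimes> \<A>(A, Y \<otimes> A) \<rightarrow> \<A>(A, X \<otimes> (Y \<otimes> A))\<close>.
\<close>

definition act_unit :: "('x, 'o, 'a) tensored_ecategory \<Rightarrow> 'x \<Rightarrow> 'x \<times> 'x \<times> 'a" where
  "act_unit \<A> A = adjunct \<A> A A (eid \<A> A)"

definition act_assoc :: "('x, 'o, 'a) tensored_ecategory \<Rightarrow> 'o \<Rightarrow> 'o \<Rightarrow> 'x \<Rightarrow> 'x \<times> 'x \<times> 'a" where
  "act_assoc \<A> X Y A =
     (let B = act_ob \<A> Y A; C = act_ob \<A> X B
      in adjunct \<A> A C (ecmp \<A> A B C \<cdot> (coev \<A> X B \<odot> coev \<A> Y A)))"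


section \<open>Strong functors and strong natural transformations\<close>

definition is_strong_functor ::
  "('x, 'o, 'a) tensored_ecategory \<Rightarrow> ('x, 'o, 'a) tensored_ecategory \<Rightarrow>
   ('x, 'o, 'a) strong_1cell \<Rightarrow> bool" where
  "is_strong_functor \<A> \<B> T \<longleftrightarrow>
     is_functor (und E \<A>) (und E \<B>) T \<and>
     fob T \<in> extensional (eob \<A>) \<and>
     farr T \<in> extensional (arr (und E \<A>)) \<and>
     strength T \<in> extensional (ob E \<times> eob \<A>) \<and>
     (\<forall>X\<in>ob E. \<forall>A\<in>eob \<A>.
        strength T (X, A) \<in> hom (und E \<B>) (act_ob \<B> X (fob T A)) (fob T (act_ob \<A> X A))) \<and>
     \<comment> \<open>naturality in \<open>X\<close> and in \<open>A\<close>\<close>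
     (\<forall>f\<in>arr E. \<forall>A\<in>eob \<A>.
        strength T (tgt E f, A) \<cdot>\<^bsub>und E \<B>\<^esub> act_left \<B> f (fob T A) =
        farr T (act_left \<A> f A) \<cdot>\<^bsub>und E \<B>\<^esub> strength T (src E f, A)) \<and>
     (\<forall>X\<in>ob E. \<forall>f\<in>arr (und E \<A>).
        strength T (X, tgt (und E \<A>) f) \<cdot>\<^bsub>und E \<B>\<^esub> act_right \<B> X (farr T f) =
        farr T (act_right \<A> X f) \<cdot>\<^bsub>und E \<B>\<^esub> strength T (X, src (und E \<A>) f)) \<and>
     \<comment> \<open>unit and associativity axioms\<close>
     (\<forall>A\<in>eob \<A>.
        farr T (act_unit \<A> A) \<cdot>\<^bsub>und E \<B>\<^esub> strength T (\<I>, A) = act_unit \<B> (fob T A)) \<and>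
     (\<forall>X\<in>ob E. \<forall>Y\<in>ob E. \<forall>A\<in>eob \<A>.
        farr T (act_assoc \<A> X Y A) \<cdot>\<^bsub>und E \<B>\<^esub> strength T (X \<otimes> Y, A) =
        strength T (X, act_ob \<A> Y A) \<cdot>\<^bsub>und E \<B>\<^esub> act_right \<B> X (strength T (Y, A)) \<cdot>\<^bsub>und E \<B>\<^esub>
          act_assoc \<B> X Y (fob T A))"

definition id_strong_functor ::
  "('x, 'o, 'a) tensored_ecategory \<Rightarrow> ('x, 'o, 'a) strong_1cell" where
  "id_strong_functor \<A> =
     \<lparr> fob = (\<lambda>A\<in>eob \<A>. A),
       farr = (\<lambda>f\<in>arr (und E \<A>). f),
       strength = (\<lambda>(X, A)\<in>ob E \<times> eob \<A>. ident (und E \<A>) (act_ob \<A> X A)) \<rparr>"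

definition comp_strong_functor ::
  "('x, 'o, 'a) tensored_ecategory \<Rightarrow> ('x, 'o, 'a) tensored_ecategory \<Rightarrow>
   ('x, 'o, 'a) strong_1cell \<Rightarrow> ('x, 'o, 'a) strong_1cell \<Rightarrow> ('x, 'o, 'a) strong_1cell" where
  "comp_strong_functor \<A> \<C> T2 T1 =
     \<lparr> fob = (\<lambda>A\<in>eob \<A>. fob T2 (fob T1 A)),
       farr = (\<lambda>f\<in>arr (und E \<A>). farr T2 (farr T1 f)),
       strength = (\<lambda>(X, A)\<in>ob E \<times> eob \<A>.
         farr T2 (strength T1 (X, A)) \<cdot>\<^bsub>und E \<C>\<^esub> strength T2 (X, fob T1 A)) \<rparr>"

definition is_strong_natural ::
  "('x, 'o, 'a) tensored_ecategory \<Rightarrow> ('x, 'o, 'a) tensored_ecategory \<Rightarrow>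
   ('x, 'o, 'a) strong_1cell \<Rightarrow> ('x, 'o, 'a) strong_1cell \<Rightarrow> ('x, 'a) transformation \<Rightarrow> bool" where
  "is_strong_natural \<A> \<B> T1 T2 \<Psi> \<longleftrightarrow>
     \<Psi> \<in> extensional (eob \<A>) \<and>
     is_natural (und E \<A>) (und E \<B>) T1 T2 \<Psi> \<and>
     (\<forall>X\<in>ob E. \<forall>A\<in>eob \<A>.
        \<Psi> (act_ob \<A> X A) \<cdot>\<^bsub>und E \<B>\<^esub> strength T1 (X, A) =
        strength T2 (X, A) \<cdot>\<^bsub>und E \<B>\<^esub> act_right \<B> X (\<Psi> A))"

end


section \<open>2-categories and 2-isomorphism\<close>

text \<open>
  A strict 2-category has a category \<open>hom2 K A B\<close> of 1-cells and 2-cells for each pair of 0-cells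
  (vertical composition) and horizontal composition functors
  \<open>hcomp K A B C : hom2 K B C \<times> hom2 K A B \<rightarrow> hom2 K A C\<close>.
\<close>

record ('c, 'f, 't) two_category =
  ob2 :: "'c set"
  hom2 :: "'c \<Rightarrow> 'c \<Rightarrow> ('f, 't) category"
  id1 :: "'c \<Rightarrow> 'f"
  hcomp :: "'c \<Rightarrow> 'c \<Rightarrow> 'c \<Rightarrow> ('f \<times> 'f, 't \<times> 't, 'f, 't) functor_data"

definition is_two_category :: "('c, 'f, 't) two_category \<Rightarrow> bool" where
  "is_two_category K \<longleftrightarrow>
     (\<forall>A\<in>ob2 K. \<forall>B\<in>ob2 K. is_category (hom2 K A B)) \<and>
     (\<forall>A\<in>ob2 K. id1 K A \<in> ob (hom2 K A A)) \<and>
     (\<forall>A\<in>ob2 K. \<forall>B\<in>ob2 K. \<forall>C\<in>ob2 K.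
        is_functor (prod_category (hom2 K B C) (hom2 K A B)) (hom2 K A C) (hcomp K A B C)) \<and>
     (\<forall>A\<in>ob2 K. \<forall>B\<in>ob2 K. \<forall>C\<in>ob2 K. \<forall>D\<in>ob2 K.
        (\<forall>h\<in>ob (hom2 K C D). \<forall>g\<in>ob (hom2 K B C). \<forall>f\<in>ob (hom2 K A B).
           fob (hcomp K A B D) (fob (hcomp K B C D) (h, g), f) =
           fob (hcomp K A C D) (h, fob (hcomp K A B C) (g, f))) \<and>
        (\<forall>\<gamma>\<in>arr (hom2 K C D). \<forall>\<beta>\<in>arr (hom2 K B C). \<forall>\<alpha>\<in>arr (hom2 K A B).
           farr (hcomp K A B D) (farr (hcomp K B C D) (\<gamma>, \<beta>), \<alpha>) =
           farr (hcomp K A C D) (\<gamma>, farr (hcomp K A B C) (\<beta>, \<alpha>)))) \<and>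
     (\<forall>A\<in>ob2 K. \<forall>B\<in>ob2 K.
        (\<forall>f\<in>ob (hom2 K A B).
           fob (hcomp K A A B) (f, id1 K A) = f \<and> fob (hcomp K A B B) (id1 K B, f) = f) \<and>
        (\<forall>\<alpha>\<in>arr (hom2 K A B).
           farr (hcomp K A A B) (\<alpha>, ident (hom2 K A A) (id1 K A)) = \<alpha> \<and>
           farr (hcomp K A B B) (ident (hom2 K B B) (id1 K B), \<alpha>) = \<alpha>))"

record ('c, 'f, 't, 'd, 'g, 's) two_functor_data =
  map0 :: "'c \<Rightarrow> 'd"
  map_hom :: "'c \<Rightarrow> 'c \<Rightarrow> ('f, 't, 'g, 's) functor_data"

definition is_two_functor ::
  "('c, 'f, 't) two_category \<Rightarrow> ('d, 'g, 's) two_category \<Rightarrow>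
   ('c, 'f, 't, 'd, 'g, 's) two_functor_data \<Rightarrow> bool" where
  "is_two_functor K L \<Phi> \<longleftrightarrow>
     (\<forall>A\<in>ob2 K. map0 \<Phi> A \<in> ob2 L) \<and>
     (\<forall>A\<in>ob2 K. \<forall>B\<in>ob2 K.
        is_functor (hom2 K A B) (hom2 L (map0 \<Phi> A) (map0 \<Phi> B)) (map_hom \<Phi> A B)) \<and>
     (\<forall>A\<in>ob2 K. fob (map_hom \<Phi> A A) (id1 K A) = id1 L (map0 \<Phi> A)) \<and>
     (\<forall>A\<in>ob2 K. \<forall>B\<in>ob2 K. \<forall>C\<in>ob2 K.
        (\<forall>g\<in>ob (hom2 K B C). \<forall>f\<in>ob (hom2 K A B).
           fob (map_hom \<Phi> A C) (fob (hcomp K A B C) (g, f)) =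
           fob (hcomp L (map0 \<Phi> A) (map0 \<Phi> B) (map0 \<Phi> C))
             (fob (map_hom \<Phi> B C) g, fob (map_hom \<Phi> A B) f)) \<and>
        (\<forall>\<beta>\<in>arr (hom2 K B C). \<forall>\<alpha>\<in>arr (hom2 K A B).
           farr (map_hom \<Phi> A C) (farr (hcomp K A B C) (\<beta>, \<alpha>)) =
           farr (hcomp L (map0 \<Phi> A) (map0 \<Phi> B) (map0 \<Phi> C))
             (farr (map_hom \<Phi> B C) \<beta>, farr (map_hom \<Phi> A B) \<alpha>)))"

definition is_left_inverse_two_functor ::
  "('c, 'f, 't) two_category \<Rightarrow> ('c, 'f, 't, 'd, 'g, 's) two_functor_data \<Rightarrow>
   ('d, 'g, 's, 'c, 'f, 't) two_functor_data \<Rightarrow> bool" where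
  "is_left_inverse_two_functor K \<Phi> \<Theta> \<longleftrightarrow>
     (\<forall>A\<in>ob2 K. map0 \<Theta> (map0 \<Phi> A) = A) \<and>
     (\<forall>A\<in>ob2 K. \<forall>B\<in>ob2 K.
        (\<forall>f\<in>ob (hom2 K A B).
           fob (map_hom \<Theta> (map0 \<Phi> A) (map0 \<Phi> B)) (fob (map_hom \<Phi> A B) f) = f) \<and>
        (\<forall>\<alpha>\<in>arr (hom2 K A B).
           farr (map_hom \<Theta> (map0 \<Phi> A) (map0 \<Phi> B)) (farr (map_hom \<Phi> A B) \<alpha>) = \<alpha>))"

definition two_isomorphic :: "('c, 'f, 't) two_category \<Rightarrow> ('d, 'g, 's) two_category \<Rightarrow> bool" where
  "two_isomorphic K L \<longleftrightarrow>
     is_two_category K \<and> is_two_category L \<and>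
     (\<exists>\<Phi> \<Theta>. is_two_functor K L \<Phi> \<and> is_two_functor L K \<Theta> \<and>
        is_left_inverse_two_functor K \<Phi> \<Theta> \<and> is_left_inverse_two_functor L \<Theta> \<Phi>)"


section \<open>The two 2-categories\<close>

text \<open>
  The category of 1-cells \<open>S\<close> with values in \<open>D\<close> and of transformations \<open>R F G\<close> with components
  indexed by \<open>I\<close>, composed componentwise; \<open>m F\<close> is the object map of \<open>F\<close>.
\<close>

definition transf_category ::
  "'x set \<Rightarrow> ('y, 'b) category \<Rightarrow> ('f \<Rightarrow> 'x \<Rightarrow> 'y) \<Rightarrow> 'f set \<Rightarrow> ('f \<Rightarrow> 'f \<Rightarrow> ('x \<Rightarrow> 'b) \<Rightarrow> bool) \<Rightarrow>
   ('f, 'f \<times> 'f \<times> ('x \<Rightarrow> 'b)) category" where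
  "transf_category I D m S R =
     \<lparr> ob = S,
       arr = {(F, G, \<alpha>). F \<in> S \<and> G \<in> S \<and> R F G \<alpha>},
       src = (\<lambda>(F, G, \<alpha>). F),
       tgt = (\<lambda>(F, G, \<alpha>). G),
       ident = (\<lambda>F. (F, F, \<lambda>A\<in>I. ident D (m F A))),
       cmp = (\<lambda>(G', H, \<beta>) (F, G, \<alpha>). (F, H, \<lambda>A\<in>I. \<beta> A \<cdot>\<^bsub>D\<^esub> \<alpha> A)) \<rparr>"

context
  fixes E :: "('o, 'a) monoidal_category"
begin

definition StrongCat ::
  "(('x, 'o, 'a) tensored_ecategory, ('x, 'o, 'a) strong_1cell,
    ('x, 'o, 'a) strong_1cell \<times> ('x, 'o, 'a) strong_1cell \<times> ('x, 'a) transformation) two_category" where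
  "StrongCat =
     \<lparr> ob2 = tensored_ecategories E,
       hom2 = (\<lambda>\<A> \<B>. transf_category (eob \<A>) (und E \<B>) fob
         {T. is_strong_functor E \<A> \<B> T} (is_strong_natural E \<A> \<B>)),
       id1 = id_strong_functor E,
       hcomp = (\<lambda>\<A> \<B> \<C>.
         \<lparr> fob = (\<lambda>(T2, T1). comp_strong_functor E \<A> \<C> T2 T1),
           farr = (\<lambda>((S2, T2, \<Psi>2), (S1, T1, \<Psi>1)).
             (comp_strong_functor E \<A> \<C> S2 S1, comp_strong_functor E \<A> \<C> T2 T1,
              \<lambda>A\<in>eob \<A>. \<Psi>2 (fob T1 A) \<cdot>\<^bsub>und E \<C>\<^esub> farr S2 (\<Psi>1 A))) \<rparr>) \<rparr>"

definition ECat ::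
  "(('x, 'o, 'a) tensored_ecategory, ('x, 'x, 'a) efunctor,
    ('x, 'x, 'a) efunctor \<times> ('x, 'x, 'a) efunctor \<times> ('x, 'a) transformation) two_category" where
  "ECat =
     \<lparr> ob2 = tensored_ecategories E,
       hom2 = (\<lambda>\<A> \<B>. transf_category (eob \<A>) (und E \<B>) eob_map
         {F. is_efunctor E \<A> \<B> F} (is_enatural E \<A> \<B>)),
       id1 = id_efunctor E,
       hcomp = (\<lambda>\<A> \<B> \<C>.
         \<lparr> fob = (\<lambda>(G, F). comp_efunctor E \<A> G F),
           farr = (\<lambda>((F2, G2, \<beta>), (F1, G1, \<alpha>)).
             (comp_efunctor E \<A> F2 F1, comp_efunctor E \<A> G2 G1,
              \<lambda>A\<in>eob \<A>. \<beta> (eob_map G1 A) \<cdot>\<^bsub>und E \<C>\<^esub> farr (und_functor E F2) (\<alpha> A))) \<rparr>) \<rparr>"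

end

end

theory Submission
  imports Defs
begin

text \<open>
  A tensored category \<open>\<A>\<close> enters only through the unit arrows \<open>coev X A : X \<rightarrow> \<A>(A, X \<otimes> A)\<close>, which are universal:
  an arrow \<open>k : X \<otimes> A \<rightarrow> B\<close> is determined by \<open>\<A>(A,k) \<circ> coev X A : X \<rightarrow> \<A>(A,B)\<close>, and each \<open>X \<rightarrow> \<A>(A,B)\<close> is of
  this form. An \<open>E\<close>-functor \<open>(F,\<phi>)\<close> corresponds to the strong functor whose strength \<open>\<sigma> : X \<otimes> FA \<rightarrow> F(X \<otimes> A)\<close> is
  determined by \<open>\<B>(FA,\<sigma>) \<circ> coev X (FA) = \<phi> \<circ> coev X A\<close>; conversely \<open>\<phi>\<close> on \<open>\<A>(A,B)\<close> is the arrow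
  corresponding to \<open>T(\<epsilon>) \<circ> \<sigma> : \<A>(A,B) \<otimes> TA \<rightarrow> T(\<A>(A,B) \<otimes> A) \<rightarrow> TB\<close>, where \<open>\<epsilon> : \<A>(A,B) \<otimes> A \<rightarrow> B\<close> is the counit.
  All axioms on either side are compared by composing with \<open>coev\<close>. The bijection identifies \<open>E\<close>-natural with
  strong natural transformations and respects all compositions, so the 2-category axioms for strong functors are
  transported from those for \<open>E\<close>-functors.
\<close>

section \<open>Categories\<close>

text \<open>An arrow of an underlying category is a global element \<I> -> \<A>(A,B), so composing
  it with anything brings in inverse unitors. The obstacle is to keep these out of the main
  argument. Three equations for generalised elements f, g of hom objects do this: k(fg) = (kf)g,
  (fg)k = f(gk) and (fk)g = f(kg), where the underlying arrow k acts through \<open>post\<close> or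
  \<open>pre\<close>. They are \<open>post_ecmp\<close>, \<open>pre_ecmp\<close> and
  \<open>ecmp_pre_post\<close>, and each uses one coherence law for units. After them an axiom
  composed with \<open>coev\<close> is a calculation with composites in hom objects, and the axioms
  can be matched: preservation of identities by \<phi> against the unit axiom, preservation of
  composition against the associativity axiom. Naturality of \<sigma> in X is what allows \<phi> to
  be defined from the single case X = \<A>(A,B), as in the Yoneda lemma. Since 1-cells and 2-cells
  are extensional, the passages between both sides are inverse to each other as equalities, and the
  2-isomorphism is strict.\<close>

lemma in_hom_iff [simp]: "f \<in> hom C X Y \<longleftrightarrow> f \<in> arr C \<and> src C f = X \<and> tgt C f = Y"
  by (simp add: hom_def)

lemma category_arr:
  assumes "is_category C" "f \<in> arr C"
  shows "src C f \<in> ob C" "tgt C f \<in> ob C" "f \<cdot>\<^bsub>C\<^esub> ident C (src C f) = f" "ident C (tgt C f) \<cdot>\<^bsub>C\<^esub> f = f"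
  using assms by (simp_all add: is_category_def)

lemma category_ident:
  assumes "is_category C" "X \<in> ob C"
  shows "ident C X \<in> arr C" "src C (ident C X) = X" "tgt C (ident C X) = X"
  using assms by (simp_all add: is_category_def)

lemma category_cmp:
  assumes "is_category C" "f \<in> arr C" "g \<in> arr C" "tgt C f = src C g"
  shows "g \<cdot>\<^bsub>C\<^esub> f \<in> arr C" "src C (g \<cdot>\<^bsub>C\<^esub> f) = src C f" "tgt C (g \<cdot>\<^bsub>C\<^esub> f) = tgt C g"
  using assms by (simp_all add: is_category_def)

lemma cmp_ident:
  assumes "is_category C" "f \<in> arr C"
  shows "src C f = X \<Longrightarrow> f \<cdot>\<^bsub>C\<^esub> ident C X = f" "tgt C f = X \<Longrightarrow> ident C X \<cdot>\<^bsub>C\<^esub> f = f"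
  using assms by (auto simp: category_arr)

lemma cmp_assoc:
  assumes "is_category C" "f \<in> arr C" "g \<in> arr C" "h \<in> arr C" "tgt C f = src C g" "tgt C g = src C h"
  shows "(h \<cdot>\<^bsub>C\<^esub> g) \<cdot>\<^bsub>C\<^esub> f = h \<cdot>\<^bsub>C\<^esub> g \<cdot>\<^bsub>C\<^esub> f"
  using assms by (simp add: is_category_def)

text \<open>\<open>cmp_assoc\<close> stays out of the simp set: most calculations bracket to the
  right with it, but some use it backwards to bring two neighbouring arrows together.\<close>

declare category_arr [simp] category_ident [simp] category_cmp [simp] cmp_ident [simp]

text \<open>In a composite bracketed to the right, an equation for two adjacent arrows matches only
  if it carries the tail x.\<close>

lemma cmp_rewrite:
  assumes "is_category C" "g \<cdot>\<^bsub>C\<^esub> f = k" "x \<in> arr C" "f \<in> arr C" "g \<in> arr C"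
    "tgt C x = src C f" "tgt C f = src C g"
  shows "g \<cdot>\<^bsub>C\<^esub> f \<cdot>\<^bsub>C\<^esub> x = k \<cdot>\<^bsub>C\<^esub> x"
  using assms cmp_assoc by metis

lemma inv_arr:
  assumes C: "is_category C" and "is_iso C f"
  shows "is_inverse C f (inv_arr C f)"
proof -
  obtain g where g: "is_inverse C f g"
    using assms(2) by (auto simp: is_iso_def)
  have "h = g" if h: "is_inverse C f h" for h
  proof -
    have "h = h \<cdot>\<^bsub>C\<^esub> f \<cdot>\<^bsub>C\<^esub> g"
      using g h C by (auto simp: is_inverse_def)
    also have "\<dots> = (h \<cdot>\<^bsub>C\<^esub> f) \<cdot>\<^bsub>C\<^esub> g"
      using g h C by (intro cmp_assoc [symmetric]) (auto simp: is_inverse_def)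
    also have "\<dots> = g"
      using g h C by (auto simp: is_inverse_def)
    finally show ?thesis .
  qed
  then show ?thesis
    unfolding inv_arr_def using g by (metis theI)
qed

lemma inv_arr_simps [simp]:
  assumes "is_category C" "is_iso C f"
  shows "inv_arr C f \<in> arr C" "src C (inv_arr C f) = tgt C f" "tgt C (inv_arr C f) = src C f"
    "inv_arr C f \<cdot>\<^bsub>C\<^esub> f = ident C (src C f)" "f \<cdot>\<^bsub>C\<^esub> inv_arr C f = ident C (tgt C f)"
  using inv_arr [OF assms] by (auto simp: is_inverse_def)

lemma is_iso_arr: "is_iso C f \<Longrightarrow> f \<in> arr C"
  by (auto simp: is_iso_def is_inverse_def)

lemma iso_cancel_left:
  assumes "is_category C" "is_iso C h" "f \<in> arr C" "g \<in> arr C" "tgt C f = src C h" "tgt C g = src C h"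
    and eq: "h \<cdot>\<^bsub>C\<^esub> f = h \<cdot>\<^bsub>C\<^esub> g"
  shows "f = g"
proof -
  have "inv_arr C h \<cdot>\<^bsub>C\<^esub> h \<cdot>\<^bsub>C\<^esub> f = inv_arr C h \<cdot>\<^bsub>C\<^esub> h \<cdot>\<^bsub>C\<^esub> g"
    by (simp only: eq)
  then show ?thesis
    using assms(1-6) is_iso_arr [OF assms(2)] by (simp flip: cmp_assoc)
qed

lemma iso_cancel_right:
  assumes "is_category C" "is_iso C h" "f \<in> arr C" "g \<in> arr C" "src C f = tgt C h" "src C g = tgt C h"
    and eq: "f \<cdot>\<^bsub>C\<^esub> h = g \<cdot>\<^bsub>C\<^esub> h"
  shows "f = g"
proof -
  have "(f \<cdot>\<^bsub>C\<^esub> h) \<cdot>\<^bsub>C\<^esub> inv_arr C h = (g \<cdot>\<^bsub>C\<^esub> h) \<cdot>\<^bsub>C\<^esub> inv_arr C h"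
    by (simp only: eq)
  then show ?thesis
    using assms(1-6) is_iso_arr [OF assms(2)] by (simp add: cmp_assoc)
qed

lemma is_isoI:
  assumes "f \<in> arr C" "g \<in> arr C" "src C g = tgt C f" "tgt C g = src C f"
    "g \<cdot>\<^bsub>C\<^esub> f = ident C (src C f)" "f \<cdot>\<^bsub>C\<^esub> g = ident C (tgt C f)"
  shows "is_iso C f"
  using assms by (auto simp: is_iso_def is_inverse_def)

lemma is_iso_cmp:
  assumes C: "is_category C" and f: "is_iso C f" and g: "is_iso C g" and [simp]: "tgt C f = src C g"
  shows "is_iso C (g \<cdot>\<^bsub>C\<^esub> f)"
proof (rule is_isoI)
  note [simp] = C f g is_iso_arr [OF f] is_iso_arr [OF g]
  have "f \<cdot>\<^bsub>C\<^esub> inv_arr C f \<cdot>\<^bsub>C\<^esub> inv_arr C g = inv_arr C g"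
    "inv_arr C g \<cdot>\<^bsub>C\<^esub> g \<cdot>\<^bsub>C\<^esub> f = f"
    by (simp_all flip: cmp_assoc)
  then show "(inv_arr C f \<cdot>\<^bsub>C\<^esub> inv_arr C g) \<cdot>\<^bsub>C\<^esub> g \<cdot>\<^bsub>C\<^esub> f = ident C (src C (g \<cdot>\<^bsub>C\<^esub> f))"
    "(g \<cdot>\<^bsub>C\<^esub> f) \<cdot>\<^bsub>C\<^esub> inv_arr C f \<cdot>\<^bsub>C\<^esub> inv_arr C g = ident C (tgt C (g \<cdot>\<^bsub>C\<^esub> f))"
    by (simp_all add: cmp_assoc)
qed (use is_iso_arr [OF f] is_iso_arr [OF g] C f g in simp_all)


section \<open>Monoidal coherence\<close>

locale closed_symmetric_monoidal =
  fixes E :: "('o, 'a) monoidal_category" (structure)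
  assumes closed_symmetric_monoidal: "is_closed_symmetric_monoidal E"
begin

abbreviation "one \<equiv> ident E"
abbreviation "linv X \<equiv> inv_arr E (lunit E X)"
abbreviation "rinv X \<equiv> inv_arr E (runit E X)"

lemma symmetric_monoidal: "is_symmetric_monoidal E"
  using closed_symmetric_monoidal by (simp add: is_closed_symmetric_monoidal_def)

lemma category [simp]: "is_category E"
  using symmetric_monoidal by (simp add: is_symmetric_monoidal_def)

lemma unit_ob [simp]: "\<I> \<in> ob E"
  using symmetric_monoidal by (simp add: is_symmetric_monoidal_def)

lemma tensor_functor:
  "is_functor (prod_category E E) E \<lparr>fob = (\<lambda>(X, Y). X \<otimes> Y), farr = (\<lambda>(f, g). f \<odot> g)\<rparr>"
  using symmetric_monoidal by (simp add: is_symmetric_monoidal_def)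

lemma tens_ob [simp]: "X \<in> ob E \<Longrightarrow> Y \<in> ob E \<Longrightarrow> X \<otimes> Y \<in> ob E"
  using tensor_functor by (simp add: is_functor_def prod_category_def)

lemma tens_arr [simp]:
  assumes "f \<in> arr E" "g \<in> arr E"
  shows "f \<odot> g \<in> arr E" "src E (f \<odot> g) = src E f \<otimes> src E g" "tgt E (f \<odot> g) = tgt E f \<otimes> tgt E g"
  using tensor_functor assms by (simp_all add: is_functor_def prod_category_def)

lemma tens_ident [simp]: "X \<in> ob E \<Longrightarrow> Y \<in> ob E \<Longrightarrow> one X \<odot> one Y = one (X \<otimes> Y)"
  using tensor_functor by (simp add: is_functor_def prod_category_def)

lemma interchange:
  assumes "f \<in> arr E" "f' \<in> arr E" "tgt E f = src E f'" "g \<in> arr E" "g' \<in> arr E" "tgt E g = src E g'"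
  shows "(f' \<odot> g') \<cdot> (f \<odot> g) = (f' \<cdot> f) \<odot> (g' \<cdot> g)"
  using tensor_functor assms by (simp add: is_functor_def prod_category_def)

lemma interchange':
  assumes "f \<in> arr E" "f' \<in> arr E" "tgt E f = src E f'" "g \<in> arr E" "g' \<in> arr E" "tgt E g = src E g'"
    and "x \<in> arr E" "tgt E x = src E f \<otimes> src E g"
  shows "(f' \<odot> g') \<cdot> (f \<odot> g) \<cdot> x = ((f' \<cdot> f) \<odot> (g' \<cdot> g)) \<cdot> x"
  using assms by (simp add: interchange cmp_rewrite)

lemma assoc [simp]:
  assumes "X \<in> ob E" "Y \<in> ob E" "Z \<in> ob E"
  shows "assoc E X Y Z \<in> arr E" "src E (assoc E X Y Z) = (X \<otimes> Y) \<otimes> Z"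
    "tgt E (assoc E X Y Z) = X \<otimes> Y \<otimes> Z" "is_iso E (assoc E X Y Z)"
  using symmetric_monoidal assms by (simp_all add: is_symmetric_monoidal_def)

lemma lunit [simp]:
  assumes "X \<in> ob E"
  shows "lunit E X \<in> arr E" "src E (lunit E X) = \<I> \<otimes> X" "tgt E (lunit E X) = X" "is_iso E (lunit E X)"
  using symmetric_monoidal assms by (simp_all add: is_symmetric_monoidal_def)

lemma runit [simp]:
  assumes "X \<in> ob E"
  shows "runit E X \<in> arr E" "src E (runit E X) = X \<otimes> \<I>" "tgt E (runit E X) = X" "is_iso E (runit E X)"
  using symmetric_monoidal assms by (simp_all add: is_symmetric_monoidal_def)

lemma assoc_natural:
  assumes "f \<in> arr E" "g \<in> arr E" "h \<in> arr E" "tgt E f = X" "tgt E g = Y" "tgt E h = Z"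
  shows "assoc E X Y Z \<cdot> ((f \<odot> g) \<odot> h) = (f \<odot> g \<odot> h) \<cdot> assoc E (src E f) (src E g) (src E h)"
  using symmetric_monoidal assms by (auto simp add: is_symmetric_monoidal_def)

lemma lunit_natural:
  "f \<in> arr E \<Longrightarrow> tgt E f = X \<Longrightarrow> lunit E X \<cdot> (one \<I> \<odot> f) = f \<cdot> lunit E (src E f)"
  using symmetric_monoidal by (auto simp add: is_symmetric_monoidal_def)

lemma runit_natural:
  "f \<in> arr E \<Longrightarrow> tgt E f = X \<Longrightarrow> runit E X \<cdot> (f \<odot> one \<I>) = f \<cdot> runit E (src E f)"
  using symmetric_monoidal by (auto simp add: is_symmetric_monoidal_def)

lemma pentagon:
  assumes "W \<in> ob E" "X \<in> ob E" "Y \<in> ob E" "Z \<in> ob E"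
  shows "assoc E W X (Y \<otimes> Z) \<cdot> assoc E (W \<otimes> X) Y Z =
        (one W \<odot> assoc E X Y Z) \<cdot> assoc E W (X \<otimes> Y) Z \<cdot> (assoc E W X Y \<odot> one Z)"
  using symmetric_monoidal assms by (simp add: is_symmetric_monoidal_def)

lemma triangle:
  assumes "X \<in> ob E" "Y \<in> ob E"
  shows "(one X \<odot> lunit E Y) \<cdot> assoc E X \<I> Y = runit E X \<odot> one Y"
  using symmetric_monoidal assms by (simp add: is_symmetric_monoidal_def)

lemma is_iso_tens:
  assumes f: "is_iso E f" and g: "is_iso E g"
  shows "is_iso E (f \<odot> g)"
proof (rule is_isoI)
  note [simp] = f g is_iso_arr [OF f] is_iso_arr [OF g]
  show "inv_arr E f \<odot> inv_arr E g \<in> arr E" "f \<odot> g \<in> arr E"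
    "(inv_arr E f \<odot> inv_arr E g) \<cdot> (f \<odot> g) = one (src E (f \<odot> g))"
    "(f \<odot> g) \<cdot> (inv_arr E f \<odot> inv_arr E g) = one (tgt E (f \<odot> g))"
    "src E (inv_arr E f \<odot> inv_arr E g) = tgt E (f \<odot> g)"
    "tgt E (inv_arr E f \<odot> inv_arr E g) = src E (f \<odot> g)"
    by (simp_all add: interchange)
qed

lemma is_iso_one [simp]: "X \<in> ob E \<Longrightarrow> is_iso E (one X)"
  by (rule is_isoI [where g = "one X"]) simp_all

section \<open>Kelly's unit laws, derived from pentagon and triangle\<close>

lemma unit_tens_faithful:
  assumes "f \<in> arr E" "g \<in> arr E" "src E f = src E g" "tgt E f = tgt E g" and eq: "one \<I> \<odot> f = one \<I> \<odot> g"
  shows "f = g"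
proof (rule iso_cancel_right [OF category])
  show "f \<cdot> lunit E (src E f) = g \<cdot> lunit E (src E f)"
    using lunit_natural [of f] lunit_natural [of g] eq assms by simp
qed (use assms in simp_all)

lemma tens_unit_faithful:
  assumes "f \<in> arr E" "g \<in> arr E" "src E f = src E g" "tgt E f = tgt E g" and eq: "f \<odot> one \<I> = g \<odot> one \<I>"
  shows "f = g"
proof (rule iso_cancel_right [OF category])
  show "f \<cdot> runit E (src E f) = g \<cdot> runit E (src E f)"
    using runit_natural [of f] runit_natural [of g] eq assms by simp
qed (use assms in simp_all)

text \<open>After tensoring with \<I> on the left, the pentagon for \<I>, \<I>, X, Y and two
  triangles show that both sides agree when precomposed with the isomorphism \<open>?m\<close>,
  which is then cancelled. Nothing is lost by \<open>unit_tens_faithful\<close>.\<close>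

lemma lunit_tens:
  assumes [simp]: "X \<in> ob E" "Y \<in> ob E"
  shows "lunit E (X \<otimes> Y) \<cdot> assoc E \<I> X Y = lunit E X \<odot> one Y"
proof (rule unit_tens_faithful)
  let ?m = "assoc E \<I> (\<I> \<otimes> X) Y \<cdot> (assoc E \<I> \<I> X \<odot> one Y)"
  have "(one \<I> \<odot> (lunit E (X \<otimes> Y) \<cdot> assoc E \<I> X Y)) \<cdot> ?m
      = (one \<I> \<odot> lunit E (X \<otimes> Y)) \<cdot> (one \<I> \<odot> assoc E \<I> X Y) \<cdot> ?m"
    by (simp add: interchange')
  also have "\<dots> = (one \<I> \<odot> lunit E (X \<otimes> Y)) \<cdot> assoc E \<I> \<I> (X \<otimes> Y) \<cdot> assoc E (\<I> \<otimes> \<I>) X Y"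
    by (simp add: pentagon)
  also have "\<dots> = (runit E \<I> \<odot> one (X \<otimes> Y)) \<cdot> assoc E (\<I> \<otimes> \<I>) X Y"
    by (simp add: triangle flip: cmp_assoc)
  also have "\<dots> = assoc E \<I> X Y \<cdot> ((runit E \<I> \<odot> one X) \<odot> one Y)"
    by (simp add: assoc_natural)
  also have "\<dots> = assoc E \<I> X Y \<cdot> ((one \<I> \<odot> lunit E X) \<odot> one Y) \<cdot> (assoc E \<I> \<I> X \<odot> one Y)"
    by (simp add: interchange triangle)
  also have "\<dots> = (one \<I> \<odot> (lunit E X \<odot> one Y)) \<cdot> ?m"
    by (simp add: assoc_natural flip: cmp_assoc)
  finally have eq: "(one \<I> \<odot> (lunit E (X \<otimes> Y) \<cdot> assoc E \<I> X Y)) \<cdot> ?m = (one \<I> \<odot> (lunit E X \<odot> one Y)) \<cdot> ?m" .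
  have "is_iso E ?m"
    by (intro is_iso_cmp is_iso_tens) simp_all
  then show "one \<I> \<odot> (lunit E (X \<otimes> Y) \<cdot> assoc E \<I> X Y) = one \<I> \<odot> (lunit E X \<odot> one Y)"
    by (rule iso_cancel_right [OF category _ _ _ _ _ eq]) simp_all
qed simp_all

text \<open>Mirror image of \<open>lunit_tens\<close>: the pentagon for X, Y, \<I>, \<I>, after
  tensoring with \<I> on the right. Here an associator on the left is cancelled.\<close>

lemma runit_tens:
  assumes [simp]: "X \<in> ob E" "Y \<in> ob E"
  shows "(one X \<odot> runit E Y) \<cdot> assoc E X Y \<I> = runit E (X \<otimes> Y)"
proof (rule tens_unit_faithful)
  have "assoc E X Y \<I> \<cdot> (((one X \<odot> runit E Y) \<cdot> assoc E X Y \<I>) \<odot> one \<I>)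
      = assoc E X Y \<I> \<cdot> ((one X \<odot> runit E Y) \<odot> one \<I>) \<cdot> (assoc E X Y \<I> \<odot> one \<I>)"
    by (simp add: interchange)
  also have "\<dots> = (one X \<odot> runit E Y \<odot> one \<I>) \<cdot> assoc E X (Y \<otimes> \<I>) \<I> \<cdot> (assoc E X Y \<I> \<odot> one \<I>)"
    by (simp add: assoc_natural flip: cmp_assoc)
  also have "\<dots> = (one X \<odot> one Y \<odot> lunit E \<I>) \<cdot> (one X \<odot> assoc E Y \<I> \<I>) \<cdot>
      assoc E X (Y \<otimes> \<I>) \<I> \<cdot> (assoc E X Y \<I> \<odot> one \<I>)"
    by (simp add: interchange' triangle)
  also have "\<dots> = (one X \<odot> one Y \<odot> lunit E \<I>) \<cdot> assoc E X Y (\<I> \<otimes> \<I>) \<cdot> assoc E (X \<otimes> Y) \<I> \<I>"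
    by (simp add: pentagon)
  also have "\<dots> = assoc E X Y \<I> \<cdot> ((one X \<odot> one Y) \<odot> lunit E \<I>) \<cdot> assoc E (X \<otimes> Y) \<I> \<I>"
    using assoc_natural [of "one X" "one Y" "lunit E \<I>"] by (simp del: tens_ident flip: cmp_assoc)
  also have "\<dots> = assoc E X Y \<I> \<cdot> (runit E (X \<otimes> Y) \<odot> one \<I>)"
    by (simp add: triangle)
  finally have eq: "assoc E X Y \<I> \<cdot> (((one X \<odot> runit E Y) \<cdot> assoc E X Y \<I>) \<odot> one \<I>)
      = assoc E X Y \<I> \<cdot> (runit E (X \<otimes> Y) \<odot> one \<I>)" .
  show "((one X \<odot> runit E Y) \<cdot> assoc E X Y \<I>) \<odot> one \<I> = runit E (X \<otimes> Y) \<odot> one \<I>"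
    by (rule iso_cancel_left [OF category _ _ _ _ _ eq]) simp_all
qed simp_all

text \<open>Naturality of \<open>lunit\<close> at its own component, with
  \<open>lunit E \<I>\<close> cancelled, makes \<open>lunit E (\<I> \<otimes> \<I>)\<close> equal to
  \<open>one \<I> \<odot> lunit E \<I>\<close>. Precomposed with the associator, the former is
  computed by \<open>lunit_tens\<close> and the latter by the triangle.\<close>

lemma lunit_unit: "lunit E \<I> = runit E \<I>"
proof (rule tens_unit_faithful)
  have "lunit E \<I> \<cdot> lunit E (\<I> \<otimes> \<I>) = lunit E \<I> \<cdot> (one \<I> \<odot> lunit E \<I>)"
    by (simp add: lunit_natural)
  then have "lunit E (\<I> \<otimes> \<I>) = one \<I> \<odot> lunit E \<I>"
    by (rule iso_cancel_left [OF category, rotated 5]) simp_all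
  then show "lunit E \<I> \<odot> one \<I> = runit E \<I> \<odot> one \<I>"
    using lunit_tens [of \<I> \<I>] triangle [of \<I> \<I>] by simp
qed simp_all

section \<open>Inverse unitors\<close>

lemma linv_natural:
  assumes [simp]: "f \<in> arr E" "src E f = X"
  shows "(one \<I> \<odot> f) \<cdot> linv X = linv (tgt E f) \<cdot> f"
proof -
  have [simp]: "X \<in> ob E" using category_arr(1) [of E f] by simp
  have "lunit E (tgt E f) \<cdot> (one \<I> \<odot> f) \<cdot> linv X = (f \<cdot> lunit E X) \<cdot> linv X"
    using lunit_natural [of f] by (simp flip: cmp_assoc)
  also have "\<dots> = f"
    by (simp add: cmp_assoc)
  finally have "lunit E (tgt E f) \<cdot> (one \<I> \<odot> f) \<cdot> linv X = f" .
  then have "linv (tgt E f) \<cdot> lunit E (tgt E f) \<cdot> (one \<I> \<odot> f) \<cdot> linv X = linv (tgt E f) \<cdot> f"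
    by simp
  then show ?thesis by (simp flip: cmp_assoc)
qed

lemma rinv_natural:
  assumes [simp]: "f \<in> arr E" "src E f = X"
  shows "(f \<odot> one \<I>) \<cdot> rinv X = rinv (tgt E f) \<cdot> f"
proof -
  have [simp]: "X \<in> ob E" using category_arr(1) [of E f] by simp
  have "runit E (tgt E f) \<cdot> (f \<odot> one \<I>) \<cdot> rinv X = (f \<cdot> runit E X) \<cdot> rinv X"
    using runit_natural [of f] by (simp flip: cmp_assoc)
  also have "\<dots> = f"
    by (simp add: cmp_assoc)
  finally have "runit E (tgt E f) \<cdot> (f \<odot> one \<I>) \<cdot> rinv X = f" .
  then have "rinv (tgt E f) \<cdot> runit E (tgt E f) \<cdot> (f \<odot> one \<I>) \<cdot> rinv X = rinv (tgt E f) \<cdot> f"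
    by simp
  then show ?thesis by (simp flip: cmp_assoc)
qed

text \<open>Absorbs the associator that \<open>ecmp_assoc\<close> leaves behind in
  \<open>post_ecmp\<close>. The next two lemmas do the same for \<open>pre_ecmp\<close> and
  \<open>ecmp_pre_post\<close>.\<close>

lemma linv_tens:
  assumes [simp]: "X \<in> ob E" "Y \<in> ob E"
  shows "assoc E \<I> X Y \<cdot> (linv X \<odot> one Y) = linv (X \<otimes> Y)"
proof (rule iso_cancel_left [OF category])
  show "lunit E (X \<otimes> Y) \<cdot> assoc E \<I> X Y \<cdot> (linv X \<odot> one Y) = lunit E (X \<otimes> Y) \<cdot> linv (X \<otimes> Y)"
    by (simp add: lunit_tens interchange flip: cmp_assoc)
qed simp_all

lemma rinv_tens:
  assumes [simp]: "X \<in> ob E" "Y \<in> ob E"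
  shows "assoc E X Y \<I> \<cdot> rinv (X \<otimes> Y) = one X \<odot> rinv Y"
proof (rule iso_cancel_left [OF category])
  show "is_iso E (one X \<odot> runit E Y)"
    by (simp add: is_iso_tens)
  show "(one X \<odot> runit E Y) \<cdot> assoc E X Y \<I> \<cdot> rinv (X \<otimes> Y) = (one X \<odot> runit E Y) \<cdot> (one X \<odot> rinv Y)"
    by (simp add: runit_tens interchange flip: cmp_assoc)
qed simp_all

lemma triangle_inv:
  assumes [simp]: "X \<in> ob E" "Y \<in> ob E"
  shows "assoc E X \<I> Y \<cdot> (rinv X \<odot> one Y) = one X \<odot> linv Y"
proof (rule iso_cancel_left [OF category])
  show "is_iso E (one X \<odot> lunit E Y)"
    by (simp add: is_iso_tens)
  show "(one X \<odot> lunit E Y) \<cdot> assoc E X \<I> Y \<cdot> (rinv X \<odot> one Y) = (one X \<odot> lunit E Y) \<cdot> (one X \<odot> linv Y)"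
    by (simp add: triangle interchange flip: cmp_assoc)
qed simp_all

section \<open>Enriched categories\<close>

text \<open>With \<open>src\<close>, \<open>tgt\<close> and \<open>el\<close> an underlying arrow
  can stay a variable and need not be split into a triple.\<close>

definition el :: "('x, 'o, 'a, 'm) ecategory_scheme \<Rightarrow> 'x \<times> 'x \<times> 'a \<Rightarrow> 'a" where
  "el \<A> k = snd (snd k)"

lemma el_eq [simp]: "el \<A> (A, B, f) = f"
  by (simp add: el_def)

abbreviation "post \<equiv> ehom_post E"
abbreviation "pre \<equiv> ehom_pre E"

lemma und_simps [simp]:
  "ob (und E \<A>) = eob \<A>"
  "(B, C, g) \<in> arr (und E \<A>) \<longleftrightarrow> B \<in> eob \<A> \<and> C \<in> eob \<A> \<and> g \<in> hom E \<I> (ehom \<A> B C)"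
  "src (und E \<A>) (B, C, g) = B" "tgt (und E \<A>) (B, C, g) = C"
  "ident (und E \<A>) A = (A, A, eid \<A> A)"
  by (simp_all add: und_def)

lemma und_arrE:
  assumes "k \<in> arr (und E \<A>)"
  obtains B C g where "k = (B, C, g)" "B \<in> eob \<A>" "C \<in> eob \<A>" "g \<in> arr E" "src E g = \<I>" "tgt E g = ehom \<A> B C"
  using assms by (cases k) auto

lemma und_arr [simp]:
  assumes "k \<in> arr (und E \<A>)"
  shows "src (und E \<A>) k \<in> eob \<A>" "tgt (und E \<A>) k \<in> eob \<A>"
    "el \<A> k \<in> arr E" "src E (el \<A> k) = \<I>" "tgt E (el \<A> k) = ehom \<A> (src (und E \<A>) k) (tgt (und E \<A>) k)"
  using assms by (auto elim!: und_arrE)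

lemma und_cmp_eq:
  "src (und E \<A>) k = B \<Longrightarrow> tgt (und E \<A>) l = B \<Longrightarrow> k \<cdot>\<^bsub>und E \<A>\<^esub> l =
    (src (und E \<A>) l, tgt (und E \<A>) k,
      ecmp \<A> (src (und E \<A>) l) B (tgt (und E \<A>) k) \<cdot> (el \<A> k \<odot> el \<A> l) \<cdot> linv \<I>)"
  by (cases k; cases l) (simp add: und_def)

lemma und_eqI:
  assumes "src (und E \<A>) k = src (und E \<A>) l" "tgt (und E \<A>) k = tgt (und E \<A>) l" "el \<A> k = el \<A> l"
  shows "k = l"
  using assms by (cases k; cases l) simp

lemma ecategory_laws:
  assumes "is_ecategory E \<A>" "A \<in> eob \<A>" "B \<in> eob \<A>"
  shows "C \<in> eob \<A> \<Longrightarrow> D \<in> eob \<A> \<Longrightarrow> ecmp \<A> A B D \<cdot> (ecmp \<A> B C D \<odot> one (ehom \<A> A B)) =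
      ecmp \<A> A C D \<cdot> (one (ehom \<A> C D) \<odot> ecmp \<A> A B C) \<cdot> assoc E (ehom \<A> C D) (ehom \<A> B C) (ehom \<A> A B)"
    and "ecmp \<A> A B B \<cdot> (eid \<A> B \<odot> one (ehom \<A> A B)) = lunit E (ehom \<A> A B)"
    and "ecmp \<A> A A B \<cdot> (one (ehom \<A> A B) \<odot> eid \<A> A) = runit E (ehom \<A> A B)"
  using assms by (auto simp: is_ecategory_def)

lemma ecategory_simps [simp]:
  assumes "is_ecategory E \<A>"
  shows "A \<in> eob \<A> \<Longrightarrow> B \<in> eob \<A> \<Longrightarrow> ehom \<A> A B \<in> ob E"
    and "A \<in> eob \<A> \<Longrightarrow> eid \<A> A \<in> arr E"
    and "A \<in> eob \<A> \<Longrightarrow> src E (eid \<A> A) = \<I>"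
    and "A \<in> eob \<A> \<Longrightarrow> tgt E (eid \<A> A) = ehom \<A> A A"
    and "A \<in> eob \<A> \<Longrightarrow> B \<in> eob \<A> \<Longrightarrow> C \<in> eob \<A> \<Longrightarrow> ecmp \<A> A B C \<in> arr E"
    and "A \<in> eob \<A> \<Longrightarrow> B \<in> eob \<A> \<Longrightarrow> C \<in> eob \<A> \<Longrightarrow> src E (ecmp \<A> A B C) = ehom \<A> B C \<otimes> ehom \<A> A B"
    and "A \<in> eob \<A> \<Longrightarrow> B \<in> eob \<A> \<Longrightarrow> C \<in> eob \<A> \<Longrightarrow> tgt E (ecmp \<A> A B C) = ehom \<A> A C"
  using assms by (auto simp: is_ecategory_def)

text \<open>The associativity law for generalised elements with arbitrary sources; naturality of the
  associator carries f, g, h through it.\<close>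

lemma ecmp_assoc:
  assumes A: "is_ecategory E \<A>"
    and [simp]: "A \<in> eob \<A>" "B \<in> eob \<A>" "C \<in> eob \<A>" "D \<in> eob \<A>" "f \<in> arr E" "g \<in> arr E" "h \<in> arr E"
      "tgt E f = ehom \<A> C D" "tgt E g = ehom \<A> B C" "tgt E h = ehom \<A> A B"
  shows "ecmp \<A> A B D \<cdot> ((ecmp \<A> B C D \<cdot> (f \<odot> g)) \<odot> h) =
    ecmp \<A> A C D \<cdot> (f \<odot> (ecmp \<A> A B C \<cdot> (g \<odot> h))) \<cdot> assoc E (src E f) (src E g) (src E h)"
proof -
  note [simp] = A
  have "ecmp \<A> A B D \<cdot> ((ecmp \<A> B C D \<cdot> (f \<odot> g)) \<odot> h)
      = ecmp \<A> A B D \<cdot> (ecmp \<A> B C D \<odot> one (ehom \<A> A B)) \<cdot> ((f \<odot> g) \<odot> h)"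
    by (simp add: interchange)
  also have "\<dots> = (ecmp \<A> A B D \<cdot> (ecmp \<A> B C D \<odot> one (ehom \<A> A B))) \<cdot> ((f \<odot> g) \<odot> h)"
    by (simp add: cmp_assoc)
  also have "ecmp \<A> A B D \<cdot> (ecmp \<A> B C D \<odot> one (ehom \<A> A B)) = ecmp \<A> A C D \<cdot> (one (ehom \<A> C D) \<odot> ecmp \<A> A B C) \<cdot>
          assoc E (ehom \<A> C D) (ehom \<A> B C) (ehom \<A> A B)"
    by (simp add: ecategory_laws)
  also have "\<dots> \<cdot> ((f \<odot> g) \<odot> h) = ecmp \<A> A C D \<cdot> (one (ehom \<A> C D) \<odot> ecmp \<A> A B C) \<cdot>
      (f \<odot> g \<odot> h) \<cdot> assoc E (src E f) (src E g) (src E h)"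
    by (simp add: cmp_assoc assoc_natural)
  finally show ?thesis
    by (simp add: interchange')
qed

lemma ecmp_eid:
  assumes A: "is_ecategory E \<A>"
    and [simp]: "A \<in> eob \<A>" "B \<in> eob \<A>" "f \<in> arr E" "tgt E f = ehom \<A> A B"
  shows "ecmp \<A> A B B \<cdot> (eid \<A> B \<odot> f) = f \<cdot> lunit E (src E f)"
    and "ecmp \<A> A A B \<cdot> (f \<odot> eid \<A> A) = f \<cdot> runit E (src E f)"
proof -
  note [simp] = A
  have "ecmp \<A> A B B \<cdot> (eid \<A> B \<odot> f) = ecmp \<A> A B B \<cdot> (eid \<A> B \<odot> one (ehom \<A> A B)) \<cdot> (one \<I> \<odot> f)"
    by (simp add: interchange)
  also have "\<dots> = (ecmp \<A> A B B \<cdot> (eid \<A> B \<odot> one (ehom \<A> A B))) \<cdot> (one \<I> \<odot> f)"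
    by (simp add: cmp_assoc)
  also have "ecmp \<A> A B B \<cdot> (eid \<A> B \<odot> one (ehom \<A> A B)) = lunit E (ehom \<A> A B)"
    by (simp add: ecategory_laws)
  finally show "ecmp \<A> A B B \<cdot> (eid \<A> B \<odot> f) = f \<cdot> lunit E (src E f)"
    by (simp add: lunit_natural)
  have "ecmp \<A> A A B \<cdot> (f \<odot> eid \<A> A) = ecmp \<A> A A B \<cdot> (one (ehom \<A> A B) \<odot> eid \<A> A) \<cdot> (f \<odot> one \<I>)"
    by (simp add: interchange)
  also have "\<dots> = (ecmp \<A> A A B \<cdot> (one (ehom \<A> A B) \<odot> eid \<A> A)) \<cdot> (f \<odot> one \<I>)"
    by (simp add: cmp_assoc)
  also have "ecmp \<A> A A B \<cdot> (one (ehom \<A> A B) \<odot> eid \<A> A) = runit E (ehom \<A> A B)"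
    by (simp add: ecategory_laws)
  finally show "ecmp \<A> A A B \<cdot> (f \<odot> eid \<A> A) = f \<cdot> runit E (src E f)"
    by (simp add: runit_natural)
qed

section \<open>Composition with underlying arrows, on generalised elements\<close>

lemma post_typing [simp]:
  assumes "is_ecategory E \<A>" "A \<in> eob \<A>" "k \<in> arr (und E \<A>)"
  shows "post \<A> A k \<in> arr E" "src E (post \<A> A k) = ehom \<A> A (src (und E \<A>) k)"
    "tgt E (post \<A> A k) = ehom \<A> A (tgt (und E \<A>) k)"
  using assms by (auto simp: ehom_post_def elim!: und_arrE)

lemma pre_typing [simp]:
  assumes "is_ecategory E \<A>" "A \<in> eob \<A>" "k \<in> arr (und E \<A>)"
  shows "pre \<A> k A \<in> arr E" "src E (pre \<A> k A) = ehom \<A> (tgt (und E \<A>) k) A"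
    "tgt E (pre \<A> k A) = ehom \<A> (src (und E \<A>) k) A"
  using assms by (auto simp: ehom_pre_def elim!: und_arrE)

text \<open>Reads \<A>(A,k) at a generalised element h as the composite kh. Naturality moves the
  inverse unitor past h, so only the one at the source of h remains.\<close>

lemma post_apply:
  assumes [simp]: "is_ecategory E \<A>" "A \<in> eob \<A>" "k \<in> arr (und E \<A>)" "h \<in> arr E"
    and h: "tgt E h = ehom \<A> A (src (und E \<A>) k)"
  shows "post \<A> A k \<cdot> h = ecmp \<A> A (src (und E \<A>) k) (tgt (und E \<A>) k) \<cdot> (el \<A> k \<odot> h) \<cdot> linv (src E h)"
proof -
  obtain B C g where k: "k = (B, C, g)" and [simp]: "B \<in> eob \<A>" "C \<in> eob \<A>" "g \<in> arr E" "src E g = \<I>" "tgt E g = ehom \<A> B C"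
    by (rule und_arrE [OF assms(3)])
  have [simp]: "tgt E h = ehom \<A> A B"
    using h k by simp
  have "linv (ehom \<A> A B) \<cdot> h = (one \<I> \<odot> h) \<cdot> linv (src E h)"
    by (simp add: linv_natural)
  then show ?thesis
    by (simp add: k ehom_post_def cmp_assoc interchange')
qed

lemma pre_apply:
  assumes [simp]: "is_ecategory E \<A>" "C \<in> eob \<A>" "k \<in> arr (und E \<A>)" "h \<in> arr E"
    and h: "tgt E h = ehom \<A> (tgt (und E \<A>) k) C"
  shows "pre \<A> k C \<cdot> h = ecmp \<A> (src (und E \<A>) k) (tgt (und E \<A>) k) C \<cdot> (h \<odot> el \<A> k) \<cdot> rinv (src E h)"
proof -
  obtain A B g where k: "k = (A, B, g)" and [simp]: "A \<in> eob \<A>" "B \<in> eob \<A>" "g \<in> arr E" "src E g = \<I>" "tgt E g = ehom \<A> A B"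
    by (rule und_arrE [OF assms(3)])
  have [simp]: "tgt E h = ehom \<A> B C"
    using h k by simp
  have "rinv (ehom \<A> B C) \<cdot> h = (h \<odot> one \<I>) \<cdot> rinv (src E h)"
    by (simp add: rinv_natural)
  then show ?thesis
    by (simp add: k ehom_pre_def cmp_assoc interchange')
qed

text \<open>The law k(fg) = (kf)g: associativity for \<open>el \<A> k\<close>, f, g, the associator
  being absorbed by \<open>linv_tens\<close>.\<close>

lemma post_ecmp:
  assumes [simp]: "is_ecategory E \<A>" "A \<in> eob \<A>" "B \<in> eob \<A>" "C \<in> eob \<A>"
      "k \<in> arr (und E \<A>)" "src (und E \<A>) k = C" "f \<in> arr E" "g \<in> arr E"
      "tgt E f = ehom \<A> B C" "tgt E g = ehom \<A> A B"
  shows "post \<A> A k \<cdot> ecmp \<A> A B C \<cdot> (f \<odot> g) = ecmp \<A> A B (tgt (und E \<A>) k) \<cdot> ((post \<A> B k \<cdot> f) \<odot> g)"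
proof -
  let ?D = "tgt (und E \<A>) k"
  have "post \<A> A k \<cdot> ecmp \<A> A B C \<cdot> (f \<odot> g)
      = ecmp \<A> A C ?D \<cdot> (el \<A> k \<odot> (ecmp \<A> A B C \<cdot> (f \<odot> g))) \<cdot> assoc E \<I> (src E f) (src E g) \<cdot> (linv (src E f) \<odot> one (src E g))"
    by (simp add: post_apply linv_tens)
  also have "\<dots> = (ecmp \<A> A B ?D \<cdot> ((ecmp \<A> B C ?D \<cdot> (el \<A> k \<odot> f)) \<odot> g)) \<cdot> (linv (src E f) \<odot> one (src E g))"
    by (simp add: ecmp_assoc cmp_assoc)
  also have "\<dots> = ecmp \<A> A B ?D \<cdot> ((post \<A> B k \<cdot> f) \<odot> g)"
    by (simp add: cmp_assoc interchange post_apply)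
  finally show ?thesis .
qed

text \<open>The law (fg)k = f(gk), with \<open>rinv_tens\<close> in place of
  \<open>linv_tens\<close>.\<close>

lemma pre_ecmp:
  assumes [simp]: "is_ecategory E \<A>" "B \<in> eob \<A>" "C \<in> eob \<A>" "D \<in> eob \<A>"
      "k \<in> arr (und E \<A>)" "tgt (und E \<A>) k = B" "f \<in> arr E" "g \<in> arr E"
      "tgt E f = ehom \<A> C D" "tgt E g = ehom \<A> B C"
  shows "pre \<A> k D \<cdot> ecmp \<A> B C D \<cdot> (f \<odot> g) = ecmp \<A> (src (und E \<A>) k) C D \<cdot> (f \<odot> (pre \<A> k C \<cdot> g))"
proof -
  let ?A = "src (und E \<A>) k"
  have "pre \<A> k D \<cdot> ecmp \<A> B C D \<cdot> (f \<odot> g)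
      = (ecmp \<A> ?A B D \<cdot> ((ecmp \<A> B C D \<cdot> (f \<odot> g)) \<odot> el \<A> k)) \<cdot> rinv (src E f \<otimes> src E g)"
    by (simp add: pre_apply cmp_assoc)
  also have "\<dots> = ecmp \<A> ?A C D \<cdot> (f \<odot> (ecmp \<A> ?A B C \<cdot> (g \<odot> el \<A> k))) \<cdot>
      assoc E (src E f) (src E g) \<I> \<cdot> rinv (src E f \<otimes> src E g)"
    by (simp add: ecmp_assoc cmp_assoc)
  also have "\<dots> = ecmp \<A> ?A C D \<cdot> (f \<odot> (pre \<A> k C \<cdot> g))"
    by (simp add: rinv_tens cmp_assoc interchange pre_apply)
  finally show ?thesis .
qed

text \<open>The law (fk)g = f(kg). The unit object stands in the middle, and
  \<open>triangle_inv\<close> exchanges the right inverse unitor for the left one. Later this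
  carries strengths and counits from one factor of a composite to the other.\<close>

lemma ecmp_pre_post:
  assumes [simp]: "is_ecategory E \<A>" "A \<in> eob \<A>" "D \<in> eob \<A>"
      "k \<in> arr (und E \<A>)" "src (und E \<A>) k = B" "f \<in> arr E" "g \<in> arr E"
      "tgt E f = ehom \<A> (tgt (und E \<A>) k) D" "tgt E g = ehom \<A> A B"
  shows "ecmp \<A> A B D \<cdot> ((pre \<A> k D \<cdot> f) \<odot> g) = ecmp \<A> A (tgt (und E \<A>) k) D \<cdot> (f \<odot> (post \<A> A k \<cdot> g))"
proof -
  let ?C = "tgt (und E \<A>) k"
  have [simp]: "B \<in> eob \<A>"
    using und_arr(1) [of k \<A>] by simp
  have "ecmp \<A> A B D \<cdot> ((pre \<A> k D \<cdot> f) \<odot> g)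
      = (ecmp \<A> A B D \<cdot> ((ecmp \<A> B ?C D \<cdot> (f \<odot> el \<A> k)) \<odot> g)) \<cdot> (rinv (src E f) \<odot> one (src E g))"
    by (simp add: pre_apply cmp_assoc interchange)
  also have "\<dots> = ecmp \<A> A ?C D \<cdot> (f \<odot> (ecmp \<A> A B ?C \<cdot> (el \<A> k \<odot> g))) \<cdot>
      assoc E (src E f) \<I> (src E g) \<cdot> (rinv (src E f) \<odot> one (src E g))"
    by (simp add: ecmp_assoc cmp_assoc)
  also have "\<dots> = ecmp \<A> A ?C D \<cdot> (f \<odot> (post \<A> A k \<cdot> g))"
    by (simp add: triangle_inv cmp_assoc interchange post_apply)
  finally show ?thesis .
qed

lemma und_cmp_typing:
  assumes "is_ecategory E \<A>" "k \<in> arr (und E \<A>)" "l \<in> arr (und E \<A>)" "tgt (und E \<A>) l = src (und E \<A>) k"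
  shows "k \<cdot>\<^bsub>und E \<A>\<^esub> l \<in> arr (und E \<A>)" "src (und E \<A>) (k \<cdot>\<^bsub>und E \<A>\<^esub> l) = src (und E \<A>) l"
    "tgt (und E \<A>) (k \<cdot>\<^bsub>und E \<A>\<^esub> l) = tgt (und E \<A>) k"
  using assms by (auto simp: und_cmp_eq elim!: und_arrE)

text \<open>A composite is read as k acting on l or as l acting on k. The second reading has a right
  unitor at \<I> where \<open>und\<close> has the left one; \<open>lunit_unit\<close> identifies
  them.\<close>

lemma
  assumes "is_ecategory E \<A>" "k \<in> arr (und E \<A>)" "l \<in> arr (und E \<A>)" "tgt (und E \<A>) l = src (und E \<A>) k"
  shows el_cmp_post: "el \<A> (k \<cdot>\<^bsub>und E \<A>\<^esub> l) = post \<A> (src (und E \<A>) l) k \<cdot> el \<A> l"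
    and el_cmp_pre: "el \<A> (k \<cdot>\<^bsub>und E \<A>\<^esub> l) = pre \<A> l (tgt (und E \<A>) k) \<cdot> el \<A> k"
  using assms by (simp_all add: und_cmp_eq post_apply pre_apply lunit_unit)

text \<open>The primed rules carry an arrow h on the right and so rewrite inside composites
  bracketed to the right; the forms without it follow for h an identity.\<close>

lemma post_cmp':
  assumes [simp]: "is_ecategory E \<A>" "A \<in> eob \<A>" "k \<in> arr (und E \<A>)" "l \<in> arr (und E \<A>)"
     "tgt (und E \<A>) l = src (und E \<A>) k" "h \<in> arr E" "tgt E h = ehom \<A> A (src (und E \<A>) l)"
  shows "post \<A> A (k \<cdot>\<^bsub>und E \<A>\<^esub> l) \<cdot> h = post \<A> A k \<cdot> post \<A> A l \<cdot> h"
proof -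
  let ?B = "src (und E \<A>) l" and ?C = "src (und E \<A>) k"
  have "post \<A> A k \<cdot> post \<A> A l \<cdot> h = (post \<A> A k \<cdot> ecmp \<A> A ?B ?C \<cdot> (el \<A> l \<odot> h)) \<cdot> linv (src E h)"
    by (simp add: post_apply [of _ _ l] cmp_assoc)
  also have "\<dots> = (ecmp \<A> A ?B (tgt (und E \<A>) k) \<cdot> ((post \<A> ?B k \<cdot> el \<A> l) \<odot> h)) \<cdot> linv (src E h)"
    by (simp add: post_ecmp)
  also have "\<dots> = post \<A> A (k \<cdot>\<^bsub>und E \<A>\<^esub> l) \<cdot> h"
    by (simp add: post_apply [of _ _ "k \<cdot>\<^bsub>und E \<A>\<^esub> l"] und_cmp_typing el_cmp_post cmp_assoc)
  finally show ?thesis ..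
qed

lemma pre_cmp':
  assumes [simp]: "is_ecategory E \<A>" "D \<in> eob \<A>" "k \<in> arr (und E \<A>)" "l \<in> arr (und E \<A>)"
     "tgt (und E \<A>) l = src (und E \<A>) k" "h \<in> arr E" "tgt E h = ehom \<A> (tgt (und E \<A>) k) D"
  shows "pre \<A> (k \<cdot>\<^bsub>und E \<A>\<^esub> l) D \<cdot> h = pre \<A> l D \<cdot> pre \<A> k D \<cdot> h"
proof -
  let ?B = "src (und E \<A>) k" and ?C = "tgt (und E \<A>) k"
  have "pre \<A> l D \<cdot> pre \<A> k D \<cdot> h = (pre \<A> l D \<cdot> ecmp \<A> ?B ?C D \<cdot> (h \<odot> el \<A> k)) \<cdot> rinv (src E h)"
    by (simp add: pre_apply [of _ _ k] cmp_assoc)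
  also have "\<dots> = (ecmp \<A> (src (und E \<A>) l) ?C D \<cdot> (h \<odot> (pre \<A> l ?C \<cdot> el \<A> k))) \<cdot> rinv (src E h)"
    by (simp add: pre_ecmp)
  also have "\<dots> = pre \<A> (k \<cdot>\<^bsub>und E \<A>\<^esub> l) D \<cdot> h"
    by (simp add: pre_apply [of _ _ "k \<cdot>\<^bsub>und E \<A>\<^esub> l"] und_cmp_typing el_cmp_pre cmp_assoc)
  finally show ?thesis ..
qed

text \<open>Bifunctoriality of the hom objects, oriented so that \<open>pre\<close> moves outwards
  and \<open>post\<close> comes next to \<open>coev\<close>. The objects A and C are given by
  equations so that the rule still matches once their sources have been rewritten.\<close>

lemma post_pre':
  assumes [simp]: "is_ecategory E \<A>" "k \<in> arr (und E \<A>)" "l \<in> arr (und E \<A>)" "A = src (und E \<A>) l" "C = src (und E \<A>) k"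
     "h \<in> arr E" "tgt E h = ehom \<A> (tgt (und E \<A>) l) (src (und E \<A>) k)"
  shows "post \<A> A k \<cdot> pre \<A> l C \<cdot> h = pre \<A> l (tgt (und E \<A>) k) \<cdot> post \<A> (tgt (und E \<A>) l) k \<cdot> h"
proof -
  let ?B = "tgt (und E \<A>) l" and ?D = "tgt (und E \<A>) k"
  have "post \<A> A k \<cdot> pre \<A> l C \<cdot> h = (post \<A> A k \<cdot> ecmp \<A> A ?B C \<cdot> (h \<odot> el \<A> l)) \<cdot> rinv (src E h)"
    by (simp add: pre_apply cmp_assoc)
  also have "\<dots> = (ecmp \<A> A ?B ?D \<cdot> ((post \<A> ?B k \<cdot> h) \<odot> el \<A> l)) \<cdot> rinv (src E h)"
    by (simp add: post_ecmp)
  also have "\<dots> = pre \<A> l ?D \<cdot> post \<A> ?B k \<cdot> h"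
    by (simp add: pre_apply cmp_assoc)
  finally show ?thesis .
qed

lemma post_ident [simp]:
  assumes [simp]: "is_ecategory E \<A>" "A \<in> eob \<A>" "B \<in> eob \<A>"
  shows "post \<A> A (B, B, eid \<A> B) = one (ehom \<A> A B)"
    and "pre \<A> (B, B, eid \<A> B) A = one (ehom \<A> B A)"
  using post_apply [of \<A> A "(B, B, eid \<A> B)" "one (ehom \<A> A B)"]
    pre_apply [of \<A> A "(B, B, eid \<A> B)" "one (ehom \<A> B A)"]
  by (simp_all add: ecmp_eid flip: cmp_assoc)

text \<open>The Yoneda argument: an underlying arrow is recovered from its action on an identity.
  This yields the unit laws of the underlying category.\<close>

lemma post_eid:
  assumes [simp]: "is_ecategory E \<A>" "k \<in> arr (und E \<A>)"
  shows "src (und E \<A>) k = A \<Longrightarrow> post \<A> A k \<cdot> eid \<A> A = el \<A> k"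
    and "tgt (und E \<A>) k = B \<Longrightarrow> pre \<A> k B \<cdot> eid \<A> B = el \<A> k"
proof -
  have "(el \<A> k \<cdot> lunit E \<I>) \<cdot> linv \<I> = el \<A> k"
    by (simp add: cmp_assoc)
  then show "src (und E \<A>) k = A \<Longrightarrow> post \<A> A k \<cdot> eid \<A> A = el \<A> k"
    and "tgt (und E \<A>) k = B \<Longrightarrow> pre \<A> k B \<cdot> eid \<A> B = el \<A> k"
    by (auto simp: post_apply pre_apply ecmp_eid simp flip: cmp_assoc lunit_unit)
qed

lemma category_und [simp]:
  assumes [simp]: "is_ecategory E \<A>"
  shows "is_category (und E \<A>)"
  unfolding is_category_def
proof (intro conjI ballI impI)
  fix f assume "f \<in> arr (und E \<A>)"
  then show "f \<cdot>\<^bsub>und E \<A>\<^esub> ident (und E \<A>) (src (und E \<A>) f) = f"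
    "ident (und E \<A>) (tgt (und E \<A>) f) \<cdot>\<^bsub>und E \<A>\<^esub> f = f"
    by (auto intro!: und_eqI [of \<A>] simp: und_cmp_typing el_cmp_post post_eid)
next
  fix f g h
  assume "f \<in> arr (und E \<A>)" "g \<in> arr (und E \<A>)" "h \<in> arr (und E \<A>)"
    "tgt (und E \<A>) f = src (und E \<A>) g" "tgt (und E \<A>) g = src (und E \<A>) h"
  then show "(h \<cdot>\<^bsub>und E \<A>\<^esub> g) \<cdot>\<^bsub>und E \<A>\<^esub> f = h \<cdot>\<^bsub>und E \<A>\<^esub> g \<cdot>\<^bsub>und E \<A>\<^esub> f"
    by (intro und_eqI [of \<A>]) (simp_all add: und_cmp_typing el_cmp_post post_cmp')
qed (simp_all add: und_cmp_typing)

lemma und_cmp_eid [simp]: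
  assumes "is_ecategory E \<A>" "k \<in> arr (und E \<A>)"
  shows "src (und E \<A>) k = A \<Longrightarrow> k \<cdot>\<^bsub>und E \<A>\<^esub> (A, A, eid \<A> A) = k"
    and "tgt (und E \<A>) k = A \<Longrightarrow> (A, A, eid \<A> A) \<cdot>\<^bsub>und E \<A>\<^esub> k = k"
  using cmp_ident [OF category_und, of \<A> k A] assms by simp_all

lemma post_cmp:
  assumes [simp]: "is_ecategory E \<A>" "A \<in> eob \<A>" "k \<in> arr (und E \<A>)" "l \<in> arr (und E \<A>)"
     "tgt (und E \<A>) l = src (und E \<A>) k"
  shows "post \<A> A (k \<cdot>\<^bsub>und E \<A>\<^esub> l) = post \<A> A k \<cdot> post \<A> A l"
  using post_cmp' [of \<A> A k l "one (ehom \<A> A (src (und E \<A>) l))"] by simp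

lemma pre_cmp:
  assumes [simp]: "is_ecategory E \<A>" "D \<in> eob \<A>" "k \<in> arr (und E \<A>)" "l \<in> arr (und E \<A>)"
     "tgt (und E \<A>) l = src (und E \<A>) k"
  shows "pre \<A> (k \<cdot>\<^bsub>und E \<A>\<^esub> l) D = pre \<A> l D \<cdot> pre \<A> k D"
  using pre_cmp' [of \<A> D k l "one (ehom \<A> (tgt (und E \<A>) k) D)"] by simp

section \<open>Enriched functors\<close>

abbreviation "uf F \<equiv> farr (und_functor E F)"

lemma efunctor_extensional:
  assumes "is_efunctor E \<A> \<B> F"
  shows "eob_map F \<in> extensional (eob \<A>)" "ehom_map F \<in> extensional (eob \<A> \<times> eob \<A>)"
  using assms by (simp_all add: is_efunctor_def PiE_def)

lemma efunctor_ecmp_law: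
  assumes "is_efunctor E \<A> \<B> F" "A \<in> eob \<A>" "B \<in> eob \<A>" "C \<in> eob \<A>"
  shows "ehom_map F (A, C) \<cdot> ecmp \<A> A B C =
    ecmp \<B> (eob_map F A) (eob_map F B) (eob_map F C) \<cdot> (ehom_map F (B, C) \<odot> ehom_map F (A, B))"
  using assms by (auto simp: is_efunctor_def)

lemma efunctor_simps [simp]:
  assumes "is_efunctor E \<A> \<B> F" "A \<in> eob \<A>"
  shows "eob_map F A \<in> eob \<B>" "ehom_map F (A, A) \<cdot> eid \<A> A = eid \<B> (eob_map F A)"
    "B \<in> eob \<A> \<Longrightarrow> ehom_map F (A, B) \<in> arr E"
    "B \<in> eob \<A> \<Longrightarrow> src E (ehom_map F (A, B)) = ehom \<A> A B"
    "B \<in> eob \<A> \<Longrightarrow> tgt E (ehom_map F (A, B)) = ehom \<B> (eob_map F A) (eob_map F B)"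
  using assms by (auto simp: is_efunctor_def)

lemma efunctor_ecmp:
  assumes F: "is_efunctor E \<A> \<B> F" and [simp]: "is_ecategory E \<A>" "is_ecategory E \<B>"
    "A \<in> eob \<A>" "B \<in> eob \<A>" "C \<in> eob \<A>" "f \<in> arr E" "g \<in> arr E" "tgt E f = ehom \<A> B C" "tgt E g = ehom \<A> A B"
  shows "ehom_map F (A, C) \<cdot> ecmp \<A> A B C \<cdot> (f \<odot> g) =
    ecmp \<B> (eob_map F A) (eob_map F B) (eob_map F C) \<cdot> ((ehom_map F (B, C) \<cdot> f) \<odot> (ehom_map F (A, B) \<cdot> g))"
proof -
  note [simp] = efunctor_simps [OF F]
  have "ehom_map F (A, C) \<cdot> ecmp \<A> A B C =
    ecmp \<B> (eob_map F A) (eob_map F B) (eob_map F C) \<cdot> (ehom_map F (B, C) \<odot> ehom_map F (A, B))"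
    using F by (simp add: efunctor_ecmp_law)
  then have "(ehom_map F (A, C) \<cdot> ecmp \<A> A B C) \<cdot> (f \<odot> g) =
    (ecmp \<B> (eob_map F A) (eob_map F B) (eob_map F C) \<cdot> (ehom_map F (B, C) \<odot> ehom_map F (A, B))) \<cdot> (f \<odot> g)"
    by simp
  then show ?thesis by (simp add: cmp_assoc interchange)
qed

lemma fob_und_functor [simp]: "fob (und_functor E F) = eob_map F"
  by (simp add: und_functor_def)

lemma uf_eq: "uf F (A, B, f) = (eob_map F A, eob_map F B, ehom_map F (A, B) \<cdot> f)"
  by (simp add: und_functor_def)

lemma el_uf: "el \<B> (uf F k) = ehom_map F (src (und E \<A>) k, tgt (und E \<A>) k) \<cdot> el \<A> k"
  by (cases k) (simp add: und_functor_def)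

lemma uf_typing [simp]:
  assumes "is_efunctor E \<A> \<B> F" "k \<in> arr (und E \<A>)"
  shows "uf F k \<in> arr (und E \<B>)"
    and "src (und E \<B>) (uf F k) = eob_map F (src (und E \<A>) k)"
    and "tgt (und E \<B>) (uf F k) = eob_map F (tgt (und E \<A>) k)"
  using assms by (auto simp: uf_eq elim!: und_arrE)

lemmas efunctor_typing = efunctor_simps uf_typing

text \<open>Preservation of composition at the pair \<open>el \<A> k\<close>, h. It says that \<phi>
  is natural in its second argument; \<open>efunctor_pre'\<close> covers the first.\<close>

lemma efunctor_post':
  assumes F [simp]: "is_efunctor E \<A> \<B> F" and [simp]: "is_ecategory E \<A>" "is_ecategory E \<B>"
    "A \<in> eob \<A>" "k \<in> arr (und E \<A>)" "C = tgt (und E \<A>) k" "h \<in> arr E" "tgt E h = ehom \<A> A (src (und E \<A>) k)"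
  shows "ehom_map F (A, C) \<cdot> post \<A> A k \<cdot> h = post \<B> (eob_map F A) (uf F k) \<cdot> ehom_map F (A, src (und E \<A>) k) \<cdot> h"
proof -
  note [simp] = efunctor_typing [OF F]
  let ?B = "src (und E \<A>) k"
  have "ehom_map F (A, C) \<cdot> post \<A> A k \<cdot> h = (ehom_map F (A, C) \<cdot> ecmp \<A> A ?B C \<cdot> (el \<A> k \<odot> h)) \<cdot> linv (src E h)"
    by (simp add: post_apply cmp_assoc)
  also have "\<dots> = post \<B> (eob_map F A) (uf F k) \<cdot> ehom_map F (A, ?B) \<cdot> h"
    by (simp add: efunctor_ecmp [OF F] post_apply cmp_assoc el_uf [of _ _ _ \<A>])
  finally show ?thesis .
qed

text \<open>The previous equation reversed, as a rewrite rule that takes \<phi> to the left and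
  leaves \<open>post\<close> next to \<open>coev\<close>.\<close>

lemma post_uf:
  assumes F: "is_efunctor E \<A> \<B> F" and [simp]: "is_ecategory E \<A>" "is_ecategory E \<B>"
    "A \<in> eob \<A>" "k \<in> arr (und E \<A>)" "src (und E \<A>) k = B" "h \<in> arr E" "tgt E h = ehom \<A> A B"
  shows "post \<B> (eob_map F A) (uf F k) \<cdot> ehom_map F (A, B) \<cdot> h = ehom_map F (A, tgt (und E \<A>) k) \<cdot> post \<A> A k \<cdot> h"
  using efunctor_post' [OF F, of A k "tgt (und E \<A>) k" h] by simp

lemma efunctor_pre':
  assumes F [simp]: "is_efunctor E \<A> \<B> F" and [simp]: "is_ecategory E \<A>" "is_ecategory E \<B>"
    "C \<in> eob \<A>" "k \<in> arr (und E \<A>)" "A = src (und E \<A>) k" "h \<in> arr E" "tgt E h = ehom \<A> (tgt (und E \<A>) k) C"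
  shows "ehom_map F (A, C) \<cdot> pre \<A> k C \<cdot> h = pre \<B> (uf F k) (eob_map F C) \<cdot> ehom_map F (tgt (und E \<A>) k, C) \<cdot> h"
proof -
  note [simp] = efunctor_typing [OF F]
  let ?B = "tgt (und E \<A>) k"
  have "ehom_map F (A, C) \<cdot> pre \<A> k C \<cdot> h = (ehom_map F (A, C) \<cdot> ecmp \<A> A ?B C \<cdot> (h \<odot> el \<A> k)) \<cdot> rinv (src E h)"
    by (simp add: pre_apply cmp_assoc)
  also have "\<dots> = pre \<B> (uf F k) (eob_map F C) \<cdot> ehom_map F (?B, C) \<cdot> h"
    by (simp add: efunctor_ecmp [OF F] pre_apply cmp_assoc el_uf [of _ _ _ \<A>])
  finally show ?thesis .
qed

lemma uf_cmp:
  assumes F [simp]: "is_efunctor E \<A> \<B> F" and [simp]: "is_ecategory E \<A>" "is_ecategory E \<B>"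
    "k \<in> arr (und E \<A>)" "l \<in> arr (und E \<A>)" "tgt (und E \<A>) l = src (und E \<A>) k"
  shows "uf F (k \<cdot>\<^bsub>und E \<A>\<^esub> l) = uf F k \<cdot>\<^bsub>und E \<B>\<^esub> uf F l"
proof (rule und_eqI [of \<B>])
  note [simp] = efunctor_typing [OF F]
  show "el \<B> (uf F (k \<cdot>\<^bsub>und E \<A>\<^esub> l)) = el \<B> (uf F k \<cdot>\<^bsub>und E \<B>\<^esub> uf F l)"
    by (simp add: el_uf [of _ _ _ \<A>] el_cmp_post efunctor_post' [OF F])
qed (simp_all add: efunctor_typing [OF F])

lemma uf_ident:
  assumes "is_efunctor E \<A> \<B> F" "A \<in> eob \<A>"
  shows "uf F (A, A, eid \<A> A) = (eob_map F A, eob_map F A, eid \<B> (eob_map F A))"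
  using assms by (simp add: uf_eq)

lemma enatural_simps:
  assumes "is_enatural E \<A> \<B> F G \<alpha>" "A \<in> eob \<A>"
  shows "\<alpha> A \<in> arr (und E \<B>)" "src (und E \<B>) (\<alpha> A) = eob_map F A" "tgt (und E \<B>) (\<alpha> A) = eob_map G A"
  using assms by (simp_all add: is_enatural_def)

lemma enatural_apply:
  assumes F [simp]: "is_efunctor E \<A> \<B> F" and G [simp]: "is_efunctor E \<A> \<B> G"
    and [simp]: "is_ecategory E \<A>" "is_ecategory E \<B>" "A \<in> eob \<A>" "B \<in> eob \<A>" "h \<in> arr E" "tgt E h = ehom \<A> A B"
    and \<alpha>: "is_enatural E \<A> \<B> F G \<alpha>"
  shows "post \<B> (eob_map F A) (\<alpha> B) \<cdot> ehom_map F (A, B) \<cdot> h =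
        pre \<B> (\<alpha> A) (eob_map G B) \<cdot> ehom_map G (A, B) \<cdot> h"
proof -
  note [simp] = enatural_simps [OF \<alpha>] efunctor_simps [OF F] efunctor_simps [OF G]
  have "post \<B> (eob_map F A) (\<alpha> B) \<cdot> ehom_map F (A, B) = pre \<B> (\<alpha> A) (eob_map G B) \<cdot> ehom_map G (A, B)"
    using \<alpha> by (simp add: is_enatural_def)
  then have "(post \<B> (eob_map F A) (\<alpha> B) \<cdot> ehom_map F (A, B)) \<cdot> h = (pre \<B> (\<alpha> A) (eob_map G B) \<cdot> ehom_map G (A, B)) \<cdot> h"
    by simp
  then show ?thesis by (simp add: cmp_assoc)
qed

text \<open>E-naturality evaluated at the global element of k: \<open>el_cmp_post\<close> reads one
  side as a composite and \<open>el_cmp_pre\<close> the other.\<close>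

lemma enatural_natural:
  assumes F [simp]: "is_efunctor E \<A> \<B> F" and G [simp]: "is_efunctor E \<A> \<B> G"
    and [simp]: "is_ecategory E \<A>" "is_ecategory E \<B>"
    and \<alpha>: "is_enatural E \<A> \<B> F G \<alpha>" and [simp]: "k \<in> arr (und E \<A>)"
  shows "\<alpha> (tgt (und E \<A>) k) \<cdot>\<^bsub>und E \<B>\<^esub> uf F k = uf G k \<cdot>\<^bsub>und E \<B>\<^esub> \<alpha> (src (und E \<A>) k)"
proof (rule und_eqI [of \<B>])
  note [simp] = enatural_simps [OF \<alpha>] efunctor_typing [OF F] efunctor_typing [OF G]
  have "el \<B> (\<alpha> (tgt (und E \<A>) k) \<cdot>\<^bsub>und E \<B>\<^esub> uf F k) =
     post \<B> (eob_map F (src (und E \<A>) k)) (\<alpha> (tgt (und E \<A>) k)) \<cdot> ehom_map F (src (und E \<A>) k, tgt (und E \<A>) k) \<cdot> el \<A> k"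
    by (simp add: el_cmp_post el_uf [of _ _ _ \<A>])
  also have "\<dots> = el \<B> (uf G k \<cdot>\<^bsub>und E \<B>\<^esub> \<alpha> (src (und E \<A>) k))"
    by (simp add: el_cmp_pre el_uf [of _ _ _ \<A>] enatural_apply [OF F G _ _ _ _ _ _ \<alpha>])
  finally show "el \<B> (\<alpha> (tgt (und E \<A>) k) \<cdot>\<^bsub>und E \<B>\<^esub> uf F k) = el \<B> (uf G k \<cdot>\<^bsub>und E \<B>\<^esub> \<alpha> (src (und E \<A>) k))" .
qed (simp_all add: efunctor_typing [OF F] efunctor_typing [OF G] enatural_simps [OF \<alpha>])

section \<open>Identity and composite E-functors\<close>

lemma id_efunctor_eqs [simp]:
  "A \<in> eob \<A> \<Longrightarrow> eob_map (id_efunctor E \<A>) A = A"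
  "A \<in> eob \<A> \<Longrightarrow> B \<in> eob \<A> \<Longrightarrow> ehom_map (id_efunctor E \<A>) (A, B) = one (ehom \<A> A B)"
  by (simp_all add: id_efunctor_def)

lemma comp_efunctor_eqs [simp]:
  "A \<in> eob \<A> \<Longrightarrow> eob_map (comp_efunctor E \<A> G F) A = eob_map G (eob_map F A)"
  "A \<in> eob \<A> \<Longrightarrow> B \<in> eob \<A> \<Longrightarrow>
    ehom_map (comp_efunctor E \<A> G F) (A, B) = ehom_map G (eob_map F A, eob_map F B) \<cdot> ehom_map F (A, B)"
  by (simp_all add: comp_efunctor_def)

lemma is_efunctorI:
  assumes [simp]: "is_ecategory E \<A>" "is_ecategory E \<B>"
    and "eob_map F \<in> extensional (eob \<A>)" "ehom_map F \<in> extensional (eob \<A> \<times> eob \<A>)"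
    and [simp]: "\<And>A. A \<in> eob \<A> \<Longrightarrow> eob_map F A \<in> eob \<B>"
    and [simp]: "\<And>A B. A \<in> eob \<A> \<Longrightarrow> B \<in> eob \<A> \<Longrightarrow> ehom_map F (A, B) \<in> arr E"
      "\<And>A B. A \<in> eob \<A> \<Longrightarrow> B \<in> eob \<A> \<Longrightarrow> src E (ehom_map F (A, B)) = ehom \<A> A B"
      "\<And>A B. A \<in> eob \<A> \<Longrightarrow> B \<in> eob \<A> \<Longrightarrow> tgt E (ehom_map F (A, B)) = ehom \<B> (eob_map F A) (eob_map F B)"
    and "\<And>A. A \<in> eob \<A> \<Longrightarrow> ehom_map F (A, A) \<cdot> eid \<A> A = eid \<B> (eob_map F A)"
    and "\<And>A B C. A \<in> eob \<A> \<Longrightarrow> B \<in> eob \<A> \<Longrightarrow> C \<in> eob \<A> \<Longrightarrow> ehom_map F (A, C) \<cdot> ecmp \<A> A B C =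
      ecmp \<B> (eob_map F A) (eob_map F B) (eob_map F C) \<cdot> (ehom_map F (B, C) \<odot> ehom_map F (A, B))"
  shows "is_efunctor E \<A> \<B> F"
  unfolding is_efunctor_def using assms(3,4,9,10) by (simp add: PiE_iff extensional_def)

lemma id_efunctor:
  assumes [simp]: "is_ecategory E \<A>"
  shows "is_efunctor E \<A> \<A> (id_efunctor E \<A>)"
  by (rule is_efunctorI) (simp_all, simp_all add: id_efunctor_def)

lemma comp_efunctor:
  assumes F: "is_efunctor E \<A> \<B> F" and G: "is_efunctor E \<B> \<C> G"
    and [simp]: "is_ecategory E \<A>" "is_ecategory E \<B>" "is_ecategory E \<C>"
  shows "is_efunctor E \<A> \<C> (comp_efunctor E \<A> G F)"
proof (rule is_efunctorI)
  note [simp] = efunctor_typing [OF F] efunctor_typing [OF G]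
  show "eob_map (comp_efunctor E \<A> G F) \<in> extensional (eob \<A>)"
    "ehom_map (comp_efunctor E \<A> G F) \<in> extensional (eob \<A> \<times> eob \<A>)"
    by (simp_all add: comp_efunctor_def)
  fix A B C assume [simp]: "A \<in> eob \<A>" "B \<in> eob \<A>" "C \<in> eob \<A>"
  show "ehom_map (comp_efunctor E \<A> G F) (A, C) \<cdot> ecmp \<A> A B C =
    ecmp \<C> (eob_map (comp_efunctor E \<A> G F) A) (eob_map (comp_efunctor E \<A> G F) B) (eob_map (comp_efunctor E \<A> G F) C) \<cdot>
    (ehom_map (comp_efunctor E \<A> G F) (B, C) \<odot> ehom_map (comp_efunctor E \<A> G F) (A, B))"
    by (simp add: cmp_assoc efunctor_ecmp_law [OF F] efunctor_ecmp [OF G])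
qed (simp_all add: efunctor_typing [OF F] efunctor_typing [OF G] cmp_assoc)

lemma uf_id: "is_ecategory E \<A> \<Longrightarrow> k \<in> arr (und E \<A>) \<Longrightarrow> uf (id_efunctor E \<A>) k = k"
  by (auto simp: uf_eq elim!: und_arrE)

lemma uf_comp:
  assumes "is_efunctor E \<A> \<B> F" "is_efunctor E \<B> \<C> G" "k \<in> arr (und E \<A>)"
  shows "uf (comp_efunctor E \<A> G F) k = uf G (uf F k)"
  using assms by (auto simp: uf_eq efunctor_simps cmp_assoc elim!: und_arrE)

section \<open>The self-enrichment\<close>

lemma closed [simp]:
  assumes "X \<in> ob E" "Y \<in> ob E"
  shows "ihom E X Y \<in> ob E" "eval E X Y \<in> arr E" "src E (eval E X Y) = ihom E X Y \<otimes> X" "tgt E (eval E X Y) = Y"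
  using closed_symmetric_monoidal assms by (auto simp: is_closed_symmetric_monoidal_def)

lemma eval_bij:
  assumes "X \<in> ob E" "Y \<in> ob E" "Z \<in> ob E"
  shows "bij_betw (\<lambda>g. eval E X Y \<cdot> (g \<odot> one X)) (hom E Z (ihom E X Y)) (hom E (Z \<otimes> X) Y)"
  using closed_symmetric_monoidal assms by (auto simp: is_closed_symmetric_monoidal_def)

lemma eval_eqI:
  assumes "X \<in> ob E" "Y \<in> ob E" "f \<in> arr E" "g \<in> arr E" "src E f = src E g"
    "tgt E f = ihom E X Y" "tgt E g = ihom E X Y" "eval E X Y \<cdot> (f \<odot> one X) = eval E X Y \<cdot> (g \<odot> one X)"
  shows "f = g"
  using eval_bij [of X Y "src E g"] assms by (auto simp: bij_betw_def inj_on_def)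

lemma transpose [simp]:
  assumes X: "X \<in> ob E" and Z: "Z \<in> ob E" and f: "f \<in> arr E" "src E f = Z \<otimes> X" "tgt E f = Y"
  shows "transpose E Z X Y f \<in> arr E" "src E (transpose E Z X Y f) = Z" "tgt E (transpose E Z X Y f) = ihom E X Y"
    "eval E X Y \<cdot> (transpose E Z X Y f \<odot> one X) = f"
proof -
  have Y: "Y \<in> ob E"
    using category_arr(2) [OF category f(1)] f(3) by simp
  have "f \<in> (\<lambda>g. eval E X Y \<cdot> (g \<odot> one X)) ` hom E Z (ihom E X Y)"
    using eval_bij [OF X Y Z] f by (simp add: bij_betw_def)
  then obtain g where g: "g \<in> hom E Z (ihom E X Y)" "eval E X Y \<cdot> (g \<odot> one X) = f"
    by auto
  moreover have "g' = g" if "g' \<in> hom E Z (ihom E X Y) \<and> eval E X Y \<cdot> (g' \<odot> one X) = f" for g'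
    using eval_eqI [of X Y g' g] X Y g that by simp
  ultimately have "transpose E Z X Y f = g"
    unfolding transpose_def by (intro the_equality) blast+
  then show "transpose E Z X Y f \<in> arr E" "src E (transpose E Z X Y f) = Z" "tgt E (transpose E Z X Y f) = ihom E X Y"
    "eval E X Y \<cdot> (transpose E Z X Y f \<odot> one X) = f"
    using g by auto
qed

lemma transpose_apply:
  assumes [simp]: "X \<in> ob E" "Z \<in> ob E" "f \<in> arr E" "src E f = Z \<otimes> X" "tgt E f = Y"
    "g \<in> arr E" "tgt E g = Z" "h \<in> arr E" "tgt E h = X"
  shows "eval E X Y \<cdot> ((transpose E Z X Y f \<cdot> g) \<odot> h) = f \<cdot> (g \<odot> h)"
proof -
  have [simp]: "Y \<in> ob E"
    using category_arr(2) [of E f] by simp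
  have "eval E X Y \<cdot> ((transpose E Z X Y f \<cdot> g) \<odot> h) = (eval E X Y \<cdot> (transpose E Z X Y f \<odot> one X)) \<cdot> (g \<odot> h)"
    by (simp add: cmp_assoc interchange del: transpose(4))
  then show ?thesis by simp
qed

lemma self_eqs [simp]:
  "eob (self E) = ob E" "ehom (self E) = ihom E"
  "eid (self E) X = transpose E \<I> X X (lunit E X)"
  by (simp_all add: self_def)

lemma self_ecmp_typing [simp]:
  assumes [simp]: "X \<in> ob E" "Y \<in> ob E" "Z \<in> ob E"
  shows "ecmp (self E) X Y Z \<in> arr E" "src E (ecmp (self E) X Y Z) = ihom E Y Z \<otimes> ihom E X Y"
    "tgt E (ecmp (self E) X Y Z) = ihom E X Z"
  by (simp_all add: self_def)

text \<open>Composition in the self-enrichment is determined by evaluation; on generalised elements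
  it means f(g(h)), up to an associator.\<close>

lemma self_ecmp:
  assumes [simp]: "A \<in> ob E" "B \<in> ob E" "C \<in> ob E" "f \<in> arr E" "g \<in> arr E" "h \<in> arr E"
    "tgt E f = ihom E B C" "tgt E g = ihom E A B" "tgt E h = A"
  shows "eval E A C \<cdot> ((ecmp (self E) A B C \<cdot> (f \<odot> g)) \<odot> h)
    = eval E B C \<cdot> (f \<odot> (eval E A B \<cdot> (g \<odot> h))) \<cdot> assoc E (src E f) (src E g) (src E h)"
proof -
  have "eval E A C \<cdot> ((ecmp (self E) A B C \<cdot> (f \<odot> g)) \<odot> h)
     = eval E B C \<cdot> (one (ihom E B C) \<odot> eval E A B) \<cdot> assoc E (ihom E B C) (ihom E A B) A \<cdot> ((f \<odot> g) \<odot> h)"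
    by (simp add: self_def transpose_apply cmp_assoc)
  then show ?thesis
    by (simp add: assoc_natural interchange')
qed

text \<open>For identities f and g, simp collapses \<open>one P \<odot> one Q\<close> and drops the
  identity that results, so the pattern of \<open>self_ecmp\<close> is no longer visible.\<close>

lemma self_ecmp1:
  assumes [simp]: "A \<in> ob E" "B \<in> ob E" "C \<in> ob E" "h \<in> arr E" "tgt E h = A"
  shows "eval E A C \<cdot> (ecmp (self E) A B C \<odot> h)
    = eval E B C \<cdot> (one (ihom E B C) \<odot> (eval E A B \<cdot> (one (ihom E A B) \<odot> h))) \<cdot> assoc E (ihom E B C) (ihom E A B) (src E h)"
  using self_ecmp [of A B C "one (ihom E B C)" "one (ihom E A B)" h] by simp

text \<open>By \<open>eval_eqI\<close> each law is tested by evaluating at an argument. Then the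
  left unit law comes down to \<open>lunit_tens\<close>, the right one to the triangle, and
  associativity to the pentagon.\<close>

lemma ecategory_self [simp]: "is_ecategory E (self E)"
  unfolding is_ecategory_def
proof (intro conjI ballI)
  fix A B assume "A \<in> eob (self E)" "B \<in> eob (self E)"
  then have [simp]: "A \<in> ob E" "B \<in> ob E" by simp_all
  show "ecmp (self E) A B B \<cdot> (eid (self E) B \<odot> one (ehom (self E) A B)) = lunit E (ehom (self E) A B)"
  proof (rule eval_eqI [of A B])
    have "eval E A B \<cdot> ((ecmp (self E) A B B \<cdot> (eid (self E) B \<odot> one (ihom E A B))) \<odot> one A)
      = eval E B B \<cdot> ((eid (self E) B \<cdot> one \<I>) \<odot> eval E A B) \<cdot> assoc E \<I> (ihom E A B) A"
      by (simp add: self_ecmp)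
    also have "\<dots> = (eval E B B \<cdot> ((eid (self E) B \<cdot> one \<I>) \<odot> eval E A B)) \<cdot> assoc E \<I> (ihom E A B) A"
      by (simp add: cmp_assoc)
    also have "\<dots> = (eval E A B \<cdot> lunit E (ihom E A B \<otimes> A)) \<cdot> assoc E \<I> (ihom E A B) A"
      using transpose_apply [of B \<I> "lunit E B" B "one \<I>" "eval E A B"]
      by (simp add: lunit_natural)
    also have "\<dots> = eval E A B \<cdot> (lunit E (ihom E A B) \<odot> one A)"
      by (simp add: cmp_assoc lunit_tens)
    finally show "eval E A B \<cdot> ((ecmp (self E) A B B \<cdot> (eid (self E) B \<odot> one (ehom (self E) A B))) \<odot> one A) =
        eval E A B \<cdot> (lunit E (ehom (self E) A B) \<odot> one A)" by simp
  qed simp_all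
  show "ecmp (self E) A A B \<cdot> (one (ehom (self E) A B) \<odot> eid (self E) A) = runit E (ehom (self E) A B)"
    by (rule eval_eqI [of A B]) (simp_all add: self_ecmp triangle)
next
  fix A B C D assume "A \<in> eob (self E)" "B \<in> eob (self E)" "C \<in> eob (self E)" "D \<in> eob (self E)"
  then have [simp]: "A \<in> ob E" "B \<in> ob E" "C \<in> ob E" "D \<in> ob E" by simp_all
  have "ecmp (self E) A B D \<cdot> (ecmp (self E) B C D \<odot> one (ihom E A B)) =
        ecmp (self E) A C D \<cdot> (one (ihom E C D) \<odot> ecmp (self E) A B C) \<cdot>
          assoc E (ihom E C D) (ihom E B C) (ihom E A B)" (is "?l = ?r")
  proof (rule eval_eqI [of A D])
    let ?u = "one (ihom E C D) \<odot> (eval E B C \<cdot> (one (ihom E B C) \<odot> eval E A B))"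
    let ?P = "ihom E C D" and ?Q = "ihom E B C" and ?R = "ihom E A B"
    have "eval E A D \<cdot> (?l \<odot> one A) = (eval E B D \<cdot> (ecmp (self E) B C D \<odot> eval E A B)) \<cdot> assoc E (?P \<otimes> ?Q) ?R A"
      by (simp add: self_ecmp cmp_assoc)
    also have "\<dots> = (eval E C D \<cdot> ?u) \<cdot> assoc E ?P ?Q (?R \<otimes> A) \<cdot> assoc E (?P \<otimes> ?Q) ?R A"
      by (simp add: self_ecmp1 cmp_assoc)
    also have "\<dots> = eval E C D \<cdot> (?u \<cdot> (one ?P \<odot> assoc E ?Q ?R A)) \<cdot> assoc E ?P (?Q \<otimes> ?R) A \<cdot> (assoc E ?P ?Q ?R \<odot> one A)"
      by (simp add: pentagon cmp_assoc)
    also have "\<dots> = (eval E A D \<cdot> ((ecmp (self E) A C D \<cdot> (one ?P \<odot> ecmp (self E) A B C)) \<odot> one A)) \<cdot> (assoc E ?P ?Q ?R \<odot> one A)"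
      by (simp add: self_ecmp self_ecmp1 cmp_assoc interchange)
    also have "\<dots> = eval E A D \<cdot> (?r \<odot> one A)"
      by (simp add: cmp_assoc interchange)
    finally show "eval E A D \<cdot> (?l \<odot> one A) = eval E A D \<cdot> (?r \<odot> one A)" .
  qed simp_all
  then show "ecmp (self E) A B D \<cdot> (ecmp (self E) B C D \<odot> one (ehom (self E) A B)) =
        ecmp (self E) A C D \<cdot> (one (ehom (self E) C D) \<odot> ecmp (self E) A B C) \<cdot>
          assoc E (ehom (self E) C D) (ehom (self E) B C) (ehom (self E) A B)" by simp
qed simp_all

section \<open>The underlying category of the self-enrichment, identified with E\<close>

abbreviation "S \<equiv> und E (self E)"

lemma unname_eq:
  "k \<in> arr S \<Longrightarrow> unname E k =
    eval E (src S k) (tgt S k) \<cdot> (el (self E) k \<odot> one (src S k)) \<cdot> linv (src S k)"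
  by (auto simp: unname_def elim!: und_arrE)

lemma self_arr [simp]:
  assumes "k \<in> arr S"
  shows "src S k \<in> ob E" "tgt S k \<in> ob E"
  using und_arr(1,2) [OF assms] by simp_all

lemma self_el [simp]:
  assumes "k \<in> arr S"
  shows "tgt E (el (self E) k) = ihom E (src S k) (tgt S k)"
  using und_arr(5) [OF assms] by simp

lemma unname_typing [simp]:
  assumes "k \<in> arr S"
  shows "unname E k \<in> arr E" "src E (unname E k) = src S k" "tgt E (unname E k) = tgt S k"
  using assms by (simp_all add: unname_eq)

lemma unname_inj:
  assumes "k \<in> arr S" "l \<in> arr S" "src S k = src S l" "tgt S k = tgt S l" "unname E k = unname E l"
  shows "k = l"
proof (rule und_eqI [of "self E"])
  show "el (self E) k = el (self E) l"
  proof (rule eval_eqI [of "src S l" "tgt S l"])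
    have "(eval E (src S l) (tgt S l) \<cdot> (el (self E) k \<odot> one (src S l))) \<cdot> linv (src S l) =
      (eval E (src S l) (tgt S l) \<cdot> (el (self E) l \<odot> one (src S l))) \<cdot> linv (src S l)"
      using assms by (simp add: unname_eq cmp_assoc)
    then have "((eval E (src S l) (tgt S l) \<cdot> (el (self E) k \<odot> one (src S l))) \<cdot> linv (src S l)) \<cdot> lunit E (src S l) =
      ((eval E (src S l) (tgt S l) \<cdot> (el (self E) l \<odot> one (src S l))) \<cdot> linv (src S l)) \<cdot> lunit E (src S l)"
      by simp
    then show "eval E (src S l) (tgt S l) \<cdot> (el (self E) k \<odot> one (src S l)) =
      eval E (src S l) (tgt S l) \<cdot> (el (self E) l \<odot> one (src S l))"
      using assms by (simp add: cmp_assoc)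
  qed (use assms in simp_all)
qed (use assms in simp_all)

lemma name_typing [simp]:
  assumes "f \<in> arr E"
  shows "name E f \<in> arr S" "src S (name E f) = src E f" "tgt S (name E f) = tgt E f"
  using assms by (simp_all add: name_def)

lemma unname_name [simp]:
  assumes [simp]: "f \<in> arr E"
  shows "unname E (name E f) = f"
proof -
  have "unname E (name E f) = (eval E (src E f) (tgt E f) \<cdot>
      (transpose E \<I> (src E f) (tgt E f) (f \<cdot> lunit E (src E f)) \<odot> one (src E f))) \<cdot> linv (src E f)"
    by (simp add: unname_def name_def cmp_assoc del: transpose(4))
  also have "\<dots> = (f \<cdot> lunit E (src E f)) \<cdot> linv (src E f)"
    by simp
  also have "\<dots> = f"
    by (simp add: cmp_assoc)
  finally show ?thesis .
qed

text \<open>Together with \<open>unname_ident\<close>, \<open>unname_name\<close> and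
  \<open>unname_inj\<close> this makes \<open>unname\<close> an isomorphism from \<open>S\<close> to
  E, so the adjunction equations, which are stated in \<open>S\<close>, can be read in E.\<close>

lemma unname_cmp:
  assumes [simp]: "k \<in> arr S" "l \<in> arr S" "tgt S l = src S k"
  shows "unname E (k \<cdot>\<^bsub>S\<^esub> l) = unname E k \<cdot> unname E l"
proof -
  let ?X = "src S l" and ?Y = "src S k" and ?Z = "tgt S k" and ?n = "el (self E) k" and ?m = "el (self E) l"
  have "unname E (k \<cdot>\<^bsub>S\<^esub> l) = (eval E ?X ?Z \<cdot> ((ecmp (self E) ?X ?Y ?Z \<cdot> (?n \<odot> ?m)) \<odot> one ?X)) \<cdot> (linv \<I> \<odot> one ?X) \<cdot> linv ?X"
    by (simp add: unname_eq und_cmp_eq [of _ k "src S k" l] interchange interchange' cmp_assoc)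
  also have "\<dots> = eval E ?Y ?Z \<cdot> (?n \<odot> (eval E ?X ?Y \<cdot> (?m \<odot> one ?X))) \<cdot> (assoc E \<I> \<I> ?X \<cdot> (linv \<I> \<odot> one ?X)) \<cdot> linv ?X"
    by (simp add: self_ecmp cmp_assoc)
  also have "\<dots> = eval E ?Y ?Z \<cdot> (?n \<odot> one ?Y) \<cdot> (((one \<I> \<odot> (eval E ?X ?Y \<cdot> (?m \<odot> one ?X))) \<cdot> linv (\<I> \<otimes> ?X)) \<cdot> linv ?X)"
    by (simp add: linv_tens interchange' cmp_assoc)
  also have "\<dots> = unname E k \<cdot> unname E l"
    by (simp add: unname_eq linv_natural cmp_assoc)
  finally show ?thesis .
qed

lemma unname_ident:
  assumes [simp]: "X \<in> ob E"
  shows "unname E (X, X, eid (self E) X) = one X"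
proof -
  have "unname E (X, X, eid (self E) X) = (eval E X X \<cdot> (eid (self E) X \<odot> one X)) \<cdot> linv X"
    by (simp add: unname_def cmp_assoc del: transpose(4))
  then show ?thesis by simp
qed

text \<open>Identifies the two descriptions of \<A>(A,k), as a value of the representable E-functor
  and as \<open>post\<close>. With it the triangle identities become equations about
  \<open>post\<close> and \<open>coev\<close>.\<close>

lemma unname_representable:
  assumes [simp]: "is_ecategory E \<A>" "A \<in> eob \<A>" "k \<in> arr (und E \<A>)"
  shows "unname E (uf (representable E \<A> A) k) = post \<A> A k"
proof -
  obtain B C g where k: "k = (B, C, g)" and [simp]: "B \<in> eob \<A>" "C \<in> eob \<A>" "g \<in> arr E" "src E g = \<I>" "tgt E g = ehom \<A> B C"
    by (rule und_arrE [OF assms(3)])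
  have "unname E (uf (representable E \<A> A) k) = (eval E (ehom \<A> A B) (ehom \<A> A C) \<cdot>
     ((transpose E (ehom \<A> B C) (ehom \<A> A B) (ehom \<A> A C) (ecmp \<A> A B C) \<cdot> g) \<odot> one (ehom \<A> A B))) \<cdot> linv (ehom \<A> A B)"
    by (simp add: k uf_eq representable_def unname_def cmp_assoc)
  also have "\<dots> = post \<A> A k"
    by (simp add: transpose_apply k ehom_post_def cmp_assoc)
  finally show ?thesis .
qed

section \<open>Tensored categories\<close>

lemma tensored_simps [simp]:
  assumes "is_tensored E \<A>"
  shows "is_ecategory E \<A>"
    and "A \<in> eob \<A> \<Longrightarrow> is_eadjunction E (self E) \<A> (tensoring \<A> A) (representable E \<A> A) (adj_unit \<A> A) (adj_counit \<A> A)"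
  using assms by (simp_all add: is_tensored_def)

lemma eadjunctionD:
  assumes "is_eadjunction E \<C> \<D> F G \<eta> \<epsilon>"
  shows "is_efunctor E \<C> \<D> F" "is_efunctor E \<D> \<C> G"
     "is_enatural E \<C> \<C> (id_efunctor E \<C>) (comp_efunctor E \<C> G F) \<eta>"
     "is_enatural E \<D> \<D> (comp_efunctor E \<D> F G) (id_efunctor E \<D>) \<epsilon>"
     "X \<in> eob \<C> \<Longrightarrow> \<epsilon> (eob_map F X) \<cdot>\<^bsub>und E \<D>\<^esub> uf F (\<eta> X) = ident (und E \<D>) (eob_map F X)"
     "B \<in> eob \<D> \<Longrightarrow> uf G (\<epsilon> B) \<cdot>\<^bsub>und E \<C>\<^esub> \<eta> (eob_map G B) = ident (und E \<C>) (eob_map G B)"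
  using assms by (auto simp: is_eadjunction_def)

context
  fixes \<A> :: "('x, 'o, 'a) tensored_ecategory"
  assumes tensored [simp]: "is_tensored E \<A>"
begin

lemma tensoring:
  assumes "A \<in> eob \<A>"
  shows "is_efunctor E (self E) \<A> (tensoring \<A> A)"
  by (rule eadjunctionD [OF tensored_simps(2)]) (use assms in simp_all)

lemma representable:
  assumes "A \<in> eob \<A>"
  shows "is_efunctor E \<A> (self E) (representable E \<A> A)"
  by (rule eadjunctionD [OF tensored_simps(2)]) (use assms in simp_all)

lemma representable_eob [simp]: "B \<in> eob \<A> \<Longrightarrow> eob_map (representable E \<A> A) B = ehom \<A> A B"
  by (simp add: representable_def)

lemma act_ob [simp]: "X \<in> ob E \<Longrightarrow> A \<in> eob \<A> \<Longrightarrow> act_ob \<A> X A \<in> eob \<A>"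
  using efunctor_simps(1) [OF tensoring, of A X] by (simp add: act_ob_def)

lemma act_left [simp]:
  assumes "f \<in> arr E" "A \<in> eob \<A>"
  shows "act_left E \<A> f A \<in> arr (und E \<A>)" "src (und E \<A>) (act_left E \<A> f A) = act_ob \<A> (src E f) A"
    "tgt (und E \<A>) (act_left E \<A> f A) = act_ob \<A> (tgt E f) A"
  using assms uf_typing [OF tensoring, of A "name E f"] by (simp_all add: act_left_def act_ob_def)

lemma adj_unit [simp]:
  assumes "A \<in> eob \<A>" "X \<in> ob E"
  shows "adj_unit \<A> A X \<in> arr S" "src S (adj_unit \<A> A X) = X" "tgt S (adj_unit \<A> A X) = ehom \<A> A (act_ob \<A> X A)"
  using enatural_simps [OF eadjunctionD(3) [OF tensored_simps(2) [OF tensored assms(1)]], of X] assms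
    act_ob [OF assms(2,1)] by (simp_all add: act_ob_def)

lemma adj_counit [simp]:
  assumes "A \<in> eob \<A>" "B \<in> eob \<A>"
  shows "adj_counit \<A> A B \<in> arr (und E \<A>)"
    "src (und E \<A>) (adj_counit \<A> A B) = act_ob \<A> (ehom \<A> A B) A"
    "tgt (und E \<A>) (adj_counit \<A> A B) = B"
  using enatural_simps [OF eadjunctionD(4) [OF tensored_simps(2) [OF tensored assms(1)]], of B] assms
  by (simp_all add: act_ob_def)

lemma coev [simp]:
  assumes "A \<in> eob \<A>" "X \<in> ob E"
  shows "coev E \<A> X A \<in> arr E" "src E (coev E \<A> X A) = X" "tgt E (coev E \<A> X A) = ehom \<A> A (act_ob \<A> X A)"
  using assms by (simp_all add: coev_def)

lemma adjunct [simp]: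
  assumes "A \<in> eob \<A>" "B \<in> eob \<A>" "h \<in> arr E" "tgt E h = ehom \<A> A B"
  shows "adjunct E \<A> A B h \<in> arr (und E \<A>)"
    "src (und E \<A>) (adjunct E \<A> A B h) = act_ob \<A> (src E h) A"
    "tgt (und E \<A>) (adjunct E \<A> A B h) = B"
  using assms by (simp_all add: adjunct_def)

section \<open>The universal property of the unit arrows\<close>

lemma post_act_left:
  assumes [simp]: "A \<in> eob \<A>" "f \<in> arr E"
  shows "post \<A> A (act_left E \<A> f A) \<cdot> coev E \<A> (src E f) A = coev E \<A> (tgt E f) A \<cdot> f"
proof -
  let ?F = "tensoring \<A> A" and ?G = "representable E \<A> A" and ?\<eta> = "adj_unit \<A> A"
  have F: "is_efunctor E (self E) \<A> ?F" and G: "is_efunctor E \<A> (self E) ?G"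
    by (simp_all add: tensoring representable)
  note [simp] = efunctor_typing [OF F] efunctor_typing [OF G]
  have \<eta>: "is_enatural E (self E) (self E) (id_efunctor E (self E)) (comp_efunctor E (self E) ?G ?F) ?\<eta>"
    by (rule eadjunctionD [OF tensored_simps(2)]) simp_all
  \<comment> \<open>Naturality of the adjunction unit, an equation in \<open>S\<close>; applying
    \<open>unname\<close> to both sides gives the claim in E.\<close>
  have "?\<eta> (tgt S (name E f)) \<cdot>\<^bsub>S\<^esub> uf (id_efunctor E (self E)) (name E f)
      = uf (comp_efunctor E (self E) ?G ?F) (name E f) \<cdot>\<^bsub>S\<^esub> ?\<eta> (src S (name E f))"
    by (rule enatural_natural [OF id_efunctor comp_efunctor [OF F G] _ _ \<eta>]) simp_all
  then have "?\<eta> (tgt E f) \<cdot>\<^bsub>S\<^esub> name E f = uf ?G (act_left E \<A> f A) \<cdot>\<^bsub>S\<^esub> ?\<eta> (src E f)"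
    by (simp add: uf_id uf_comp [OF F G] act_left_def)
  then have "unname E (?\<eta> (tgt E f) \<cdot>\<^bsub>S\<^esub> name E f) = unname E (uf ?G (act_left E \<A> f A) \<cdot>\<^bsub>S\<^esub> ?\<eta> (src E f))"
    by simp
  then show ?thesis
    by (simp add: unname_cmp unname_representable coev_def)
qed

text \<open>Existence in the universal property. The adjunct is the counit after h \<otimes> A;
  naturality of the unit slides h out to the right, and the triangle identity for \<A>(A,-) removes
  the rest.\<close>

lemma post_adjunct:
  assumes [simp]: "A \<in> eob \<A>" "B \<in> eob \<A>" "h \<in> arr E" "tgt E h = ehom \<A> A B" "src E h = X"
  shows "post \<A> A (adjunct E \<A> A B h) \<cdot> coev E \<A> X A = h"
proof -
  let ?G = "representable E \<A> A" and ?\<epsilon> = "adj_counit \<A> A"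
  have X [simp]: "X \<in> ob E"
    using category_arr(1) [of E h] by simp
  have G: "is_efunctor E \<A> (self E) ?G"
    by (simp_all add: representable)
  note [simp] = efunctor_typing [OF G]
  have "uf ?G (?\<epsilon> B) \<cdot>\<^bsub>S\<^esub> adj_unit \<A> A (eob_map ?G B) = ident S (eob_map ?G B)"
    by (rule eadjunctionD(6) [OF tensored_simps(2)]) simp_all
  then have "unname E (uf ?G (?\<epsilon> B) \<cdot>\<^bsub>S\<^esub> adj_unit \<A> A (ehom \<A> A B)) = unname E (ident S (ehom \<A> A B))"
    by simp
  then have triangle: "post \<A> A (?\<epsilon> B) \<cdot> coev E \<A> (ehom \<A> A B) A = one (ehom \<A> A B)"
    by (simp add: unname_cmp unname_representable coev_def unname_ident del: self_eqs(3))
  have "post \<A> A (adjunct E \<A> A B h) \<cdot> coev E \<A> X A = post \<A> A (?\<epsilon> B) \<cdot> (post \<A> A (act_left E \<A> h A) \<cdot> coev E \<A> (src E h) A)"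
    by (simp add: adjunct_def post_cmp cmp_assoc)
  also have "\<dots> = (post \<A> A (?\<epsilon> B) \<cdot> coev E \<A> (ehom \<A> A B) A) \<cdot> h"
    using post_act_left [of A h] by (simp add: cmp_assoc)
  also have "\<dots> = h"
    by (simp add: triangle)
  finally show ?thesis .
qed

text \<open>Uniqueness in the universal property. Naturality of the counit pulls k out to the left,
  and the triangle identity for - \<otimes> A removes the rest.\<close>

lemma adjunct_post:
  assumes [simp]: "A \<in> eob \<A>" "X \<in> ob E" "k \<in> arr (und E \<A>)" "src (und E \<A>) k = act_ob \<A> X A" "tgt (und E \<A>) k = B"
  shows "adjunct E \<A> A B (post \<A> A k \<cdot> coev E \<A> X A) = k"
proof -
  let ?F = "tensoring \<A> A" and ?G = "representable E \<A> A" and ?\<epsilon> = "adj_counit \<A> A" and ?\<eta> = "adj_unit \<A> A"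
  have F: "is_efunctor E (self E) \<A> ?F" and G: "is_efunctor E \<A> (self E) ?G"
    by (simp_all add: tensoring representable)
  note [simp] = efunctor_typing [OF F] efunctor_typing [OF G] act_ob_def [symmetric]
  have [simp]: "B \<in> eob \<A>"
    using und_arr(2) [of k \<A>] by simp
  have "post \<A> A k \<cdot> coev E \<A> X A = unname E (uf ?G k \<cdot>\<^bsub>S\<^esub> ?\<eta> X)"
    by (simp add: unname_cmp unname_representable coev_def)
  \<comment> \<open>\<open>name\<close> undoes \<open>unname\<close> because both sides have the
    same image under the injective \<open>unname\<close>.\<close>
  moreover have "name E (unname E (uf ?G k \<cdot>\<^bsub>S\<^esub> ?\<eta> X)) = uf ?G k \<cdot>\<^bsub>S\<^esub> ?\<eta> X"
    by (rule unname_inj) simp_all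
  ultimately have "adjunct E \<A> A B (post \<A> A k \<cdot> coev E \<A> X A) = ?\<epsilon> B \<cdot>\<^bsub>und E \<A>\<^esub> uf ?F (uf ?G k \<cdot>\<^bsub>S\<^esub> ?\<eta> X)"
    by (simp add: adjunct_def act_left_def)
  also have "\<dots> = (?\<epsilon> B \<cdot>\<^bsub>und E \<A>\<^esub> uf ?F (uf ?G k)) \<cdot>\<^bsub>und E \<A>\<^esub> uf ?F (?\<eta> X)"
    by (simp add: uf_cmp [OF F] cmp_assoc)
  also have "?\<epsilon> B \<cdot>\<^bsub>und E \<A>\<^esub> uf ?F (uf ?G k) = k \<cdot>\<^bsub>und E \<A>\<^esub> ?\<epsilon> (act_ob \<A> X A)"
  proof -
    have \<epsilon>: "is_enatural E \<A> \<A> (comp_efunctor E \<A> ?F ?G) (id_efunctor E \<A>) ?\<epsilon>"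
      by (rule eadjunctionD [OF tensored_simps(2)]) simp_all
    have "?\<epsilon> (tgt (und E \<A>) k) \<cdot>\<^bsub>und E \<A>\<^esub> uf (comp_efunctor E \<A> ?F ?G) k
      = uf (id_efunctor E \<A>) k \<cdot>\<^bsub>und E \<A>\<^esub> ?\<epsilon> (src (und E \<A>) k)"
      by (rule enatural_natural [OF comp_efunctor [OF G F] id_efunctor _ _ \<epsilon>]) simp_all
    then show ?thesis
      by (simp add: uf_id uf_comp [OF G F])
  qed
  also have "(k \<cdot>\<^bsub>und E \<A>\<^esub> ?\<epsilon> (act_ob \<A> X A)) \<cdot>\<^bsub>und E \<A>\<^esub> uf ?F (?\<eta> X)
     = k \<cdot>\<^bsub>und E \<A>\<^esub> (?\<epsilon> (eob_map ?F X) \<cdot>\<^bsub>und E \<A>\<^esub> uf ?F (?\<eta> X))"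
    by (simp add: cmp_assoc)
  also have "?\<epsilon> (eob_map ?F X) \<cdot>\<^bsub>und E \<A>\<^esub> uf ?F (?\<eta> X) = ident (und E \<A>) (eob_map ?F X)"
    by (rule eadjunctionD(5) [OF tensored_simps(2)]) simp_all
  finally show ?thesis
    by (simp del: und_simps)
qed

lemma act_eqI:
  assumes "A \<in> eob \<A>" "X \<in> ob E" "k \<in> arr (und E \<A>)" "l \<in> arr (und E \<A>)"
    "src (und E \<A>) k = act_ob \<A> X A" "src (und E \<A>) l = act_ob \<A> X A" "tgt (und E \<A>) k = tgt (und E \<A>) l"
    "post \<A> A k \<cdot> coev E \<A> X A = post \<A> A l \<cdot> coev E \<A> X A"
  shows "k = l"
  using adjunct_post [OF assms(1-3,5) refl] adjunct_post [OF assms(1,2,4,6) refl] unfolding assms(7,8) by (rule trans [OF sym])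

section \<open>The action on arrows, its unit and its associator, seen through
  \<open>coev\<close>\<close>

lemma act_right_eq:
  assumes "f \<in> arr (und E \<A>)"
  shows "act_right E \<A> X f = adjunct E \<A> (src (und E \<A>) f) (act_ob \<A> X (tgt (und E \<A>) f))
     (pre \<A> f (act_ob \<A> X (tgt (und E \<A>) f)) \<cdot> coev E \<A> X (tgt (und E \<A>) f))"
  using assms by (auto simp: act_right_def elim!: und_arrE)

lemma act_right [simp]:
  assumes "f \<in> arr (und E \<A>)" "X \<in> ob E"
  shows "act_right E \<A> X f \<in> arr (und E \<A>)"
    "src (und E \<A>) (act_right E \<A> X f) = act_ob \<A> X (src (und E \<A>) f)"
    "tgt (und E \<A>) (act_right E \<A> X f) = act_ob \<A> X (tgt (und E \<A>) f)"
  using assms by (simp_all add: act_right_eq)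

text \<open>Extranaturality of \<open>coev\<close> in A. By uniqueness it characterises X \<otimes>
  f, and it turns every occurrence of \<open>act_right\<close> into a \<open>pre\<close>.\<close>

lemma post_act_right:
  assumes "f \<in> arr (und E \<A>)" "X \<in> ob E" "src (und E \<A>) f = A" "tgt (und E \<A>) f = B"
  shows "post \<A> A (act_right E \<A> X f) \<cdot> coev E \<A> X A = pre \<A> f (act_ob \<A> X B) \<cdot> coev E \<A> X B"
  using assms by (auto simp: act_right_eq post_adjunct)

lemma act_unit [simp]:
  assumes "A \<in> eob \<A>"
  shows "act_unit E \<A> A \<in> arr (und E \<A>)" "src (und E \<A>) (act_unit E \<A> A) = act_ob \<A> \<I> A"
    "tgt (und E \<A>) (act_unit E \<A> A) = A"
    "post \<A> A (act_unit E \<A> A) \<cdot> coev E \<A> \<I> A = eid \<A> A"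
  using assms by (simp_all add: act_unit_def post_adjunct)

lemma act_assoc [simp]:
  assumes "A \<in> eob \<A>" "X \<in> ob E" "Y \<in> ob E"
  shows "act_assoc E \<A> X Y A \<in> arr (und E \<A>)"
    "src (und E \<A>) (act_assoc E \<A> X Y A) = act_ob \<A> (X \<otimes> Y) A"
    "tgt (und E \<A>) (act_assoc E \<A> X Y A) = act_ob \<A> X (act_ob \<A> Y A)"
    "post \<A> A (act_assoc E \<A> X Y A) \<cdot> coev E \<A> (X \<otimes> Y) A
      = ecmp \<A> A (act_ob \<A> Y A) (act_ob \<A> X (act_ob \<A> Y A)) \<cdot> (coev E \<A> X (act_ob \<A> Y A) \<odot> coev E \<A> Y A)"
  using assms by (simp_all add: act_assoc_def post_adjunct Let_def)

end

section \<open>Strong functors and enriched functors\<close>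

definition strong_of ::
  "('x, 'o, 'a) tensored_ecategory \<Rightarrow> ('x, 'o, 'a) tensored_ecategory \<Rightarrow> ('x, 'x, 'a) efunctor \<Rightarrow>
   ('x, 'o, 'a) strong_1cell" where
  "strong_of \<A> \<B> F =
     \<lparr> fob = eob_map F,
       farr = (\<lambda>k\<in>arr (und E \<A>). uf F k),
       strength = (\<lambda>(X, A)\<in>ob E \<times> eob \<A>.
         adjunct E \<B> (eob_map F A) (eob_map F (act_ob \<A> X A)) (ehom_map F (A, act_ob \<A> X A) \<cdot> coev E \<A> X A)) \<rparr>"

lemma fob_strong_of [simp]: "fob (strong_of \<A> \<B> F) = eob_map F"
  by (simp add: strong_of_def)

lemma farr_strong_of [simp]: "k \<in> arr (und E \<A>) \<Longrightarrow> farr (strong_of \<A> \<B> F) k = uf F k"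
  by (simp add: strong_of_def)

context
  fixes \<A> \<B> :: "('x, 'o, 'a) tensored_ecategory"
  assumes tensored [simp]: "is_tensored E \<A>" "is_tensored E \<B>"
begin

lemma strength_strong_of [simp]:
  assumes F: "is_efunctor E \<A> \<B> F" and [simp]: "X \<in> ob E" "A \<in> eob \<A>"
  shows "strength (strong_of \<A> \<B> F) (X, A) \<in> arr (und E \<B>)"
    "src (und E \<B>) (strength (strong_of \<A> \<B> F) (X, A)) = act_ob \<B> X (eob_map F A)"
    "tgt (und E \<B>) (strength (strong_of \<A> \<B> F) (X, A)) = eob_map F (act_ob \<A> X A)"
    "post \<B> (eob_map F A) (strength (strong_of \<A> \<B> F) (X, A)) \<cdot> coev E \<B> X (eob_map F A)
      = ehom_map F (A, act_ob \<A> X A) \<cdot> coev E \<A> X A"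
proof -
  note [simp] = efunctor_typing [OF F]
  show "strength (strong_of \<A> \<B> F) (X, A) \<in> arr (und E \<B>)"
    "src (und E \<B>) (strength (strong_of \<A> \<B> F) (X, A)) = act_ob \<B> X (eob_map F A)"
    "tgt (und E \<B>) (strength (strong_of \<A> \<B> F) (X, A)) = eob_map F (act_ob \<A> X A)"
    "post \<B> (eob_map F A) (strength (strong_of \<A> \<B> F) (X, A)) \<cdot> coev E \<B> X (eob_map F A)
      = ehom_map F (A, act_ob \<A> X A) \<cdot> coev E \<A> X A"
    by (simp_all add: strong_of_def post_adjunct)
qed

text \<open>The defining equation of the strength with a tail f. It is needed for naturality in X,
  where \<open>post_act_left\<close> leaves f to the right of \<open>coev\<close>.\<close>

lemma strength_strong_of':
  assumes F: "is_efunctor E \<A> \<B> F" and [simp]: "X \<in> ob E" "A \<in> eob \<A>" "f \<in> arr E" "tgt E f = X"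
  shows "post \<B> (eob_map F A) (strength (strong_of \<A> \<B> F) (X, A)) \<cdot> coev E \<B> X (eob_map F A) \<cdot> f
      = ehom_map F (A, act_ob \<A> X A) \<cdot> coev E \<A> X A \<cdot> f"
proof -
  note [simp] = F efunctor_typing [OF F]
  have "(post \<B> (eob_map F A) (strength (strong_of \<A> \<B> F) (X, A)) \<cdot> coev E \<B> X (eob_map F A)) \<cdot> f
      = (ehom_map F (A, act_ob \<A> X A) \<cdot> coev E \<A> X A) \<cdot> f"
    by simp
  then show ?thesis
    by (simp add: cmp_assoc del: strength_strong_of(4))
qed

text \<open>Seen through \<open>coev\<close>, the unit axiom is preservation of identities and the
  associativity axiom is preservation of composition at two unit arrows. Naturality in X rests on
  that of \<open>coev\<close>, naturality in A on \<phi> being natural in its first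
  argument.\<close>

lemma strong_functor_strong_of:
  assumes F: "is_efunctor E \<A> \<B> F"
  shows "is_strong_functor E \<A> \<B> (strong_of \<A> \<B> F)"
  unfolding is_strong_functor_def
proof (intro conjI ballI)
  note [simp] = F efunctor_typing [OF F]
  let ?T = "strong_of \<A> \<B> F" and ?\<phi> = "\<lambda>A B. ehom_map F (A, B)"
  let ?\<sigma> = "\<lambda>X A. strength ?T (X, A)"
  show "is_functor (und E \<A>) (und E \<B>) ?T"
    by (simp add: is_functor_def uf_cmp [OF F] uf_ident [OF F])
  show "fob ?T \<in> extensional (eob \<A>)"
    using efunctor_extensional [OF F] by simp
  show "farr ?T \<in> extensional (arr (und E \<A>))" "strength ?T \<in> extensional (ob E \<times> eob \<A>)"
    by (simp_all add: strong_of_def)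
  fix A assume [simp]: "A \<in> eob \<A>"
  show "farr ?T (act_unit E \<A> A) \<cdot>\<^bsub>und E \<B>\<^esub> ?\<sigma> \<I> A = act_unit E \<B> (fob ?T A)"
    by (rule act_eqI [of \<B> "eob_map F A" \<I>])
      (simp_all add: post_cmp cmp_assoc post_uf [OF F])
  fix X assume [simp]: "X \<in> ob E"
  show "?\<sigma> X A \<in> hom (und E \<B>) (act_ob \<B> X (fob ?T A)) (fob ?T (act_ob \<A> X A))"
    by simp
  fix Y assume [simp]: "Y \<in> ob E"
  let ?YA = "act_ob \<A> Y A" and ?XYA = "act_ob \<A> X (act_ob \<A> Y A)"
  show "farr ?T (act_assoc E \<A> X Y A) \<cdot>\<^bsub>und E \<B>\<^esub> ?\<sigma> (X \<otimes> Y) A =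
        ?\<sigma> X ?YA \<cdot>\<^bsub>und E \<B>\<^esub> act_right E \<B> X (?\<sigma> Y A) \<cdot>\<^bsub>und E \<B>\<^esub> act_assoc E \<B> X Y (fob ?T A)"
  proof (rule act_eqI [of \<B> "eob_map F A" "X \<otimes> Y"])
    have "post \<B> (eob_map F A) (farr ?T (act_assoc E \<A> X Y A) \<cdot>\<^bsub>und E \<B>\<^esub> ?\<sigma> (X \<otimes> Y) A) \<cdot> coev E \<B> (X \<otimes> Y) (eob_map F A)
      = ?\<phi> A ?XYA \<cdot> ecmp \<A> A ?YA ?XYA \<cdot> (coev E \<A> X ?YA \<odot> coev E \<A> Y A)"
      by (simp add: post_cmp cmp_assoc post_uf [OF F])
    also have "\<dots> = ecmp \<B> (eob_map F A) (eob_map F ?YA) (eob_map F ?XYA) \<cdot>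
       ((?\<phi> ?YA ?XYA \<cdot> coev E \<A> X ?YA) \<odot> (?\<phi> A ?YA \<cdot> coev E \<A> Y A))"
      by (simp add: efunctor_ecmp [OF F])
    also have "\<dots> = ecmp \<B> (eob_map F A) (eob_map F ?YA) (eob_map F ?XYA) \<cdot>
       ((?\<phi> ?YA ?XYA \<cdot> coev E \<A> X ?YA) \<odot> (post \<B> (eob_map F A) (?\<sigma> Y A) \<cdot> coev E \<B> Y (eob_map F A)))"
      by simp
    \<comment> \<open>The inner strength \<sigma> Y A crosses over to the outer factor. There it
      acts as \<open>pre\<close> on \<open>coev\<close>, which the next step recognises as the
      action of X on this strength.\<close>
    also have "\<dots> = ecmp \<B> (eob_map F A) (act_ob \<B> Y (eob_map F A)) (eob_map F ?XYA) \<cdot>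
       ((pre \<B> (?\<sigma> Y A) (eob_map F ?XYA) \<cdot> post \<B> (eob_map F ?YA) (?\<sigma> X ?YA) \<cdot> coev E \<B> X (eob_map F ?YA)) \<odot>
         coev E \<B> Y (eob_map F A))"
      by (subst ecmp_pre_post) simp_all
    also have "\<dots> = ecmp \<B> (eob_map F A) (act_ob \<B> Y (eob_map F A)) (eob_map F ?XYA) \<cdot>
       ((post \<B> (act_ob \<B> Y (eob_map F A)) (?\<sigma> X ?YA) \<cdot>
         post \<B> (act_ob \<B> Y (eob_map F A)) (act_right E \<B> X (?\<sigma> Y A)) \<cdot> coev E \<B> X (act_ob \<B> Y (eob_map F A))) \<odot>
         coev E \<B> Y (eob_map F A))"
      by (simp add: post_act_right post_pre' del: strength_strong_of(4))
    also have "\<dots> = post \<B> (eob_map F A) (?\<sigma> X ?YA \<cdot>\<^bsub>und E \<B>\<^esub> act_right E \<B> X (?\<sigma> Y A) \<cdot>\<^bsub>und E \<B>\<^esub> act_assoc E \<B> X Y (fob ?T A)) \<cdot>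
         coev E \<B> (X \<otimes> Y) (eob_map F A)"
      by (simp add: post_cmp cmp_assoc post_ecmp)
    finally show "post \<B> (eob_map F A) (farr ?T (act_assoc E \<A> X Y A) \<cdot>\<^bsub>und E \<B>\<^esub> ?\<sigma> (X \<otimes> Y) A) \<cdot> coev E \<B> (X \<otimes> Y) (eob_map F A)
      = post \<B> (eob_map F A) (?\<sigma> X ?YA \<cdot>\<^bsub>und E \<B>\<^esub> act_right E \<B> X (?\<sigma> Y A) \<cdot>\<^bsub>und E \<B>\<^esub> act_assoc E \<B> X Y (fob ?T A)) \<cdot>
         coev E \<B> (X \<otimes> Y) (eob_map F A)" .
  qed simp_all
next
  note [simp] = F efunctor_typing [OF F]
  let ?T = "strong_of \<A> \<B> F"
  let ?\<sigma> = "\<lambda>X A. strength ?T (X, A)"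
  fix f A assume [simp]: "f \<in> arr E" "A \<in> eob \<A>"
  show "?\<sigma> (tgt E f) A \<cdot>\<^bsub>und E \<B>\<^esub> act_left E \<B> f (fob ?T A) = farr ?T (act_left E \<A> f A) \<cdot>\<^bsub>und E \<B>\<^esub> ?\<sigma> (src E f) A"
    by (rule act_eqI [of \<B> "eob_map F A" "src E f"])
      (simp_all add: post_cmp cmp_assoc post_uf [OF F] post_act_left strength_strong_of')
next
  note [simp] = F efunctor_typing [OF F]
  let ?T = "strong_of \<A> \<B> F"
  let ?\<sigma> = "\<lambda>X A. strength ?T (X, A)"
  fix X f assume [simp]: "X \<in> ob E" "f \<in> arr (und E \<A>)"
  let ?A = "src (und E \<A>) f" and ?B = "tgt (und E \<A>) f"
  show "?\<sigma> X ?B \<cdot>\<^bsub>und E \<B>\<^esub> act_right E \<B> X (farr ?T f) = farr ?T (act_right E \<A> X f) \<cdot>\<^bsub>und E \<B>\<^esub> ?\<sigma> X ?A"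
    by (rule act_eqI [of \<B> "eob_map F ?A" X])
      (simp_all add: post_cmp cmp_assoc post_uf [OF F] post_act_right post_pre' efunctor_pre' [OF F])
qed

end

section \<open>From strong functors to E-functors\<close>

definition efunctor_of ::
  "('x, 'o, 'a) tensored_ecategory \<Rightarrow> ('x, 'o, 'a) tensored_ecategory \<Rightarrow> ('x, 'o, 'a) strong_1cell \<Rightarrow>
   ('x, 'x, 'a) efunctor" where
  "efunctor_of \<A> \<B> T =
     \<lparr> eob_map = fob T,
       ehom_map = (\<lambda>(A, B)\<in>eob \<A> \<times> eob \<A>.
         post \<B> (fob T A) (farr T (adjunct E \<A> A B (one (ehom \<A> A B))) \<cdot>\<^bsub>und E \<B>\<^esub> strength T (ehom \<A> A B, A)) \<cdot>
           coev E \<B> (ehom \<A> A B) (fob T A)) \<rparr>"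

lemma eob_map_efunctor_of [simp]: "eob_map (efunctor_of \<A> \<B> T) = fob T"
  by (simp add: efunctor_of_def)

lemma strong_functor_simps:
  assumes T: "is_strong_functor E \<A> \<B> T"
  shows "A \<in> eob \<A> \<Longrightarrow> fob T A \<in> eob \<B>"
    "f \<in> arr (und E \<A>) \<Longrightarrow> farr T f \<in> arr (und E \<B>)"
    "f \<in> arr (und E \<A>) \<Longrightarrow> src (und E \<B>) (farr T f) = fob T (src (und E \<A>) f)"
    "f \<in> arr (und E \<A>) \<Longrightarrow> tgt (und E \<B>) (farr T f) = fob T (tgt (und E \<A>) f)"
    "X \<in> ob E \<Longrightarrow> A \<in> eob \<A> \<Longrightarrow> strength T (X, A) \<in> arr (und E \<B>)"
    "X \<in> ob E \<Longrightarrow> A \<in> eob \<A> \<Longrightarrow> src (und E \<B>) (strength T (X, A)) = act_ob \<B> X (fob T A)"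
    "X \<in> ob E \<Longrightarrow> A \<in> eob \<A> \<Longrightarrow> tgt (und E \<B>) (strength T (X, A)) = fob T (act_ob \<A> X A)"
  using T by (auto simp: is_strong_functor_def is_functor_def)

lemma strong_functor_laws:
  assumes T: "is_strong_functor E \<A> \<B> T"
  shows "A \<in> eob \<A> \<Longrightarrow> farr T (A, A, eid \<A> A) = (fob T A, fob T A, eid \<B> (fob T A))"
    and "f \<in> arr (und E \<A>) \<Longrightarrow> g \<in> arr (und E \<A>) \<Longrightarrow> tgt (und E \<A>) f = src (und E \<A>) g \<Longrightarrow>
      farr T (g \<cdot>\<^bsub>und E \<A>\<^esub> f) = farr T g \<cdot>\<^bsub>und E \<B>\<^esub> farr T f"
    and "h \<in> arr E \<Longrightarrow> A \<in> eob \<A> \<Longrightarrow>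
        strength T (tgt E h, A) \<cdot>\<^bsub>und E \<B>\<^esub> act_left E \<B> h (fob T A) =
        farr T (act_left E \<A> h A) \<cdot>\<^bsub>und E \<B>\<^esub> strength T (src E h, A)"
    and "X \<in> ob E \<Longrightarrow> k \<in> arr (und E \<A>) \<Longrightarrow>
        strength T (X, tgt (und E \<A>) k) \<cdot>\<^bsub>und E \<B>\<^esub> act_right E \<B> X (farr T k) =
        farr T (act_right E \<A> X k) \<cdot>\<^bsub>und E \<B>\<^esub> strength T (X, src (und E \<A>) k)"
    and "A \<in> eob \<A> \<Longrightarrow> farr T (act_unit E \<A> A) \<cdot>\<^bsub>und E \<B>\<^esub> strength T (\<I>, A) = act_unit E \<B> (fob T A)"
    and "X \<in> ob E \<Longrightarrow> Y \<in> ob E \<Longrightarrow> A \<in> eob \<A> \<Longrightarrow>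
        farr T (act_assoc E \<A> X Y A) \<cdot>\<^bsub>und E \<B>\<^esub> strength T (X \<otimes> Y, A) =
        strength T (X, act_ob \<A> Y A) \<cdot>\<^bsub>und E \<B>\<^esub> act_right E \<B> X (strength T (Y, A)) \<cdot>\<^bsub>und E \<B>\<^esub>
          act_assoc E \<B> X Y (fob T A)"
    and "fob T \<in> extensional (eob \<A>)" "farr T \<in> extensional (arr (und E \<A>))"
      "strength T \<in> extensional (ob E \<times> eob \<A>)"
  using T by (simp_all add: is_strong_functor_def is_functor_def)

context
  fixes \<A> \<B> :: "('x, 'o, 'a) tensored_ecategory"
  assumes tensored [simp]: "is_tensored E \<A>" "is_tensored E \<B>"
begin

text \<open>The adjunct of an identity is the counit, kept in this form so that
  \<open>post_adjunct\<close> applies to it. Both sides correspond to h: naturality of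
  \<open>coev\<close> slides h out and leaves an identity.\<close>

lemma adjunct_apply:
  assumes [simp]: "A \<in> eob \<A>" "B \<in> eob \<A>" "h \<in> arr E" "tgt E h = ehom \<A> A B"
  shows "adjunct E \<A> A B (one (ehom \<A> A B)) \<cdot>\<^bsub>und E \<A>\<^esub> act_left E \<A> h A = adjunct E \<A> A B h"
proof (rule act_eqI [of \<A> A "src E h"])
  let ?H = "ehom \<A> A B"
  have "post \<A> A (adjunct E \<A> A B (one ?H) \<cdot>\<^bsub>und E \<A>\<^esub> act_left E \<A> h A) \<cdot> coev E \<A> (src E h) A
     = (post \<A> A (adjunct E \<A> A B (one ?H)) \<cdot> coev E \<A> ?H A) \<cdot> h"
    by (simp add: post_cmp cmp_assoc post_act_left del: post_adjunct)
  then show "post \<A> A (adjunct E \<A> A B (one ?H) \<cdot>\<^bsub>und E \<A>\<^esub> act_left E \<A> h A) \<cdot> coev E \<A> (src E h) A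
     = post \<A> A (adjunct E \<A> A B h) \<cdot> coev E \<A> (src E h) A"
    by (simp add: post_adjunct)
qed simp_all

text \<open>Although \<phi> is defined only by the counit, naturality of the strength in X gives its
  value at every generalised element h, with the adjunct of h in place of the counit.\<close>

lemma ehom_map_efunctor_of:
  assumes T: "is_strong_functor E \<A> \<B> T"
    and [simp]: "A \<in> eob \<A>" "B \<in> eob \<A>" "h \<in> arr E" "tgt E h = ehom \<A> A B" "src E h = X"
  shows "ehom_map (efunctor_of \<A> \<B> T) (A, B) \<cdot> h =
    post \<B> (fob T A) (farr T (adjunct E \<A> A B h) \<cdot>\<^bsub>und E \<B>\<^esub> strength T (X, A)) \<cdot> coev E \<B> X (fob T A)"
proof -
  note [simp] = strong_functor_simps [OF T]
  have [simp]: "X \<in> ob E"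
    using category_arr(1) [of E h] by simp
  let ?H = "ehom \<A> A B" and ?\<epsilon> = "adjunct E \<A> A B (one (ehom \<A> A B))"
  have "ehom_map (efunctor_of \<A> \<B> T) (A, B) \<cdot> h = post \<B> (fob T A) (farr T ?\<epsilon> \<cdot>\<^bsub>und E \<B>\<^esub> strength T (?H, A)) \<cdot>
      coev E \<B> (tgt E h) (fob T A) \<cdot> h"
    by (simp add: efunctor_of_def cmp_assoc)
  also have "\<dots> = post \<B> (fob T A) (farr T ?\<epsilon> \<cdot>\<^bsub>und E \<B>\<^esub> strength T (?H, A)) \<cdot>
      post \<B> (fob T A) (act_left E \<B> h (fob T A)) \<cdot> coev E \<B> (src E h) (fob T A)"
    by (subst post_act_left) simp_all
  also have "\<dots> = post \<B> (fob T A) (farr T ?\<epsilon> \<cdot>\<^bsub>und E \<B>\<^esub> (strength T (tgt E h, A) \<cdot>\<^bsub>und E \<B>\<^esub> act_left E \<B> h (fob T A))) \<cdot>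
     coev E \<B> X (fob T A)"
    by (simp add: post_cmp cmp_assoc)
  also have "strength T (tgt E h, A) \<cdot>\<^bsub>und E \<B>\<^esub> act_left E \<B> h (fob T A) =
        farr T (act_left E \<A> h A) \<cdot>\<^bsub>und E \<B>\<^esub> strength T (src E h, A)"
    by (rule strong_functor_laws [OF T]) simp_all
  also have "farr T ?\<epsilon> \<cdot>\<^bsub>und E \<B>\<^esub> (farr T (act_left E \<A> h A) \<cdot>\<^bsub>und E \<B>\<^esub> strength T (src E h, A)) =
     farr T (?\<epsilon> \<cdot>\<^bsub>und E \<A>\<^esub> act_left E \<A> h A) \<cdot>\<^bsub>und E \<B>\<^esub> strength T (X, A)"
    by (simp add: strong_functor_laws(2) [OF T] cmp_assoc)
  finally show ?thesis
    by (simp add: adjunct_apply)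
qed

text \<open>The case X = \<I>. The adjunct of \<open>el \<A> f\<close> is f after
  \<open>act_unit\<close>, and the unit axiom turns the image of \<open>act_unit\<close> after the
  strength into the \<open>act_unit\<close> of \<B>. So \<phi> induces T on underlying
  arrows.\<close>

lemma ehom_map_efunctor_of_el:
  assumes T: "is_strong_functor E \<A> \<B> T" and [simp]: "f \<in> arr (und E \<A>)"
  shows "ehom_map (efunctor_of \<A> \<B> T) (src (und E \<A>) f, tgt (und E \<A>) f) \<cdot> el \<A> f = el \<B> (farr T f)"
proof -
  note [simp] = strong_functor_simps [OF T]
  let ?A = "src (und E \<A>) f" and ?B = "tgt (und E \<A>) f"
  have "adjunct E \<A> ?A ?B (el \<A> f) = f \<cdot>\<^bsub>und E \<A>\<^esub> act_unit E \<A> ?A"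
    by (rule act_eqI [of \<A> ?A \<I>]) (simp_all add: post_adjunct post_cmp cmp_assoc post_eid)
  then have "ehom_map (efunctor_of \<A> \<B> T) (?A, ?B) \<cdot> el \<A> f =
    post \<B> (fob T ?A) (farr T f \<cdot>\<^bsub>und E \<B>\<^esub> (farr T (act_unit E \<A> ?A) \<cdot>\<^bsub>und E \<B>\<^esub> strength T (\<I>, ?A))) \<cdot> coev E \<B> \<I> (fob T ?A)"
    by (simp add: ehom_map_efunctor_of [OF T] strong_functor_laws(2) [OF T] cmp_assoc)
  also have "\<dots> = el \<B> (farr T f)"
    by (simp add: strong_functor_laws(5) [OF T] post_cmp cmp_assoc post_eid)
  finally show ?thesis .
qed

text \<open>Identities are preserved by the previous lemma. For composition, T is applied to the
  description of \<open>ecmp\<close> as a double evaluation; associativity splits the strength at a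
  tensor product, and naturality in A passes it over the inner counit.\<close>

lemma efunctor_efunctor_of:
  assumes T: "is_strong_functor E \<A> \<B> T"
  shows "is_efunctor E \<A> \<B> (efunctor_of \<A> \<B> T)"
proof (rule is_efunctorI)
  note [simp] = strong_functor_simps [OF T]
  let ?F = "efunctor_of \<A> \<B> T" and ?T = "fob T" and ?\<sigma> = "\<lambda>X A. strength T (X, A)"
  show "eob_map ?F \<in> extensional (eob \<A>)" "ehom_map ?F \<in> extensional (eob \<A> \<times> eob \<A>)"
    using strong_functor_laws [OF T] by (simp_all add: efunctor_of_def)
  have typing: "ehom_map ?F (A, B) \<in> arr E" "src E (ehom_map ?F (A, B)) = ehom \<A> A B"
    "tgt E (ehom_map ?F (A, B)) = ehom \<B> (?T A) (?T B)" if "A \<in> eob \<A>" "B \<in> eob \<A>" for A B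
    using that by (simp_all add: efunctor_of_def)
  then show "ehom_map ?F (A, B) \<in> arr E" "src E (ehom_map ?F (A, B)) = ehom \<A> A B"
    "tgt E (ehom_map ?F (A, B)) = ehom \<B> (eob_map ?F A) (eob_map ?F B)" if "A \<in> eob \<A>" "B \<in> eob \<A>" for A B
    using that by simp_all
  note [simp] = typing
  fix A assume [simp]: "A \<in> eob \<A>"
  show "ehom_map ?F (A, A) \<cdot> eid \<A> A = eid \<B> (eob_map ?F A)"
    using ehom_map_efunctor_of_el [OF T, of "(A, A, eid \<A> A)"] by (simp add: strong_functor_laws(1) [OF T])
  fix B C assume [simp]: "B \<in> eob \<A>" "C \<in> eob \<A>"
  let ?X = "ehom \<A> B C" and ?Y = "ehom \<A> A B"
  let ?e = "adjunct E \<A> B C (one ?X)" and ?d = "adjunct E \<A> A B (one ?Y)"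
  \<comment> \<open>Composition in \<A> is adjunct to evaluating twice: reassociate, apply the inner
    counit \<open>?d\<close> under \<open>?X\<close>, then the outer counit
    \<open>?e\<close>.\<close>
  have "post \<A> A (?e \<cdot>\<^bsub>und E \<A>\<^esub> act_right E \<A> ?X ?d \<cdot>\<^bsub>und E \<A>\<^esub> act_assoc E \<A> ?X ?Y A) \<cdot> coev E \<A> (?X \<otimes> ?Y) A
    = ecmp \<A> A (act_ob \<A> ?Y A) C \<cdot> ((pre \<A> ?d C \<cdot> one ?X) \<odot> coev E \<A> ?Y A)"
    by (simp add: post_cmp cmp_assoc post_ecmp post_act_right post_pre' post_adjunct)
  also have "\<dots> = ecmp \<A> A B C"
    by (subst ecmp_pre_post) (simp_all add: post_adjunct)
  finally have hat: "adjunct E \<A> A C (ecmp \<A> A B C) = ?e \<cdot>\<^bsub>und E \<A>\<^esub> act_right E \<A> ?X ?d \<cdot>\<^bsub>und E \<A>\<^esub> act_assoc E \<A> ?X ?Y A"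
    by (intro act_eqI [of \<A> A "?X \<otimes> ?Y"]) (simp_all add: post_adjunct)
  have "ehom_map ?F (A, C) \<cdot> ecmp \<A> A B C = post \<B> (?T A) (farr T (?e \<cdot>\<^bsub>und E \<A>\<^esub> act_right E \<A> ?X ?d) \<cdot>\<^bsub>und E \<B>\<^esub>
      (farr T (act_assoc E \<A> ?X ?Y A) \<cdot>\<^bsub>und E \<B>\<^esub> ?\<sigma> (?X \<otimes> ?Y) A)) \<cdot> coev E \<B> (?X \<otimes> ?Y) (?T A)"
    by (simp add: ehom_map_efunctor_of [OF T] hat strong_functor_laws(2) [OF T] cmp_assoc)
  also have "\<dots> = post \<B> (?T A) (farr T ?e \<cdot>\<^bsub>und E \<B>\<^esub> (farr T (act_right E \<A> ?X ?d) \<cdot>\<^bsub>und E \<B>\<^esub>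
      ?\<sigma> ?X (act_ob \<A> ?Y A)) \<cdot>\<^bsub>und E \<B>\<^esub> act_right E \<B> ?X (?\<sigma> ?Y A) \<cdot>\<^bsub>und E \<B>\<^esub> act_assoc E \<B> ?X ?Y (?T A)) \<cdot>
      coev E \<B> (?X \<otimes> ?Y) (?T A)"
    by (simp add: strong_functor_laws(2,6) [OF T] cmp_assoc)
  \<comment> \<open>Naturality of the strength in A, at the inner counit.\<close>
  also have "farr T (act_right E \<A> ?X ?d) \<cdot>\<^bsub>und E \<B>\<^esub> ?\<sigma> ?X (act_ob \<A> ?Y A) = ?\<sigma> ?X B \<cdot>\<^bsub>und E \<B>\<^esub> act_right E \<B> ?X (farr T ?d)"
    using strong_functor_laws(4) [OF T, of ?X ?d] by simp
  also have "post \<B> (?T A) (farr T ?e \<cdot>\<^bsub>und E \<B>\<^esub> (?\<sigma> ?X B \<cdot>\<^bsub>und E \<B>\<^esub> act_right E \<B> ?X (farr T ?d)) \<cdot>\<^bsub>und E \<B>\<^esub>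
      act_right E \<B> ?X (?\<sigma> ?Y A) \<cdot>\<^bsub>und E \<B>\<^esub> act_assoc E \<B> ?X ?Y (?T A)) \<cdot> coev E \<B> (?X \<otimes> ?Y) (?T A)
     = ecmp \<B> (?T A) (act_ob \<B> ?Y (?T A)) (?T C) \<cdot>
       ((pre \<B> (?\<sigma> ?Y A) (?T C) \<cdot> pre \<B> (farr T ?d) (?T C) \<cdot> post \<B> (?T B) (farr T ?e) \<cdot> post \<B> (?T B) (?\<sigma> ?X B) \<cdot> coev E \<B> ?X (?T B))
       \<odot> coev E \<B> ?Y (?T A))"
    by (simp add: post_cmp cmp_assoc post_ecmp post_act_right post_pre')
  also have "\<dots> = ecmp \<B> (?T A) (act_ob \<B> ?Y (?T A)) (?T C) \<cdot>
       ((pre \<B> (?\<sigma> ?Y A) (?T C) \<cdot> pre \<B> (farr T ?d) (?T C) \<cdot> ehom_map ?F (B, C)) \<odot> coev E \<B> ?Y (?T A))"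
    by (simp add: efunctor_of_def post_cmp cmp_assoc)
  \<comment> \<open>Two uses of \<open>ecmp_pre_post\<close> bring the inner strength and the image
    of the inner counit back to the second factor, where with \<open>coev\<close> they make up
    \<phi> on \<A>(A,B).\<close>
  also have "\<dots> = ecmp \<B> (?T A) (?T B) (?T C) \<cdot>
       (ehom_map ?F (B, C) \<odot> (post \<B> (?T A) (farr T ?d) \<cdot> post \<B> (?T A) (?\<sigma> ?Y A) \<cdot> coev E \<B> ?Y (?T A)))"
    by (simp add: ecmp_pre_post)
  also have "\<dots> = ecmp \<B> (eob_map ?F A) (eob_map ?F B) (eob_map ?F C) \<cdot> (ehom_map ?F (B, C) \<odot> ehom_map ?F (A, B))"
    by (simp add: efunctor_of_def [of _ _ T] post_cmp cmp_assoc)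
  finally show "ehom_map ?F (A, C) \<cdot> ecmp \<A> A B C =
      ecmp \<B> (eob_map ?F A) (eob_map ?F B) (eob_map ?F C) \<cdot> (ehom_map ?F (B, C) \<odot> ehom_map ?F (A, B))" .
qed (use strong_functor_simps [OF T] in simp_all)

section \<open>The two passages are mutually inverse\<close>

lemma strong_of_efunctor_of:
  assumes T: "is_strong_functor E \<A> \<B> T"
  shows "strong_of \<A> \<B> (efunctor_of \<A> \<B> T) = T"
proof -
  note [simp] = strong_functor_simps [OF T]
  let ?F = "efunctor_of \<A> \<B> T"
  have F: "is_efunctor E \<A> \<B> ?F"
    by (rule efunctor_efunctor_of [OF T])
  note [simp] = F efunctor_typing [OF F]
  have "farr (strong_of \<A> \<B> ?F) f = farr T f" for f
  proof (cases "f \<in> arr (und E \<A>)")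
    case True
    then have "uf ?F f = farr T f"
      using efunctor_typing [OF F]
      by (intro und_eqI [of \<B>]) (simp_all add: el_uf [of _ _ _ \<A>] ehom_map_efunctor_of_el [OF T])
    then show ?thesis using True by simp
  next
    case False
    then show ?thesis
      using extensional_arb [OF strong_functor_laws(8) [OF T] False] by (simp add: strong_of_def)
  qed
  then have farr: "farr (strong_of \<A> \<B> ?F) = farr T" ..
  have "strength (strong_of \<A> \<B> ?F) p = strength T p" for p
  proof (cases "p \<in> ob E \<times> eob \<A>")
    case True
    then obtain X A where p: "p = (X, A)" and [simp]: "X \<in> ob E" "A \<in> eob \<A>" by auto
    \<comment> \<open>By \<open>ehom_map_efunctor_of\<close>, the value of \<phi> at
      \<open>coev\<close> involves T only at the adjunct of \<open>coev\<close>. That adjunct is an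
      identity, so just the strength is left.\<close>
    have ident: "adjunct E \<A> A (act_ob \<A> X A) (coev E \<A> X A) = ident (und E \<A>) (act_ob \<A> X A)"
      by (rule act_eqI [of \<A> A X]) (simp_all add: post_adjunct)
    show ?thesis
      unfolding p
      by (rule act_eqI [of \<B> "fob T A" X])
        (use strength_strong_of(1-3) [OF tensored F, of X A] strength_strong_of(4) [OF tensored F, of X A] in
          \<open>simp_all add: ehom_map_efunctor_of [OF T] ident strong_functor_laws(1) [OF T]\<close>)
  next
    case False
    then show ?thesis
      using extensional_arb [OF strong_functor_laws(9) [OF T] False] by (simp add: strong_of_def)
  qed
  then have "strength (strong_of \<A> \<B> ?F) = strength T" ..
  then show ?thesis
    using farr by simp
qed

text \<open>The strength turns \<open>coev\<close> of \<B> into \<phi> on \<open>coev\<close> of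
  \<A>; moving \<phi> past the image of the counit leaves \<phi> on the counit composed with
  \<open>coev\<close>, which is an identity.\<close>

lemma efunctor_of_strong_of:
  assumes F: "is_efunctor E \<A> \<B> F"
  shows "efunctor_of \<A> \<B> (strong_of \<A> \<B> F) = F"
proof -
  note [simp] = F efunctor_typing [OF F]
  have "ehom_map (efunctor_of \<A> \<B> (strong_of \<A> \<B> F)) p = ehom_map F p" for p
  proof (cases "p \<in> eob \<A> \<times> eob \<A>")
    case True
    then obtain A B where p: "p = (A, B)" and [simp]: "A \<in> eob \<A>" "B \<in> eob \<A>" by auto
    show ?thesis
      by (simp add: p efunctor_of_def post_cmp cmp_assoc post_uf [OF F] post_adjunct)
  next
    case False
    then show ?thesis
      using extensional_arb [OF efunctor_extensional(2) [OF F] False] by (simp add: efunctor_of_def)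
  qed
  then have "ehom_map (efunctor_of \<A> \<B> (strong_of \<A> \<B> F)) = ehom_map F" ..
  then show ?thesis by simp
qed

lemma bij_betw_strong_of:
  "bij_betw (strong_of \<A> \<B>) {F. is_efunctor E \<A> \<B> F} {T. is_strong_functor E \<A> \<B> T}"
  by (rule bij_betw_byWitness [where f' = "efunctor_of \<A> \<B>"])
    (auto simp: efunctor_of_strong_of strong_of_efunctor_of efunctor_efunctor_of strong_functor_strong_of)

text \<open>E-naturality at the generalised element \<open>coev\<close> is compatibility with the
  strengths. Conversely, all of \<phi> is recovered from its value at \<open>coev\<close> with X =
  \<A>(A,B), followed by the image of the counit; so ordinary naturality at the counit and
  compatibility for this X are enough.\<close>

lemma enatural_iff_strong_natural:
  assumes F: "is_efunctor E \<A> \<B> F" and G: "is_efunctor E \<A> \<B> G"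
  shows "is_enatural E \<A> \<B> F G \<alpha> \<longleftrightarrow> is_strong_natural E \<A> \<B> (strong_of \<A> \<B> F) (strong_of \<A> \<B> G) \<alpha>"
proof
  note [simp] = F G efunctor_typing [OF F] efunctor_typing [OF G]
  let ?\<sigma> = "\<lambda>F X A. strength (strong_of \<A> \<B> F) (X, A)"
  {
    assume \<alpha>: "is_enatural E \<A> \<B> F G \<alpha>"
    note [simp] = enatural_simps [OF \<alpha>]
    have "\<alpha> (act_ob \<A> X A) \<cdot>\<^bsub>und E \<B>\<^esub> ?\<sigma> F X A = ?\<sigma> G X A \<cdot>\<^bsub>und E \<B>\<^esub> act_right E \<B> X (\<alpha> A)"
      if [simp]: "X \<in> ob E" "A \<in> eob \<A>" for X A
      by (rule act_eqI [of \<B> "eob_map F A" X])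
        (simp_all add: post_cmp cmp_assoc post_act_right post_pre' enatural_apply [OF F G _ _ _ _ _ _ \<alpha>])
    then show "is_strong_natural E \<A> \<B> (strong_of \<A> \<B> F) (strong_of \<A> \<B> G) \<alpha>"
      using \<alpha> by (simp add: is_strong_natural_def is_natural_def enatural_natural [OF F G _ _ \<alpha>])
        (simp add: is_enatural_def)
  }
  assume \<alpha>: "is_strong_natural E \<A> \<B> (strong_of \<A> \<B> F) (strong_of \<A> \<B> G) \<alpha>"
  have [simp]: "\<alpha> A \<in> arr (und E \<B>)" "src (und E \<B>) (\<alpha> A) = eob_map F A" "tgt (und E \<B>) (\<alpha> A) = eob_map G A"
    if "A \<in> eob \<A>" for A
    using \<alpha> that by (simp_all add: is_strong_natural_def is_natural_def)
  have nat: "\<alpha> (tgt (und E \<A>) k) \<cdot>\<^bsub>und E \<B>\<^esub> uf F k = uf G k \<cdot>\<^bsub>und E \<B>\<^esub> \<alpha> (src (und E \<A>) k)"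
    if "k \<in> arr (und E \<A>)" for k
    using \<alpha> that by (simp add: is_strong_natural_def is_natural_def)
  have str: "\<alpha> (act_ob \<A> X A) \<cdot>\<^bsub>und E \<B>\<^esub> ?\<sigma> F X A = ?\<sigma> G X A \<cdot>\<^bsub>und E \<B>\<^esub> act_right E \<B> X (\<alpha> A)"
    if "X \<in> ob E" "A \<in> eob \<A>" for X A
    using \<alpha> that by (simp add: is_strong_natural_def)
  have "post \<B> (eob_map F A) (\<alpha> B) \<cdot> ehom_map F (A, B) = pre \<B> (\<alpha> A) (eob_map G B) \<cdot> ehom_map G (A, B)"
    if [simp]: "A \<in> eob \<A>" "B \<in> eob \<A>" for A B
  proof -
    let ?H = "ehom \<A> A B" and ?\<epsilon> = "adjunct E \<A> A B (one (ehom \<A> A B))"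
    let ?HA = "act_ob \<A> ?H A"
    \<comment> \<open>The identity of \<A>(A,B) is the counit composed with \<open>coev\<close>, and
      \<phi> is natural in its second argument. Stated for any F, since G needs it as well.\<close>
    have map: "ehom_map F (A, B) = post \<B> (eob_map F A) (uf F ?\<epsilon>) \<cdot> ehom_map F (A, ?HA) \<cdot> coev E \<A> ?H A"
      if F: "is_efunctor E \<A> \<B> F" for F
      using efunctor_post' [OF F, of A ?\<epsilon> B "coev E \<A> ?H A"] efunctor_typing [OF F] by (simp add: post_adjunct)
    have "post \<B> (eob_map F A) (\<alpha> B) \<cdot> ehom_map F (A, B)
      = post \<B> (eob_map F A) (\<alpha> B \<cdot>\<^bsub>und E \<B>\<^esub> uf F ?\<epsilon>) \<cdot> ehom_map F (A, ?HA) \<cdot> coev E \<A> ?H A"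
      by (subst map) (simp_all add: post_cmp cmp_assoc)
    \<comment> \<open>Ordinary naturality replaces the component at B by the one at \<A>(A,B)
      \<otimes> A, to which compatibility with the strengths applies.\<close>
    also have "\<alpha> B \<cdot>\<^bsub>und E \<B>\<^esub> uf F ?\<epsilon> = uf G ?\<epsilon> \<cdot>\<^bsub>und E \<B>\<^esub> \<alpha> ?HA"
      using nat [of ?\<epsilon>] by simp
    also have "post \<B> (eob_map F A) (uf G ?\<epsilon> \<cdot>\<^bsub>und E \<B>\<^esub> \<alpha> ?HA) \<cdot> ehom_map F (A, ?HA) \<cdot> coev E \<A> ?H A
      = post \<B> (eob_map F A) (uf G ?\<epsilon>) \<cdot> post \<B> (eob_map F A) (\<alpha> ?HA \<cdot>\<^bsub>und E \<B>\<^esub> ?\<sigma> F ?H A) \<cdot> coev E \<B> ?H (eob_map F A)"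
      by (simp add: post_cmp cmp_assoc)
    also have "\<dots> = pre \<B> (\<alpha> A) (eob_map G B) \<cdot> post \<B> (eob_map G A) (uf G ?\<epsilon>) \<cdot> ehom_map G (A, ?HA) \<cdot> coev E \<A> ?H A"
      by (simp add: str post_cmp cmp_assoc post_act_right post_pre')
    also have "\<dots> = pre \<B> (\<alpha> A) (eob_map G B) \<cdot> ehom_map G (A, B)"
      by (simp flip: map [OF G])
    finally show ?thesis .
  qed
  then show "is_enatural E \<A> \<B> F G \<alpha>"
    using \<alpha> by (simp add: is_enatural_def) (simp add: is_strong_natural_def)
qed

end

section \<open>Compatibility with identity and composite 1-cells\<close>

lemma strong_of_id:
  assumes [simp]: "is_tensored E \<A>"
  shows "strong_of \<A> \<A> (id_efunctor E \<A>) = id_strong_functor E \<A>"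
proof -
  have "adjunct E \<A> A (act_ob \<A> X A) (coev E \<A> X A) = ident (und E \<A>) (act_ob \<A> X A)"
    if "A \<in> eob \<A>" "X \<in> ob E" for A X
    by (rule act_eqI [of \<A> A X]) (use that in \<open>simp_all add: post_adjunct\<close>)
  then show ?thesis
    by (auto simp add: strong_of_def id_strong_functor_def uf_id intro!: restrict_ext)
      (simp add: id_efunctor_def)
qed

text \<open>On \<open>coev\<close> the composite strength gives \<phi> of G after \<phi> of F:
  \<open>post_uf\<close> moves the former past the image of the first strength.\<close>

lemma strong_of_comp:
  assumes [simp]: "is_tensored E \<A>" "is_tensored E \<B>" "is_tensored E \<C>"
    and F: "is_efunctor E \<A> \<B> F" and G: "is_efunctor E \<B> \<C> G"
  shows "strong_of \<A> \<C> (comp_efunctor E \<A> G F) = comp_strong_functor E \<A> \<C> (strong_of \<B> \<C> G) (strong_of \<A> \<B> F)"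
proof -
  note [simp] = F G efunctor_typing [OF F] efunctor_typing [OF G]
  let ?H = "comp_efunctor E \<A> G F"
  have H: "is_efunctor E \<A> \<C> ?H"
    by (rule comp_efunctor [OF F G]) simp_all
  have "strength (strong_of \<A> \<C> ?H) (X, A) =
      farr (strong_of \<B> \<C> G) (strength (strong_of \<A> \<B> F) (X, A)) \<cdot>\<^bsub>und E \<C>\<^esub> strength (strong_of \<B> \<C> G) (X, eob_map F A)"
    if [simp]: "X \<in> ob E" "A \<in> eob \<A>" for X A
    by (rule act_eqI [of \<C> "eob_map ?H A" X])
      (use strength_strong_of [OF _ _ H, of X A] in \<open>simp_all add: post_cmp cmp_assoc post_uf [OF G]\<close>)
  then have "strength (strong_of \<A> \<C> ?H) = strength (comp_strong_functor E \<A> \<C> (strong_of \<B> \<C> G) (strong_of \<A> \<B> F))"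
    by (auto simp add: strong_of_def [of _ _ ?H] comp_strong_functor_def intro!: restrict_ext)
  moreover have "farr (strong_of \<A> \<C> ?H) = farr (comp_strong_functor E \<A> \<C> (strong_of \<B> \<C> G) (strong_of \<A> \<B> F))"
    by (auto simp add: strong_of_def [of _ _ ?H] comp_strong_functor_def uf_comp [OF F G] intro!: restrict_ext)
  moreover have "fob (strong_of \<A> \<C> ?H) = fob (comp_strong_functor E \<A> \<C> (strong_of \<B> \<C> G) (strong_of \<A> \<B> F))"
    by (simp add: comp_strong_functor_def comp_efunctor_def)
  ultimately show ?thesis by simp
qed

end

section \<open>Transport along an isomorphism of 2-categories\<close>

lemma functor_simps:
  assumes "is_functor C D F"
  shows "X \<in> ob C \<Longrightarrow> fob F X \<in> ob D"
    and "f \<in> arr C \<Longrightarrow> farr F f \<in> arr D"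
    and "f \<in> arr C \<Longrightarrow> src D (farr F f) = fob F (src C f)"
    and "f \<in> arr C \<Longrightarrow> tgt D (farr F f) = fob F (tgt C f)"
    and "X \<in> ob C \<Longrightarrow> farr F (ident C X) = ident D (fob F X)"
    and "f \<in> arr C \<Longrightarrow> g \<in> arr C \<Longrightarrow> tgt C f = src C g \<Longrightarrow> farr F (g \<cdot>\<^bsub>C\<^esub> f) = farr F g \<cdot>\<^bsub>D\<^esub> farr F f"
  using assms by (simp_all add: is_functor_def)

lemma prod_category_simps [simp]:
  "ob (prod_category C D) = ob C \<times> ob D" "arr (prod_category C D) = arr C \<times> arr D"
  "src (prod_category C D) (f, g) = (src C f, src D g)" "tgt (prod_category C D) (f, g) = (tgt C f, tgt D g)"
  "ident (prod_category C D) (X, Y) = (ident C X, ident D Y)"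
  "(f', g') \<cdot>\<^bsub>prod_category C D\<^esub> (f, g) = (f' \<cdot>\<^bsub>C\<^esub> f, g' \<cdot>\<^bsub>D\<^esub> g)"
  by (simp_all add: prod_category_def)

lemma is_functor_prodI:
  assumes "\<And>X Y. X \<in> ob C \<Longrightarrow> Y \<in> ob D \<Longrightarrow> fob F (X, Y) \<in> ob L"
    and "\<And>f g. f \<in> arr C \<Longrightarrow> g \<in> arr D \<Longrightarrow> farr F (f, g) \<in> hom L (fob F (src C f, src D g)) (fob F (tgt C f, tgt D g))"
    and "\<And>X Y. X \<in> ob C \<Longrightarrow> Y \<in> ob D \<Longrightarrow> farr F (ident C X, ident D Y) = ident L (fob F (X, Y))"
    and "\<And>f g f' g'. f \<in> arr C \<Longrightarrow> g \<in> arr D \<Longrightarrow> f' \<in> arr C \<Longrightarrow> g' \<in> arr D \<Longrightarrow> tgt C f = src C f' \<Longrightarrow> tgt D g = src D g' \<Longrightarrow>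
      farr F (f' \<cdot>\<^bsub>C\<^esub> f, g' \<cdot>\<^bsub>D\<^esub> g) = farr F (f', g') \<cdot>\<^bsub>L\<^esub> farr F (f, g)"
  shows "is_functor (prod_category C D) L F"
  unfolding is_functor_def using assms by auto

lemma functor_prod_simps:
  assumes "is_functor (prod_category C D) L F"
  shows "X \<in> ob C \<Longrightarrow> Y \<in> ob D \<Longrightarrow> fob F (X, Y) \<in> ob L"
    and "f \<in> arr C \<Longrightarrow> g \<in> arr D \<Longrightarrow> farr F (f, g) \<in> arr L"
    and "f \<in> arr C \<Longrightarrow> g \<in> arr D \<Longrightarrow> src L (farr F (f, g)) = fob F (src C f, src D g)"
    and "f \<in> arr C \<Longrightarrow> g \<in> arr D \<Longrightarrow> tgt L (farr F (f, g)) = fob F (tgt C f, tgt D g)"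
    and "X \<in> ob C \<Longrightarrow> Y \<in> ob D \<Longrightarrow> farr F (ident C X, ident D Y) = ident L (fob F (X, Y))"
    and "f \<in> arr C \<Longrightarrow> g \<in> arr D \<Longrightarrow> f' \<in> arr C \<Longrightarrow> g' \<in> arr D \<Longrightarrow> tgt C f = src C f' \<Longrightarrow> tgt D g = src D g' \<Longrightarrow>
      farr F (f' \<cdot>\<^bsub>C\<^esub> f, g' \<cdot>\<^bsub>D\<^esub> g) = farr F (f', g') \<cdot>\<^bsub>L\<^esub> farr F (f, g)"
  using functor_simps(1,5) [OF assms, of "(X, Y)"] functor_simps(2-4) [OF assms, of "(f, g)"]
    functor_simps(6) [OF assms, of "(f, g)" "(f', g')"]
  by auto

definition inv_functor ::
  "('o, 'a, 'm) category_scheme \<Rightarrow> ('o, 'a, 'p, 'b) functor_data \<Rightarrow> ('p, 'b, 'o, 'a) functor_data" where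
  "inv_functor C F = \<lparr> fob = inv_into (ob C) (fob F), farr = inv_into (arr C) (farr F) \<rparr>"

lemma inv_functor_inverse:
  assumes "bij_betw (fob F) (ob C) (ob D)" "bij_betw (farr F) (arr C) (arr D)"
  shows "X \<in> ob C \<Longrightarrow> fob (inv_functor C F) (fob F X) = X"
    "f \<in> arr C \<Longrightarrow> farr (inv_functor C F) (farr F f) = f"
    "Y \<in> ob D \<Longrightarrow> fob F (fob (inv_functor C F) Y) = Y"
    "g \<in> arr D \<Longrightarrow> farr F (farr (inv_functor C F) g) = g"
  using assms by (simp_all add: inv_functor_def bij_betw_inv_into_left bij_betw_inv_into_right)

text \<open>\<open>is_functor\<close> asks only for preservation, so D may be bare data. Every
  object and arrow of D is an image; injectivity on objects is needed because composability of
  images must come from composability in C.\<close>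

lemma transport_category:
  assumes C: "is_category C" and F: "is_functor C D F"
    and bij: "fob F ` ob C = ob D" "farr F ` arr C = arr D" "inj_on (fob F) (ob C)"
  shows "is_category D"
proof -
  note [simp] = C functor_simps(1-4) [OF F]
  have composable: "tgt C f = src C g"
    if "f \<in> arr C" "g \<in> arr C" "fob F (tgt C f) = fob F (src C g)" for f g
    using bij(3) that by (auto dest: inj_onD)
  \<comment> \<open>Reversed, these rules compute the operations of D on images inside C.\<close>
  note [simp] = functor_simps(5,6) [OF F, symmetric]
  show ?thesis
    unfolding is_category_def
  proof (intro conjI ballI impI)
    show "src D f \<in> ob D" "tgt D f \<in> ob D" "f \<cdot>\<^bsub>D\<^esub> ident D (src D f) = f" "ident D (tgt D f) \<cdot>\<^bsub>D\<^esub> f = f"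
      if "f \<in> arr D" for f
      using that [folded bij(1,2)] by auto
    show "ident D X \<in> hom D X X" if "X \<in> ob D" for X
      using that [folded bij(1,2)] by auto
    show "g \<cdot>\<^bsub>D\<^esub> f \<in> hom D (src D f) (tgt D g)" if "f \<in> arr D" "g \<in> arr D" "tgt D f = src D g" for f g
    proof -
      note fg = that
      obtain f' g' where "f = farr F f'" "g = farr F g'" and [simp]: "f' \<in> arr C" "g' \<in> arr C"
        using fg(1,2) [folded bij(1,2)] by blast
      moreover from this fg have [simp]: "tgt C f' = src C g'"
        by (auto intro!: composable)
      ultimately show ?thesis by simp
    qed
    show "(h \<cdot>\<^bsub>D\<^esub> g) \<cdot>\<^bsub>D\<^esub> f = h \<cdot>\<^bsub>D\<^esub> g \<cdot>\<^bsub>D\<^esub> f"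
      if "f \<in> arr D" "g \<in> arr D" "h \<in> arr D" "tgt D f = src D g" "tgt D g = src D h" for f g h
    proof -
      note fgh = that
      obtain f' g' h' where "f = farr F f'" "g = farr F g'" "h = farr F h'" and [simp]: "f' \<in> arr C" "g' \<in> arr C" "h' \<in> arr C"
        using fgh(1-3) [folded bij(1,2)] by blast
      moreover from this fgh have [simp]: "tgt C f' = src C g'" "tgt C g' = src C h'"
        by (auto intro!: composable)
      ultimately show ?thesis
        by (simp add: cmp_assoc)
    qed
  qed
qed

lemma transport_functor:
  assumes C: "is_category C" and F: "is_functor C D F"
    and bij: "bij_betw (fob F) (ob C) (ob D)" "bij_betw (farr F) (arr C) (arr D)"
  shows "is_functor D C (inv_functor C F)"
proof -
  note [simp] = C functor_simps(1-4) [OF F] functor_simps(5,6) [OF F, symmetric] inv_functor_inverse [OF bij]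
  have im: "fob F ` ob C = ob D" "farr F ` arr C = arr D" "inj_on (fob F) (ob C)"
    using bij by (auto simp: bij_betw_def)
  have composable: "tgt C f = src C g"
    if "f \<in> arr C" "g \<in> arr C" "fob F (tgt C f) = fob F (src C g)" for f g
    using im(3) that by (auto dest: inj_onD)
  show ?thesis
    unfolding is_functor_def
  proof (intro conjI ballI impI)
    fix X assume "X \<in> ob D"
    then obtain X' where "X' \<in> ob C" "X = fob F X'" unfolding im(1) [symmetric] by blast
    then show "fob (inv_functor C F) X \<in> ob C" "farr (inv_functor C F) (ident D X) = ident C (fob (inv_functor C F) X)"
      by simp_all
  next
    fix f assume "f \<in> arr D"
    then obtain f' where "f' \<in> arr C" "f = farr F f'" unfolding im(2) [symmetric] by blast
    then show "farr (inv_functor C F) f \<in> hom C (fob (inv_functor C F) (src D f)) (fob (inv_functor C F) (tgt D f))"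
      by simp
  next
    fix f g assume "f \<in> arr D" "g \<in> arr D" "tgt D f = src D g"
    moreover from this obtain f' g' where "f' \<in> arr C" "f = farr F f'" "g' \<in> arr C" "g = farr F g'"
      unfolding im(2) [symmetric] by blast
    ultimately show "farr (inv_functor C F) (g \<cdot>\<^bsub>D\<^esub> f) = farr (inv_functor C F) g \<cdot>\<^bsub>C\<^esub> farr (inv_functor C F) f"
      using composable [of f' g'] by simp
  qed
qed

section \<open>Transport of 2-category structure\<close>

lemma two_category_id1: "is_two_category K \<Longrightarrow> A \<in> ob2 K \<Longrightarrow> id1 K A \<in> ob (hom2 K A A)"
  by (simp add: is_two_category_def)

lemma two_category_simps:
  assumes "is_two_category K" "A \<in> ob2 K" "B \<in> ob2 K"
  shows "is_category (hom2 K A B)"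
    and "C \<in> ob2 K \<Longrightarrow> is_functor (prod_category (hom2 K B C) (hom2 K A B)) (hom2 K A C) (hcomp K A B C)"
    and "f \<in> ob (hom2 K A B) \<Longrightarrow> fob (hcomp K A A B) (f, id1 K A) = f"
    and "f \<in> ob (hom2 K A B) \<Longrightarrow> fob (hcomp K A B B) (id1 K B, f) = f"
    and "\<alpha> \<in> arr (hom2 K A B) \<Longrightarrow> farr (hcomp K A A B) (\<alpha>, ident (hom2 K A A) (id1 K A)) = \<alpha>"
    and "\<alpha> \<in> arr (hom2 K A B) \<Longrightarrow> farr (hcomp K A B B) (ident (hom2 K B B) (id1 K B), \<alpha>) = \<alpha>"
  using assms by (simp_all add: is_two_category_def)

lemma two_category_assoc:
  assumes "is_two_category K" "A \<in> ob2 K" "B \<in> ob2 K" "C \<in> ob2 K" "D \<in> ob2 K"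
  shows "h \<in> ob (hom2 K C D) \<Longrightarrow> g \<in> ob (hom2 K B C) \<Longrightarrow> f \<in> ob (hom2 K A B) \<Longrightarrow>
       fob (hcomp K A B D) (fob (hcomp K B C D) (h, g), f) = fob (hcomp K A C D) (h, fob (hcomp K A B C) (g, f))"
    and "\<gamma> \<in> arr (hom2 K C D) \<Longrightarrow> \<beta> \<in> arr (hom2 K B C) \<Longrightarrow> \<alpha> \<in> arr (hom2 K A B) \<Longrightarrow>
       farr (hcomp K A B D) (farr (hcomp K B C D) (\<gamma>, \<beta>), \<alpha>) = farr (hcomp K A C D) (\<gamma>, farr (hcomp K A B C) (\<beta>, \<alpha>))"
  using assms by (simp_all add: is_two_category_def)

text \<open>L is mere data at first. Each of its cells is the image of a unique cell of K, and its
  operations on images are images of those of K, so every axiom of L is the image of one of K. Only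
  one of the two structures has to be checked by hand.\<close>

lemma two_isomorphic_transport:
  fixes K :: "('c, 'f, 't) two_category" and L :: "('c, 'g, 's) two_category"
    and \<Phi> :: "'c \<Rightarrow> 'c \<Rightarrow> ('f, 't, 'g, 's) functor_data"
  assumes K: "is_two_category K" and ob: "ob2 L = ob2 K"
    and hom_functor: "\<And>A B. A \<in> ob2 K \<Longrightarrow> B \<in> ob2 K \<Longrightarrow> is_functor (hom2 K A B) (hom2 L A B) (\<Phi> A B)"
    and bij_ob: "\<And>A B. A \<in> ob2 K \<Longrightarrow> B \<in> ob2 K \<Longrightarrow> bij_betw (fob (\<Phi> A B)) (ob (hom2 K A B)) (ob (hom2 L A B))"
    and bij_arr: "\<And>A B. A \<in> ob2 K \<Longrightarrow> B \<in> ob2 K \<Longrightarrow> bij_betw (farr (\<Phi> A B)) (arr (hom2 K A B)) (arr (hom2 L A B))"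
    and id1: "\<And>A. A \<in> ob2 K \<Longrightarrow> fob (\<Phi> A A) (id1 K A) = id1 L A"
    and hcomp_ob: "\<And>A B C g f. A \<in> ob2 K \<Longrightarrow> B \<in> ob2 K \<Longrightarrow> C \<in> ob2 K \<Longrightarrow>
      g \<in> ob (hom2 K B C) \<Longrightarrow> f \<in> ob (hom2 K A B) \<Longrightarrow>
      fob (\<Phi> A C) (fob (hcomp K A B C) (g, f)) = fob (hcomp L A B C) (fob (\<Phi> B C) g, fob (\<Phi> A B) f)"
    and hcomp_arr: "\<And>A B C \<beta> \<alpha>. A \<in> ob2 K \<Longrightarrow> B \<in> ob2 K \<Longrightarrow> C \<in> ob2 K \<Longrightarrow>
      \<beta> \<in> arr (hom2 K B C) \<Longrightarrow> \<alpha> \<in> arr (hom2 K A B) \<Longrightarrow>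
      farr (\<Phi> A C) (farr (hcomp K A B C) (\<beta>, \<alpha>)) = farr (hcomp L A B C) (farr (\<Phi> B C) \<beta>, farr (\<Phi> A B) \<alpha>)"
  shows "two_isomorphic L K"
proof -
  define \<Psi> where "\<Psi> A B = inv_functor (hom2 K A B) (\<Phi> A B)" for A B
  note [simp] = two_category_id1 [OF K] two_category_simps [OF K] functor_prod_simps [OF two_category_simps(2) [OF K]]
  \<comment> \<open>The preservation equations are reversed, so that operations of L on images are
    computed in K.\<close>
  note [simp] = functor_simps(1-4) [OF hom_functor] functor_simps(5,6) [OF hom_functor, symmetric]
    hcomp_ob [symmetric] hcomp_arr [symmetric]
  have [simp]: "f \<in> ob (hom2 K A B) \<Longrightarrow> fob (\<Psi> A B) (fob (\<Phi> A B) f) = f"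
    "\<alpha> \<in> arr (hom2 K A B) \<Longrightarrow> farr (\<Psi> A B) (farr (\<Phi> A B) \<alpha>) = \<alpha>"
    if "A \<in> ob2 K" "B \<in> ob2 K" for A B f \<alpha>
    using inv_functor_inverse [OF bij_ob bij_arr, OF that that] by (simp_all add: \<Psi>_def)
  have \<Psi>_functor: "is_functor (hom2 L A B) (hom2 K A B) (\<Psi> A B)" if "A \<in> ob2 K" "B \<in> ob2 K" for A B
    unfolding \<Psi>_def using that by (intro transport_functor hom_functor bij_ob bij_arr) simp_all
  have obE: thesis if "g \<in> ob (hom2 L A B)" "A \<in> ob2 K" "B \<in> ob2 K"
    "\<And>f. f \<in> ob (hom2 K A B) \<Longrightarrow> g = fob (\<Phi> A B) f \<Longrightarrow> thesis" for g A B thesis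
    using bij_ob [OF that(2,3)] that(1,4) unfolding bij_betw_def by blast
  have arrE: thesis if "\<beta> \<in> arr (hom2 L A B)" "A \<in> ob2 K" "B \<in> ob2 K"
    "\<And>\<alpha>. \<alpha> \<in> arr (hom2 K A B) \<Longrightarrow> \<beta> = farr (\<Phi> A B) \<alpha> \<Longrightarrow> thesis" for \<beta> A B thesis
    using bij_arr [OF that(2,3)] that(1,4) unfolding bij_betw_def by blast
  \<comment> \<open>Images of 2-cells that are composable in L come from 2-cells composable in K, by
    injectivity on 1-cells.\<close>
  have composable: "f = g"
    if "fob (\<Phi> A B) f = fob (\<Phi> A B) g" "A \<in> ob2 K" "B \<in> ob2 K" "f \<in> ob (hom2 K A B)" "g \<in> ob (hom2 K A B)" for A B f g
    using bij_ob [OF that(2,3)] that by (auto simp: bij_betw_def dest: inj_onD)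
  have L_category [simp]: "is_category (hom2 L A B)" if "A \<in> ob2 K" "B \<in> ob2 K" for A B
    using that bij_ob [OF that] bij_arr [OF that] by (intro transport_category [OF _ hom_functor]) (auto simp: bij_betw_def)
  have hcomp: "is_functor (prod_category (hom2 L B C) (hom2 L A B)) (hom2 L A C) (hcomp L A B C)"
    if [simp]: "A \<in> ob2 K" "B \<in> ob2 K" "C \<in> ob2 K" for A B C
  proof (rule is_functor_prodI)
    fix g f assume "g \<in> ob (hom2 L B C)" "f \<in> ob (hom2 L A B)"
    then show "fob (hcomp L A B C) (g, f) \<in> ob (hom2 L A C)"
      "farr (hcomp L A B C) (ident (hom2 L B C) g, ident (hom2 L A B) f) = ident (hom2 L A C) (fob (hcomp L A B C) (g, f))"
      by (auto elim!: obE)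
  next
    fix \<beta> \<alpha> assume "\<beta> \<in> arr (hom2 L B C)" "\<alpha> \<in> arr (hom2 L A B)"
    then show "farr (hcomp L A B C) (\<beta>, \<alpha>) \<in> hom (hom2 L A C)
       (fob (hcomp L A B C) (src (hom2 L B C) \<beta>, src (hom2 L A B) \<alpha>))
       (fob (hcomp L A B C) (tgt (hom2 L B C) \<beta>, tgt (hom2 L A B) \<alpha>))"
      by (auto elim!: arrE)
  next
    fix \<beta> \<alpha> \<beta>' \<alpha>' assume "\<beta> \<in> arr (hom2 L B C)" "\<alpha> \<in> arr (hom2 L A B)" "\<beta>' \<in> arr (hom2 L B C)" "\<alpha>' \<in> arr (hom2 L A B)"
      "tgt (hom2 L B C) \<beta> = src (hom2 L B C) \<beta>'" "tgt (hom2 L A B) \<alpha> = src (hom2 L A B) \<alpha>'"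
    then show "farr (hcomp L A B C) (\<beta>' \<cdot>\<^bsub>hom2 L B C\<^esub> \<beta>, \<alpha>' \<cdot>\<^bsub>hom2 L A B\<^esub> \<alpha>) =
       farr (hcomp L A B C) (\<beta>', \<alpha>') \<cdot>\<^bsub>hom2 L A C\<^esub> farr (hcomp L A B C) (\<beta>, \<alpha>)"
      by (auto elim!: arrE dest!: composable)
  qed
  have L: "is_two_category L"
    unfolding is_two_category_def ob
  proof (intro conjI ballI)
    fix A assume [simp]: "A \<in> ob2 K"
    show "id1 L A \<in> ob (hom2 L A A)"
      by (simp flip: id1)
    fix B assume [simp]: "B \<in> ob2 K"
    show "is_category (hom2 L A B)" by simp
    show "fob (hcomp L A A B) (f, id1 L A) = f" "fob (hcomp L A B B) (id1 L B, f) = f"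
      if "f \<in> ob (hom2 L A B)" for f
      using that by (auto elim!: obE simp flip: id1)
    show "farr (hcomp L A A B) (\<alpha>, ident (hom2 L A A) (id1 L A)) = \<alpha>"
      "farr (hcomp L A B B) (ident (hom2 L B B) (id1 L B), \<alpha>) = \<alpha>"
      if "\<alpha> \<in> arr (hom2 L A B)" for \<alpha>
      using that by (auto elim!: arrE simp flip: id1)
    fix C assume [simp]: "C \<in> ob2 K"
    show "is_functor (prod_category (hom2 L B C) (hom2 L A B)) (hom2 L A C) (hcomp L A B C)"
      by (rule hcomp) simp_all
    fix D assume [simp]: "D \<in> ob2 K"
    show "fob (hcomp L A B D) (fob (hcomp L B C D) (h, g), f) = fob (hcomp L A C D) (h, fob (hcomp L A B C) (g, f))"
      if "h \<in> ob (hom2 L C D)" "g \<in> ob (hom2 L B C)" "f \<in> ob (hom2 L A B)" for h g f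
      using that by (auto elim!: obE simp: two_category_assoc [OF K])
    show "farr (hcomp L A B D) (farr (hcomp L B C D) (\<gamma>, \<beta>), \<alpha>) = farr (hcomp L A C D) (\<gamma>, farr (hcomp L A B C) (\<beta>, \<alpha>))"
      if "\<gamma> \<in> arr (hom2 L C D)" "\<beta> \<in> arr (hom2 L B C)" "\<alpha> \<in> arr (hom2 L A B)" for \<gamma> \<beta> \<alpha>
      using that by (auto elim!: arrE simp: two_category_assoc [OF K])
  qed
  have "is_two_functor K L \<lparr>map0 = \<lambda>A. A, map_hom = \<Phi>\<rparr>"
    unfolding is_two_functor_def by (simp add: ob hom_functor id1)
  moreover have "is_two_functor L K \<lparr>map0 = \<lambda>A. A, map_hom = \<Psi>\<rparr>"
    unfolding is_two_functor_def ob by (auto simp: \<Psi>_functor elim!: obE arrE simp flip: id1)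
  moreover have "is_left_inverse_two_functor K \<lparr>map0 = \<lambda>A. A, map_hom = \<Phi>\<rparr> \<lparr>map0 = \<lambda>A. A, map_hom = \<Psi>\<rparr>"
    unfolding is_left_inverse_two_functor_def by simp
  moreover have "is_left_inverse_two_functor L \<lparr>map0 = \<lambda>A. A, map_hom = \<Psi>\<rparr> \<lparr>map0 = \<lambda>A. A, map_hom = \<Phi>\<rparr>"
    unfolding is_left_inverse_two_functor_def ob by (auto elim!: obE arrE)
  ultimately show ?thesis
    unfolding two_isomorphic_def using K L by blast
qed

section \<open>Categories of transformations\<close>

lemma transf_category_simps [simp]:
  "ob (transf_category I D m S R) = S"
  "(F, G, \<alpha>) \<in> arr (transf_category I D m S R) \<longleftrightarrow> F \<in> S \<and> G \<in> S \<and> R F G \<alpha>"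
  "src (transf_category I D m S R) (F, G, \<alpha>) = F" "tgt (transf_category I D m S R) (F, G, \<alpha>) = G"
  "ident (transf_category I D m S R) F = (F, F, \<lambda>A\<in>I. ident D (m F A))"
  "(G', H, \<beta>) \<cdot>\<^bsub>transf_category I D m S R\<^esub> (F, G, \<alpha>) = (F, H, \<lambda>A\<in>I. \<beta> A \<cdot>\<^bsub>D\<^esub> \<alpha> A)"
  by (simp_all add: transf_category_def)

text \<open>Composing with an identity yields \<open>restrict \<alpha> I\<close>; extensionality of
  the families turns this into \<alpha>, so the unit laws hold as equalities.\<close>

lemma category_transf_category:
  assumes D: "is_category D"
    and "\<And>F A. F \<in> S \<Longrightarrow> A \<in> I \<Longrightarrow> m F A \<in> ob D"
    and ext: "\<And>F G \<alpha>. R F G \<alpha> \<Longrightarrow> \<alpha> \<in> extensional I"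
    and hom: "\<And>F G \<alpha> A. R F G \<alpha> \<Longrightarrow> A \<in> I \<Longrightarrow> \<alpha> A \<in> hom D (m F A) (m G A)"
    and ident: "\<And>F. F \<in> S \<Longrightarrow> R F F (\<lambda>A\<in>I. ident D (m F A))"
    and cmp: "\<And>F G H \<alpha> \<beta>. F \<in> S \<Longrightarrow> G \<in> S \<Longrightarrow> H \<in> S \<Longrightarrow> R F G \<alpha> \<Longrightarrow> R G H \<beta> \<Longrightarrow> R F H (\<lambda>A\<in>I. \<beta> A \<cdot>\<^bsub>D\<^esub> \<alpha> A)"
  shows "is_category (transf_category I D m S R)"
  unfolding is_category_def
proof (intro conjI ballI impI)
  let ?C = "transf_category I D m S R"
  note [simp] = D ident cmp
  show "ident ?C F \<in> hom ?C F F" if "F \<in> ob ?C" for F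
    using that by simp
  fix f assume f: "f \<in> arr ?C"
  obtain F G \<alpha> where [simp]: "f = (F, G, \<alpha>)" by (cases f)
  note [simp] = f [simplified]
  show "src ?C f \<in> ob ?C" "tgt ?C f \<in> ob ?C"
    by simp_all
  have "(\<lambda>A\<in>I. \<alpha> A \<cdot>\<^bsub>D\<^esub> ident D (m F A)) = restrict \<alpha> I" "(\<lambda>A\<in>I. ident D (m G A) \<cdot>\<^bsub>D\<^esub> \<alpha> A) = restrict \<alpha> I"
    using hom [of F G \<alpha>] f by (auto intro!: restrict_ext)
  moreover have "restrict \<alpha> I = \<alpha>"
    using ext [of F G \<alpha>] f by (simp add: extensional_restrict)
  ultimately show "f \<cdot>\<^bsub>?C\<^esub> ident ?C (src ?C f) = f" "ident ?C (tgt ?C f) \<cdot>\<^bsub>?C\<^esub> f = f"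
    by (simp_all cong: restrict_cong)
  fix g assume g: "g \<in> arr ?C" "tgt ?C f = src ?C g"
  obtain H \<beta> where [simp]: "g = (G, H, \<beta>)" using g by (cases g) auto
  note [simp] = g [simplified]
  show "g \<cdot>\<^bsub>?C\<^esub> f \<in> hom ?C (src ?C f) (tgt ?C g)"
    using cmp [of F G H \<alpha> \<beta>] f g by simp
  fix h assume h: "h \<in> arr ?C" "tgt ?C g = src ?C h"
  obtain K \<gamma> where [simp]: "h = (H, K, \<gamma>)" using h by (cases h) auto
  show "(h \<cdot>\<^bsub>?C\<^esub> g) \<cdot>\<^bsub>?C\<^esub> f = h \<cdot>\<^bsub>?C\<^esub> g \<cdot>\<^bsub>?C\<^esub> f"
    using hom [of F G \<alpha>] hom [of G H \<beta>] hom [of H K \<gamma>] f g h by (auto intro!: restrict_ext simp: cmp_assoc)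
qed

section \<open>The 2-category of enriched categories\<close>

context closed_symmetric_monoidal
begin

lemma enatural_eq:
  assumes "is_enatural E \<A> \<B> F G \<alpha>" "A \<in> eob \<A>" "B \<in> eob \<A>"
  shows "post \<B> (eob_map F A) (\<alpha> B) \<cdot> ehom_map F (A, B) = pre \<B> (\<alpha> A) (eob_map G B) \<cdot> ehom_map G (A, B)"
  using assms by (simp add: is_enatural_def)

lemma enatural_extensional: "is_enatural E \<A> \<B> F G \<alpha> \<Longrightarrow> \<alpha> \<in> extensional (eob \<A>)"
  by (simp add: is_enatural_def)

lemma enatural_ident:
  assumes F: "is_efunctor E \<A> \<B> F" and [simp]: "is_ecategory E \<A>" "is_ecategory E \<B>"
  shows "is_enatural E \<A> \<B> F F (\<lambda>A\<in>eob \<A>. (eob_map F A, eob_map F A, eid \<B> (eob_map F A)))"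
  using efunctor_typing [OF F] by (simp add: is_enatural_def)

lemma enatural_cmp:
  assumes F: "is_efunctor E \<A> \<B> F" and G: "is_efunctor E \<A> \<B> G" and H: "is_efunctor E \<A> \<B> H"
    and [simp]: "is_ecategory E \<A>" "is_ecategory E \<B>"
    and \<alpha>: "is_enatural E \<A> \<B> F G \<alpha>" and \<beta>: "is_enatural E \<A> \<B> G H \<beta>"
  shows "is_enatural E \<A> \<B> F H (\<lambda>A\<in>eob \<A>. \<beta> A \<cdot>\<^bsub>und E \<B>\<^esub> \<alpha> A)"
proof -
  note [simp] = efunctor_typing [OF F] efunctor_typing [OF G] efunctor_typing [OF H]
    enatural_simps [OF \<alpha>] enatural_simps [OF \<beta>]
  show ?thesis
    by (simp add: is_enatural_def post_cmp pre_cmp cmp_assoc enatural_eq [OF \<alpha>] enatural_eq [OF \<beta>] post_pre')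
qed

text \<open>Move the \<phi> of G out past the image of \<alpha>, apply E-naturality of \<alpha>,
  move that \<phi> back in past the resulting \<open>pre\<close>, and apply E-naturality of
  \<beta>.\<close>

lemma enatural_hcomp:
  assumes F: "is_efunctor E \<A> \<B> F" and F': "is_efunctor E \<A> \<B> F'"
    and G: "is_efunctor E \<B> \<C> G" and G': "is_efunctor E \<B> \<C> G'"
    and [simp]: "is_ecategory E \<A>" "is_ecategory E \<B>" "is_ecategory E \<C>"
    and \<alpha>: "is_enatural E \<A> \<B> F F' \<alpha>" and \<beta>: "is_enatural E \<B> \<C> G G' \<beta>"
  shows "is_enatural E \<A> \<C> (comp_efunctor E \<A> G F) (comp_efunctor E \<A> G' F')
    (\<lambda>A\<in>eob \<A>. \<beta> (eob_map F' A) \<cdot>\<^bsub>und E \<C>\<^esub> uf G (\<alpha> A))"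
proof -
  note [simp] = efunctor_typing [OF F] efunctor_typing [OF F'] efunctor_typing [OF G] efunctor_typing [OF G']
    enatural_simps [OF \<alpha>] enatural_simps [OF \<beta>]
  show ?thesis
    by (simp add: is_enatural_def post_cmp pre_cmp cmp_assoc enatural_eq [OF \<alpha>] post_pre' post_uf [OF G]
        efunctor_pre' [OF G] enatural_apply [OF G G' _ _ _ _ _ _ \<beta>])
qed

lemma comp_efunctor_assoc:
  assumes F: "is_efunctor E \<A> \<B> F" and G: "is_efunctor E \<B> \<C> G" and H: "is_efunctor E \<C> \<D> H"
  shows "comp_efunctor E \<A> (comp_efunctor E \<B> H G) F = comp_efunctor E \<A> H (comp_efunctor E \<A> G F)"
proof -
  note [simp] = efunctor_typing [OF F] efunctor_typing [OF G] efunctor_typing [OF H]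
  show ?thesis
    by (auto simp: comp_efunctor_def cmp_assoc intro!: restrict_ext)
qed

lemma comp_id_efunctor:
  assumes F: "is_efunctor E \<A> \<B> F" and [simp]: "is_ecategory E \<A>" "is_ecategory E \<B>"
  shows "comp_efunctor E \<A> F (id_efunctor E \<A>) = F" "comp_efunctor E \<A> (id_efunctor E \<B>) F = F"
proof -
  note [simp] = efunctor_typing [OF F]
  have "eob_map F = (\<lambda>A\<in>eob \<A>. eob_map F A)" "ehom_map F = (\<lambda>(A, B)\<in>eob \<A> \<times> eob \<A>. ehom_map F (A, B))"
    using efunctor_extensional [OF F] by (simp_all add: extensional_restrict)
  then have F_eq: "\<lparr>eob_map = (\<lambda>A\<in>eob \<A>. eob_map F A), ehom_map = (\<lambda>(A, B)\<in>eob \<A> \<times> eob \<A>. ehom_map F (A, B))\<rparr> = F"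
    by simp
  show "comp_efunctor E \<A> F (id_efunctor E \<A>) = F" "comp_efunctor E \<A> (id_efunctor E \<B>) F = F"
    \<comment> \<open>The second occurrence of F is the right side of the equation. Only that one is
      expanded into a record, for comparison field by field.\<close>
    by (subst (2) F_eq [symmetric], auto simp: comp_efunctor_def intro!: restrict_ext)+
qed

lemma ECat_simps [simp]:
  "ob2 (ECat E) = tensored_ecategories E"
  "hom2 (ECat E) \<A> \<B> = transf_category (eob \<A>) (und E \<B>) eob_map {F. is_efunctor E \<A> \<B> F} (is_enatural E \<A> \<B>)"
  "id1 (ECat E) = id_efunctor E"
  "fob (hcomp (ECat E) \<A> \<B> \<C>) (G, F) = comp_efunctor E \<A> G F"
  "farr (hcomp (ECat E) \<A> \<B> \<C>) ((F2, G2, \<beta>), (F1, G1, \<alpha>)) =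
     (comp_efunctor E \<A> F2 F1, comp_efunctor E \<A> G2 G1,
      \<lambda>A\<in>eob \<A>. \<beta> (eob_map G1 A) \<cdot>\<^bsub>und E \<C>\<^esub> uf F2 (\<alpha> A))"
  by (simp_all add: ECat_def)

lemma StrongCat_simps [simp]:
  "ob2 (StrongCat E) = tensored_ecategories E"
  "hom2 (StrongCat E) \<A> \<B> =
     transf_category (eob \<A>) (und E \<B>) fob {T. is_strong_functor E \<A> \<B> T} (is_strong_natural E \<A> \<B>)"
  "id1 (StrongCat E) = id_strong_functor E"
  "fob (hcomp (StrongCat E) \<A> \<B> \<C>) (T2, T1) = comp_strong_functor E \<A> \<C> T2 T1"
  "farr (hcomp (StrongCat E) \<A> \<B> \<C>) ((S2, T2, \<Psi>2), (S1, T1, \<Psi>1)) =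
     (comp_strong_functor E \<A> \<C> S2 S1, comp_strong_functor E \<A> \<C> T2 T1,
      \<lambda>A\<in>eob \<A>. \<Psi>2 (fob T1 A) \<cdot>\<^bsub>und E \<C>\<^esub> farr S2 (\<Psi>1 A))"
  by (simp_all add: StrongCat_def)

lemma tensored_ecategoriesD [simp]: "\<A> \<in> tensored_ecategories E \<Longrightarrow> is_tensored E \<A>"
  by (simp add: tensored_ecategories_def)

lemma category_hom2_ECat:
  assumes [simp]: "is_tensored E \<A>" "is_tensored E \<B>"
  shows "is_category (hom2 (ECat E) \<A> \<B>)"
  unfolding ECat_simps
  by (rule category_transf_category) (auto simp: efunctor_simps enatural_simps intro: enatural_extensional enatural_ident enatural_cmp)

lemma functor_hcomp_ECat:
  assumes [simp]: "is_tensored E \<A>" "is_tensored E \<B>" "is_tensored E \<C>"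
  shows "is_functor (prod_category (hom2 (ECat E) \<B> \<C>) (hom2 (ECat E) \<A> \<B>)) (hom2 (ECat E) \<A> \<C>) (hcomp (ECat E) \<A> \<B> \<C>)"
proof (rule is_functor_prodI)
  show "fob (hcomp (ECat E) \<A> \<B> \<C>) (G, F) \<in> ob (hom2 (ECat E) \<A> \<C>)"
    "farr (hcomp (ECat E) \<A> \<B> \<C>) (ident (hom2 (ECat E) \<B> \<C>) G, ident (hom2 (ECat E) \<A> \<B>) F) =
       ident (hom2 (ECat E) \<A> \<C>) (fob (hcomp (ECat E) \<A> \<B> \<C>) (G, F))"
    if "G \<in> ob (hom2 (ECat E) \<B> \<C>)" "F \<in> ob (hom2 (ECat E) \<A> \<B>)" for G F
  proof -
    have F: "is_efunctor E \<A> \<B> F" and G: "is_efunctor E \<B> \<C> G"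
      using that by simp_all
    note [simp] = efunctor_typing [OF F] efunctor_typing [OF G]
    show "fob (hcomp (ECat E) \<A> \<B> \<C>) (G, F) \<in> ob (hom2 (ECat E) \<A> \<C>)"
      "farr (hcomp (ECat E) \<A> \<B> \<C>) (ident (hom2 (ECat E) \<B> \<C>) G, ident (hom2 (ECat E) \<A> \<B>) F) =
        ident (hom2 (ECat E) \<A> \<C>) (fob (hcomp (ECat E) \<A> \<B> \<C>) (G, F))"
      by (auto simp: comp_efunctor [OF F G] uf_ident [OF G] intro!: restrict_ext)
  qed
  show "farr (hcomp (ECat E) \<A> \<B> \<C>) (g, f) \<in> hom (hom2 (ECat E) \<A> \<C>)
      (fob (hcomp (ECat E) \<A> \<B> \<C>) (src (hom2 (ECat E) \<B> \<C>) g, src (hom2 (ECat E) \<A> \<B>) f))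
      (fob (hcomp (ECat E) \<A> \<B> \<C>) (tgt (hom2 (ECat E) \<B> \<C>) g, tgt (hom2 (ECat E) \<A> \<B>) f))"
    if "g \<in> arr (hom2 (ECat E) \<B> \<C>)" "f \<in> arr (hom2 (ECat E) \<A> \<B>)" for g f
    using that by (cases f; cases g) (auto intro: comp_efunctor enatural_hcomp)
  show "farr (hcomp (ECat E) \<A> \<B> \<C>) (g' \<cdot>\<^bsub>hom2 (ECat E) \<B> \<C>\<^esub> g, f' \<cdot>\<^bsub>hom2 (ECat E) \<A> \<B>\<^esub> f) =
      farr (hcomp (ECat E) \<A> \<B> \<C>) (g', f') \<cdot>\<^bsub>hom2 (ECat E) \<A> \<C>\<^esub> farr (hcomp (ECat E) \<A> \<B> \<C>) (g, f)"
    if g: "g \<in> arr (hom2 (ECat E) \<B> \<C>)" "g' \<in> arr (hom2 (ECat E) \<B> \<C>)" "tgt (hom2 (ECat E) \<B> \<C>) g = src (hom2 (ECat E) \<B> \<C>) g'"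
      and f: "f \<in> arr (hom2 (ECat E) \<A> \<B>)" "f' \<in> arr (hom2 (ECat E) \<A> \<B>)" "tgt (hom2 (ECat E) \<A> \<B>) f = src (hom2 (ECat E) \<A> \<B>) f'"
    for g f g' f'
  proof -
    obtain F1 G1 H1 \<alpha> \<alpha>' where f_eq: "f = (F1, G1, \<alpha>)" "f' = (G1, H1, \<alpha>')"
      using f by (cases f; cases f') auto
    obtain F2 G2 H2 \<beta> \<beta>' where g_eq: "g = (F2, G2, \<beta>)" "g' = (G2, H2, \<beta>')"
      using g by (cases g; cases g') auto
    have functors: "is_efunctor E \<A> \<B> F1" "is_efunctor E \<A> \<B> G1" "is_efunctor E \<A> \<B> H1"
      "is_efunctor E \<B> \<C> F2" "is_efunctor E \<B> \<C> G2" "is_efunctor E \<B> \<C> H2"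
      and transformations: "is_enatural E \<A> \<B> F1 G1 \<alpha>" "is_enatural E \<A> \<B> G1 H1 \<alpha>'"
        "is_enatural E \<B> \<C> F2 G2 \<beta>" "is_enatural E \<B> \<C> G2 H2 \<beta>'"
      using f g by (simp_all add: f_eq g_eq)
    note [simp] = functors [THEN efunctor_simps(1)] functors [THEN uf_typing(1)] functors [THEN uf_typing(2)] functors [THEN uf_typing(3)]
      transformations [THEN enatural_simps(1)] transformations [THEN enatural_simps(2)] transformations [THEN enatural_simps(3)]
    have "(\<beta>' (eob_map H1 A) \<cdot>\<^bsub>und E \<C>\<^esub> \<beta> (eob_map H1 A)) \<cdot>\<^bsub>und E \<C>\<^esub> uf F2 (\<alpha>' A \<cdot>\<^bsub>und E \<B>\<^esub> \<alpha> A) =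
      (\<beta>' (eob_map H1 A) \<cdot>\<^bsub>und E \<C>\<^esub> uf G2 (\<alpha>' A)) \<cdot>\<^bsub>und E \<C>\<^esub> \<beta> (eob_map G1 A) \<cdot>\<^bsub>und E \<C>\<^esub> uf F2 (\<alpha> A)"
      if [simp]: "A \<in> eob \<A>" for A
    proof -
      \<comment> \<open>The interchange law comes down to naturality of \<beta> at the underlying
        arrow \<alpha>' A, which exchanges the two middle factors.\<close>
      have "\<beta> (eob_map H1 A) \<cdot>\<^bsub>und E \<C>\<^esub> uf F2 (\<alpha>' A) = uf G2 (\<alpha>' A) \<cdot>\<^bsub>und E \<C>\<^esub> \<beta> (eob_map G1 A)"
        using enatural_natural [OF functors(4,5) _ _ transformations(3), of "\<alpha>' A"] by simp
      then have "(\<beta> (eob_map H1 A) \<cdot>\<^bsub>und E \<C>\<^esub> uf F2 (\<alpha>' A)) \<cdot>\<^bsub>und E \<C>\<^esub> uf F2 (\<alpha> A) =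
         (uf G2 (\<alpha>' A) \<cdot>\<^bsub>und E \<C>\<^esub> \<beta> (eob_map G1 A)) \<cdot>\<^bsub>und E \<C>\<^esub> uf F2 (\<alpha> A)"
        by simp
      then show ?thesis
        by (simp add: uf_cmp [OF functors(4)] cmp_assoc)
    qed
    then show ?thesis
      by (auto simp: f_eq g_eq intro!: restrict_ext)
  qed
qed

lemma two_category_ECat: "is_two_category (ECat E :: (('x, 'o, 'a) tensored_ecategory, _, _) two_category)"
  unfolding is_two_category_def
proof (intro conjI ballI)
  fix \<A> :: "('x, 'o, 'a) tensored_ecategory" assume "\<A> \<in> ob2 (ECat E)"
  then have [simp]: "is_tensored E \<A>" by simp
  show "id1 (ECat E) \<A> \<in> ob (hom2 (ECat E) \<A> \<A>)"
    by (simp add: id_efunctor)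
  fix \<B> :: "('x, 'o, 'a) tensored_ecategory" assume "\<B> \<in> ob2 (ECat E)"
  then have [simp]: "is_tensored E \<B>" by simp
  show "is_category (hom2 (ECat E) \<A> \<B>)"
    by (rule category_hom2_ECat) simp_all
  show "fob (hcomp (ECat E) \<A> \<A> \<B>) (F, id1 (ECat E) \<A>) = F" "fob (hcomp (ECat E) \<A> \<B> \<B>) (id1 (ECat E) \<B>, F) = F"
    if "F \<in> ob (hom2 (ECat E) \<A> \<B>)" for F
    using that by (simp_all add: comp_id_efunctor)
  show "farr (hcomp (ECat E) \<A> \<A> \<B>) (f, ident (hom2 (ECat E) \<A> \<A>) (id1 (ECat E) \<A>)) = f"
    "farr (hcomp (ECat E) \<A> \<B> \<B>) (ident (hom2 (ECat E) \<B> \<B>) (id1 (ECat E) \<B>), f) = f"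
    if "f \<in> arr (hom2 (ECat E) \<A> \<B>)" for f
  proof -
    note arr = that
    obtain F G \<alpha> where f: "f = (F, G, \<alpha>)" and F: "is_efunctor E \<A> \<B> F" and G: "is_efunctor E \<A> \<B> G"
      and \<alpha>: "is_enatural E \<A> \<B> F G \<alpha>"
      using arr by (cases f) auto
    note [simp] = efunctor_typing [OF F] efunctor_typing [OF G] enatural_simps [OF \<alpha>]
    have "(\<lambda>A\<in>eob \<A>. \<alpha> A) = \<alpha>"
      using enatural_extensional [OF \<alpha>] by (simp add: extensional_restrict)
    then show "farr (hcomp (ECat E) \<A> \<A> \<B>) (f, ident (hom2 (ECat E) \<A> \<A>) (id1 (ECat E) \<A>)) = f"
      "farr (hcomp (ECat E) \<A> \<B> \<B>) (ident (hom2 (ECat E) \<B> \<B>) (id1 (ECat E) \<B>), f) = f"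
      by (simp_all add: f comp_id_efunctor [OF F] comp_id_efunctor [OF G] uf_ident [OF F] uf_id cong: restrict_cong)
  qed
  fix \<C> :: "('x, 'o, 'a) tensored_ecategory" assume "\<C> \<in> ob2 (ECat E)"
  then have [simp]: "is_tensored E \<C>" by simp
  show "is_functor (prod_category (hom2 (ECat E) \<B> \<C>) (hom2 (ECat E) \<A> \<B>)) (hom2 (ECat E) \<A> \<C>) (hcomp (ECat E) \<A> \<B> \<C>)"
    by (rule functor_hcomp_ECat) simp_all
  fix \<D> :: "('x, 'o, 'a) tensored_ecategory" assume "\<D> \<in> ob2 (ECat E)"
  then have [simp]: "is_tensored E \<D>" by simp
  show "fob (hcomp (ECat E) \<A> \<B> \<D>) (fob (hcomp (ECat E) \<B> \<C> \<D>) (H, G), F) =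
       fob (hcomp (ECat E) \<A> \<C> \<D>) (H, fob (hcomp (ECat E) \<A> \<B> \<C>) (G, F))"
    if "H \<in> ob (hom2 (ECat E) \<C> \<D>)" "G \<in> ob (hom2 (ECat E) \<B> \<C>)" "F \<in> ob (hom2 (ECat E) \<A> \<B>)" for H G F
    using that by (simp add: comp_efunctor_assoc)
  show "farr (hcomp (ECat E) \<A> \<B> \<D>) (farr (hcomp (ECat E) \<B> \<C> \<D>) (h, g), f) =
       farr (hcomp (ECat E) \<A> \<C> \<D>) (h, farr (hcomp (ECat E) \<A> \<B> \<C>) (g, f))"
    if "h \<in> arr (hom2 (ECat E) \<C> \<D>)" "g \<in> arr (hom2 (ECat E) \<B> \<C>)" "f \<in> arr (hom2 (ECat E) \<A> \<B>)" for h g f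
  proof -
    obtain F1 G1 \<alpha> F2 G2 \<beta> F3 G3 \<gamma> where eqs: "f = (F1, G1, \<alpha>)" "g = (F2, G2, \<beta>)" "h = (F3, G3, \<gamma>)"
      by (cases f; cases g; cases h)
    have functors: "is_efunctor E \<A> \<B> F1" "is_efunctor E \<A> \<B> G1" "is_efunctor E \<B> \<C> F2" "is_efunctor E \<B> \<C> G2"
      "is_efunctor E \<C> \<D> F3" "is_efunctor E \<C> \<D> G3"
      and transformations: "is_enatural E \<A> \<B> F1 G1 \<alpha>" "is_enatural E \<B> \<C> F2 G2 \<beta>" "is_enatural E \<C> \<D> F3 G3 \<gamma>"
      using that by (simp_all add: eqs)
    note [simp] = functors [THEN efunctor_simps(1)] functors [THEN uf_typing(1)] functors [THEN uf_typing(2)] functors [THEN uf_typing(3)]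
      transformations [THEN enatural_simps(1)] transformations [THEN enatural_simps(2)] transformations [THEN enatural_simps(3)]
    show ?thesis
      by (auto simp: eqs comp_efunctor_assoc [OF functors(1,3,5)] comp_efunctor_assoc [OF functors(2,4,6)]
          uf_comp [OF functors(3,5)] uf_cmp [OF functors(5)] cmp_assoc intro!: restrict_ext)
  qed
qed

section \<open>The 2-isomorphism\<close>

definition strong_of_functor where
  "strong_of_functor \<A> \<B> = \<lparr> fob = strong_of \<A> \<B>, farr = (\<lambda>(F, G, \<alpha>). (strong_of \<A> \<B> F, strong_of \<A> \<B> G, \<alpha>)) \<rparr>"

lemma strong_of_functor_simps [simp]:
  "fob (strong_of_functor \<A> \<B>) = strong_of \<A> \<B>"
  "farr (strong_of_functor \<A> \<B>) (F, G, \<alpha>) = (strong_of \<A> \<B> F, strong_of \<A> \<B> G, \<alpha>)"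
  by (simp_all add: strong_of_functor_def)

text \<open>\<open>ECat E\<close> takes the role of K in the transport, hence the comparison runs
  from E-functors to strong functors, against the order in the statement. On 2-cells it keeps the
  components.\<close>

lemma two_isomorphic_StrongCat_ECat:
  "two_isomorphic
    (StrongCat E :: (('x, 'o, 'a) tensored_ecategory, _, _) two_category)
    (ECat E :: (('x, 'o, 'a) tensored_ecategory, _, _) two_category)"
proof (rule two_isomorphic_transport [where \<Phi> = strong_of_functor, OF two_category_ECat])
  show "ob2 (StrongCat E :: (('x, 'o, 'a) tensored_ecategory, _, _) two_category) = ob2 (ECat E)"
    by simp
next
  fix \<A> :: "('x, 'o, 'a) tensored_ecategory" assume "\<A> \<in> ob2 (ECat E)"
  then have [simp]: "is_tensored E \<A>" by simp
  show "fob (strong_of_functor \<A> \<A>) (id1 (ECat E) \<A>) = id1 (StrongCat E) \<A>"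
    by (simp add: strong_of_id)
next
  fix \<A> \<B> :: "('x, 'o, 'a) tensored_ecategory" assume "\<A> \<in> ob2 (ECat E)" "\<B> \<in> ob2 (ECat E)"
  then have [simp]: "is_tensored E \<A>" "is_tensored E \<B>" by simp_all
  show "is_functor (hom2 (ECat E) \<A> \<B>) (hom2 (StrongCat E) \<A> \<B>) (strong_of_functor \<A> \<B>)"
    unfolding is_functor_def
    by (auto simp: strong_functor_strong_of enatural_iff_strong_natural)
  show "bij_betw (fob (strong_of_functor \<A> \<B>)) (ob (hom2 (ECat E) \<A> \<B>)) (ob (hom2 (StrongCat E) \<A> \<B>))"
    by (simp add: bij_betw_strong_of)
  show "bij_betw (farr (strong_of_functor \<A> \<B>)) (arr (hom2 (ECat E) \<A> \<B>)) (arr (hom2 (StrongCat E) \<A> \<B>))"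
  proof (rule bij_betw_byWitness [where f' = "\<lambda>(S, T, \<alpha>). (efunctor_of \<A> \<B> S, efunctor_of \<A> \<B> T, \<alpha>)"])
    show "(\<lambda>(S, T, \<alpha>). (efunctor_of \<A> \<B> S, efunctor_of \<A> \<B> T, \<alpha>)) ` arr (hom2 (StrongCat E) \<A> \<B>) \<subseteq> arr (hom2 (ECat E) \<A> \<B>)"
      \<comment> \<open>\<open>enatural_iff_strong_natural\<close> speaks of 1-cells of the form
        \<open>strong_of\<close>; rewriting with \<open>strong_of_efunctor_of\<close> gives it for
        arbitrary strong functors.\<close>
      by (auto simp: efunctor_efunctor_of enatural_iff_strong_natural strong_of_efunctor_of)
  qed (auto simp: efunctor_of_strong_of strong_of_efunctor_of strong_functor_strong_of enatural_iff_strong_natural)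
next
  fix \<A> \<B> \<C> :: "('x, 'o, 'a) tensored_ecategory"
  assume "\<A> \<in> ob2 (ECat E)" "\<B> \<in> ob2 (ECat E)" "\<C> \<in> ob2 (ECat E)"
  then have [simp]: "is_tensored E \<A>" "is_tensored E \<B>" "is_tensored E \<C>" by simp_all
  show "fob (strong_of_functor \<A> \<C>) (fob (hcomp (ECat E) \<A> \<B> \<C>) (G, F)) =
      fob (hcomp (StrongCat E) \<A> \<B> \<C>) (fob (strong_of_functor \<B> \<C>) G, fob (strong_of_functor \<A> \<B>) F)"
    if "G \<in> ob (hom2 (ECat E) \<B> \<C>)" "F \<in> ob (hom2 (ECat E) \<A> \<B>)" for G F
    using that by (simp add: strong_of_comp)
  show "farr (strong_of_functor \<A> \<C>) (farr (hcomp (ECat E) \<A> \<B> \<C>) (g, f)) =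
      farr (hcomp (StrongCat E) \<A> \<B> \<C>) (farr (strong_of_functor \<B> \<C>) g, farr (strong_of_functor \<A> \<B>) f)"
    if "g \<in> arr (hom2 (ECat E) \<B> \<C>)" "f \<in> arr (hom2 (ECat E) \<A> \<B>)" for g f
    using that by (cases f; cases g) (auto simp: strong_of_comp enatural_simps intro!: restrict_ext)
qed

end

theorem theorem3p3p5:
  fixes E :: "('o, 'a) monoidal_category"
  assumes "is_closed_symmetric_monoidal E"
  shows "two_isomorphic
    (StrongCat E :: (('x, 'o, 'a) tensored_ecategory, _, _) two_category)
    (ECat E :: (('x, 'o, 'a) tensored_ecategory, _, _) two_category)"
proof -
  interpret closed_symmetric_monoidal E
    by standard (rule assms)
  show ?thesis
    by (rule two_isomorphic_StrongCat_ECat)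
qed

end
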